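(* Let $\mathcal A=\mathcal A(\Sigma)$ be the cluster algebra associated with a totally mutable acyclic seed $\Sigma$. Then: \begin{itemize} \item $\mathcal A$ is generated (as a $\mathbb{ZP}$-algebra) by $x_1,x_1',\dots,x_n,x_n'$. \item The standard monomials in $x_1,x_1',\dots,x_n,x_n'$ form a $\mathbb{ZP}$-basis of $\mathcal A$. \item The polynomials $x_jx_j'-P_j(\mathbf x)$, for $j\in\{1,\dots,n\}$, generate the ideal $\mathcal I$ of relations among the generators $x_1,\dots,x_n,x_1',\dots,x_n'$. \item These polynomials form a Gr\"obner basis for $\mathcal I$ with respect to any term order in which $x_1',\dots,x_n'$ are much more expensive than $x_1,\dots,x_n$. \end{itemize}
   Context: Let $\mathbb P$ be a torsion-free abelian group, written multiplicatively, $\mathbb{ZP}$ its integer group ring, $n\ge 1$, and $\mathcal F$ a field isomorphic to the field of rational functions in $n$ independent variables over the fraction field of $\mathbb{ZP}$. A seed in $\mathcal F$ is a triple $\Sigma=(\mathbf x,\mathbf p,B)$ where: $\mathbf x=\{x_1,\dots,x_n\}$ (the cluster; its elements are the cluster variables) is a transcendence basis of $\mathcal F$ over the fraction field of $\mathbb{ZP}$ (so that $\mathcal F$ is the field of rational functions in $\mathbf x$); $\mathbf p=(p_1^\pm,\dots,p_n^\pm)$ is a $2n$-tuple of elements of $\mathbb P$; $B=(b_{ij})$ is an $n\times n$ integer matrix (the exchange matrix) which is sign-skew-symmetric, i.e. for all $i,j$ either $b_{ij}=b_{ji}=0$ or $b_{ij}b_{ji}<0$. Seeds differing by a simultaneous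 relabeling are identified. For $j\in\{1,\dots,n\}$ put $P_j(\mathbf x)=p_j^+\prod_{b_{ij}>0}x_i^{b_{ij}}+p_j^-\prod_{b_{ij}<0}x_i^{-b_{ij}}$, define $x_j'\in\mathcal F$ by $x_jx_j'=P_j(\mathbf x)$, and let $\mathbf x_j=(\mathbf x-\{x_j\})\cup\{x_j'\}$. A monomial in $x_1,x_1',\dots,x_n,x_n'$ is standard if it contains no product of the form $x_jx_j'$. The seed is acyclic if the directed graph with vertices $1,\dots,n$ and edges $(i,j)$ for $b_{ij}>0$ has no oriented cycles. Matrix mutation in direction $k$: $\mu_k(B)=(b'_{ij})$ with $b'_{ij}=-b_{ij}$ if $i=k$ or $j=k$, and $b'_{ij}=b_{ij}+\frac{|b_{ik}|b_{kj}+b_{ik}|b_{kj}|}{2}$ otherwise. A seed $\Sigma'=(\mathbf x',\mathbf p',B')$ is obtained from $\Sigma$ by a seed mutation in direction $k$ if $\mathbf x'=\mathbf x_k$, $B'=\mu_k(B)$, $p_k'^{\pm}=p_k^{\mp}$, and for $i\ne k$: $p_i'^+/p_i'^-=(p_k^+)^{b_{ki}}p_i^+/p_i^-$ if $b_{ki}\ge0$ and $p_i'^+/p_i'^-=(p_k^-)^{b_{ki}}p_i^+/p_i^-$ if $b_{ki}\le 0$. Mutation equivalence $\sim$ of seeds (or matrices) is the equivalence relation generated by mutations. A seed is totally mutable if every matrix mutation equivalent to its exchange matrix is sign-skew-symmetric. For a totally mutable seed $\Sigma$, the cluster algebra $\mathcal A(\Sigma)$ is the $\mathbb{ZP}$-subalgebra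 of $\mathcal F$ generated by all cluster variables from all seeds mutation equivalent to $\Sigma$. The ideal of relations $\mathcal I$ is the kernel of the natural map from the polynomial ring over $\mathbb{ZP}$ in $2n$ indeterminates named $x_1,\dots,x_n,x_1',\dots,x_n'$ to $\mathcal F$. "Much more expensive" means that the term order is such that, for every $j$, the monomial $x_jx_j'$ is larger than each of the monomials occurring in $P_j(\mathbf x)$. *)

theory Defs
  imports "HOL-Library.Poly_Mapping" "HOL-Computational_Algebra.Polynomial" "HOL.Hull"
begin

section \<open>The coefficient group and its group ring\<close>

text \<open>
  The coefficient group is a type of class \<open>ab_group_add\<close>, i.e. it is written additively;
  \<open>int_mult k a\<close> is what multiplicative notation calls the power of \<open>a\<close> with exponent \<open>k\<close>.
  With this convention \<^typ>\<open>'p \<Rightarrow>\<^sub>0 int\<close> with its convolution product is the integer group ring,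
  and the group element \<open>a\<close> is the ring element \<open>Poly_Mapping.single a 1\<close>.
\<close>

type_synonym 'p group_ring = "'p \<Rightarrow>\<^sub>0 int"

definition int_mult :: "int \<Rightarrow> 'p::ab_group_add \<Rightarrow> 'p" where
  "int_mult k a = (if 0 \<le> k then (\<Sum>_<nat k. a) else - (\<Sum>_<nat (- k). a))"

definition torsion_free :: "'p::ab_group_add itself \<Rightarrow> bool" where
  "torsion_free _ \<longleftrightarrow> (\<forall>(a::'p) k. k \<noteq> 0 \<longrightarrow> int_mult k a = 0 \<longrightarrow> a = 0)"


section \<open>Multivariate polynomials\<close>

type_synonym 'v power_product = "'v \<Rightarrow>\<^sub>0 nat"
type_synonym ('v, 'r) mpoly = "'v power_product \<Rightarrow>\<^sub>0 'r"

definition mp_const :: "'r::zero \<Rightarrow> ('v, 'r) mpoly" where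
  "mp_const c = Poly_Mapping.single 0 c"

definition mp_var :: "'v \<Rightarrow> ('v, 'r::zero_neq_one) mpoly" where
  "mp_var v = Poly_Mapping.single (Poly_Mapping.single v 1) 1"

definition pp_eval :: "('v \<Rightarrow> 'f::comm_ring_1) \<Rightarrow> 'v power_product \<Rightarrow> 'f" where
  "pp_eval y m = (\<Prod>v\<in>Poly_Mapping.keys m. y v ^ Poly_Mapping.lookup m v)"

text \<open>Evaluation at \<open>y\<close>, where coefficients are transported by \<open>h\<close>.\<close>

definition mp_eval :: "('r::zero \<Rightarrow> 'f::comm_ring_1) \<Rightarrow> ('v \<Rightarrow> 'f) \<Rightarrow> ('v, 'r) mpoly \<Rightarrow> 'f" where
  "mp_eval h y p = (\<Sum>m\<in>Poly_Mapping.keys p. h (Poly_Mapping.lookup p m) * pp_eval y m)"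


section \<open>The ambient field\<close>

text \<open>
  Throughout, \<open>\<iota>\<close> is the inclusion of the group ring into the ambient field \<^typ>\<open>'f\<close>, and
  \<open>coeff_field \<iota>\<close> is the fraction field of the group ring, viewed inside \<^typ>\<open>'f\<close>.
\<close>

definition ring_embedding :: "('r::comm_ring_1 \<Rightarrow> 'f::comm_ring_1) \<Rightarrow> bool" where
  "ring_embedding \<iota> \<longleftrightarrow> inj \<iota> \<and> \<iota> 1 = 1 \<and>
     (\<forall>a b. \<iota> (a + b) = \<iota> a + \<iota> b) \<and> (\<forall>a b. \<iota> (a * b) = \<iota> a * \<iota> b)"

definition coeff_field :: "('r::comm_ring_1 \<Rightarrow> 'f::field) \<Rightarrow> 'f set" where
  "coeff_field \<iota> = {\<iota> a / \<iota> b | a b. b \<noteq> 0}"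

definition subfield_of :: "'f::field set \<Rightarrow> bool" where
  "subfield_of S \<longleftrightarrow> 0 \<in> S \<and> 1 \<in> S \<and> (\<forall>a\<in>S. \<forall>b\<in>S. a - b \<in> S) \<and> (\<forall>a\<in>S. \<forall>b\<in>S. a * b \<in> S) \<and>
     (\<forall>a\<in>S. inverse a \<in> S)"

definition adjoin :: "'f::field set \<Rightarrow> ('v \<Rightarrow> 'f) \<Rightarrow> 'f set" where
  "adjoin K y = subfield_of hull (K \<union> range y)"

definition alg_independent :: "'f::field set \<Rightarrow> ('v \<Rightarrow> 'f) \<Rightarrow> bool" where
  "alg_independent K y \<longleftrightarrow>
     (\<forall>p :: ('v, 'f) mpoly. Poly_Mapping.range p \<subseteq> K \<longrightarrow> mp_eval (\<lambda>c. c) y p = 0 \<longrightarrow> p = 0)"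

definition algebraic_over :: "'f::field set \<Rightarrow> 'f \<Rightarrow> bool" where
  "algebraic_over K a \<longleftrightarrow> (\<exists>q. q \<noteq> 0 \<and> (\<forall>i. coeff q i \<in> K) \<and> poly q a = 0)"

definition transcendence_basis :: "'f::field set \<Rightarrow> ('v \<Rightarrow> 'f) \<Rightarrow> bool" where
  "transcendence_basis K y \<longleftrightarrow> alg_independent K y \<and> (\<forall>a. algebraic_over (adjoin K y) a)"

text \<open>
  The field \<^typ>\<open>'f\<close> is, up to isomorphism, the field of rational functions over \<open>coeff_field \<iota>\<close> in
  independent variables indexed by \<^typ>\<open>'n\<close>.
\<close>

definition ambient_field ::
    "'n itself \<Rightarrow> ('p::ab_group_add group_ring \<Rightarrow> 'f::field) \<Rightarrow> bool" where
  "ambient_field _ \<iota> \<longleftrightarrow> ring_embedding \<iota> \<and>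
     (\<exists>y :: 'n \<Rightarrow> 'f. alg_independent (coeff_field \<iota>) y \<and> adjoin (coeff_field \<iota>) y = UNIV)"


section \<open>Seeds\<close>

record ('n, 'p, 'f) seed =
  cluster :: "'n \<Rightarrow> 'f"
  pplus :: "'n \<Rightarrow> 'p"
  pminus :: "'n \<Rightarrow> 'p"
  exch :: "'n \<Rightarrow> 'n \<Rightarrow> int"

definition sign_skew_symmetric :: "('n \<Rightarrow> 'n \<Rightarrow> int) \<Rightarrow> bool" where
  "sign_skew_symmetric B \<longleftrightarrow> (\<forall>i j. (B i j = 0 \<and> B j i = 0) \<or> B i j * B j i < 0)"

text \<open>
  A transcendence basis alone (such as the square of a variable) need not generate the field;
  a cluster is required to do so.
\<close>

definition is_seed ::
    "('p::ab_group_add group_ring \<Rightarrow> 'f::field) \<Rightarrow> ('n, 'p, 'f) seed \<Rightarrow> bool" where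
  "is_seed \<iota> S \<longleftrightarrow> transcendence_basis (coeff_field \<iota>) (cluster S) \<and>
     adjoin (coeff_field \<iota>) (cluster S) = UNIV \<and> sign_skew_symmetric (exch S)"

text \<open>
  The exchange polynomial \<open>P\<^sub>j\<close>, with variables \<open>y\<close> and coefficients transported by \<open>h\<close>. It is
  used both in the ambient field and in the polynomial ring in \<open>2n\<close> indeterminates.
\<close>

definition exchange_poly ::
    "('p group_ring \<Rightarrow> 'a::comm_ring_1) \<Rightarrow> ('n::finite \<Rightarrow> 'a) \<Rightarrow> ('n, 'p, 'f) seed \<Rightarrow> 'n \<Rightarrow> 'a" where
  "exchange_poly h y S j =
     h (Poly_Mapping.single (pplus S j) 1) * (\<Prod>i | exch S i j > 0. y i ^ nat (exch S i j)) +
     h (Poly_Mapping.single (pminus S j) 1) * (\<Prod>i | exch S i j < 0. y i ^ nat (- exch S i j))"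

definition new_var ::
    "('p group_ring \<Rightarrow> 'f::field) \<Rightarrow> ('n::finite, 'p, 'f) seed \<Rightarrow> 'n \<Rightarrow> 'f" where
  "new_var \<iota> S j = exchange_poly \<iota> (cluster S) S j / cluster S j"

definition acyclic_seed :: "('n, 'p, 'f) seed \<Rightarrow> bool" where
  "acyclic_seed S \<longleftrightarrow> acyclic {(i, j). exch S i j > 0}"


section \<open>Mutations and the cluster algebra\<close>

text \<open>The division by 2 is exact.\<close>

definition matrix_mutation :: "'n \<Rightarrow> ('n \<Rightarrow> 'n \<Rightarrow> int) \<Rightarrow> 'n \<Rightarrow> 'n \<Rightarrow> int" where
  "matrix_mutation k B = (\<lambda>i j. if i = k \<or> j = k then - B i j
     else B i j + (\<bar>B i k\<bar> * B k j + B i k * \<bar>B k j\<bar>) div 2)"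

definition matrix_mutation_equiv ::
    "('n \<Rightarrow> 'n \<Rightarrow> int) \<Rightarrow> ('n \<Rightarrow> 'n \<Rightarrow> int) \<Rightarrow> bool" where
  "matrix_mutation_equiv = equivclp (\<lambda>B B'. \<exists>k. B' = matrix_mutation k B)"

definition totally_mutable :: "('n, 'p, 'f) seed \<Rightarrow> bool" where
  "totally_mutable S \<longleftrightarrow> (\<forall>B. matrix_mutation_equiv (exch S) B \<longrightarrow> sign_skew_symmetric B)"

text \<open>
  Only the quotients \<open>p\<^sub>i\<^sup>+ / p\<^sub>i\<^sup>-\<close> (here: differences) of the new coefficients with \<open>i \<noteq> k\<close> are
  prescribed, so mutation is a relation and not a function.
\<close>

definition seed_mutation ::
    "('p::ab_group_add group_ring \<Rightarrow> 'f::field) \<Rightarrow> 'n \<Rightarrow>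
     ('n::finite, 'p, 'f) seed \<Rightarrow> ('n, 'p, 'f) seed \<Rightarrow> bool" where
  "seed_mutation \<iota> k S S' \<longleftrightarrow> is_seed \<iota> S \<and> is_seed \<iota> S' \<and>
     cluster S' = (cluster S)(k := new_var \<iota> S k) \<and>
     exch S' = matrix_mutation k (exch S) \<and>
     pplus S' k = pminus S k \<and> pminus S' k = pplus S k \<and>
     (\<forall>i. i \<noteq> k \<longrightarrow>
        (exch S k i \<ge> 0 \<longrightarrow>
           pplus S' i - pminus S' i = int_mult (exch S k i) (pplus S k) + (pplus S i - pminus S i)) \<and>
        (exch S k i \<le> 0 \<longrightarrow>
           pplus S' i - pminus S' i = int_mult (exch S k i) (pminus S k) + (pplus S i - pminus S i)))"

text \<open>
  Seeds that differ by a simultaneous relabeling are identified; as \<^typ>\<open>('n, 'p, 'f) seed\<close> is the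
  type of labeled seeds, relabelings are added to the generators of mutation equivalence.
\<close>

definition seed_relabeling :: "('n, 'p, 'f) seed \<Rightarrow> ('n, 'p, 'f) seed \<Rightarrow> bool" where
  "seed_relabeling S S' \<longleftrightarrow> (\<exists>\<sigma>. bij \<sigma> \<and>
     cluster S' = cluster S \<circ> \<sigma> \<and> pplus S' = pplus S \<circ> \<sigma> \<and> pminus S' = pminus S \<circ> \<sigma> \<and>
     exch S' = (\<lambda>i j. exch S (\<sigma> i) (\<sigma> j)))"

definition seed_mutation_equiv ::
    "('p::ab_group_add group_ring \<Rightarrow> 'f::field) \<Rightarrow>
     ('n::finite, 'p, 'f) seed \<Rightarrow> ('n, 'p, 'f) seed \<Rightarrow> bool" where
  "seed_mutation_equiv \<iota> =
     equivclp (\<lambda>S S'. (\<exists>k. seed_mutation \<iota> k S S') \<or> seed_relabeling S S')"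

text \<open>Subalgebras are unital; they contain the image of \<open>- 1\<close> and hence are closed under negation.\<close>

definition is_subalgebra :: "('r::comm_ring_1 \<Rightarrow> 'f::comm_ring_1) \<Rightarrow> 'f set \<Rightarrow> bool" where
  "is_subalgebra \<iota> A \<longleftrightarrow> range \<iota> \<subseteq> A \<and> (\<forall>a\<in>A. \<forall>b\<in>A. a + b \<in> A) \<and> (\<forall>a\<in>A. \<forall>b\<in>A. a * b \<in> A)"

definition cluster_algebra ::
    "('p::ab_group_add group_ring \<Rightarrow> 'f::field) \<Rightarrow> ('n::finite, 'p, 'f) seed \<Rightarrow> 'f set" where
  "cluster_algebra \<iota> S =
     is_subalgebra \<iota> hull (\<Union>S' \<in> {S'. seed_mutation_equiv \<iota> S S'}. range (cluster S'))"


section \<open>Standard monomials and the ideal of relations\<close>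

text \<open>The \<open>2n\<close> indeterminates: \<open>Vx j\<close> is named \<open>x\<^sub>j\<close> and \<open>Vx' j\<close> is named \<open>x\<^sub>j'\<close>.\<close>

datatype 'n var = Vx 'n | Vx' 'n

primrec generator ::
    "('p group_ring \<Rightarrow> 'f::field) \<Rightarrow> ('n::finite, 'p, 'f) seed \<Rightarrow> 'n var \<Rightarrow> 'f" where
  "generator \<iota> S (Vx j) = cluster S j"
| "generator \<iota> S (Vx' j) = new_var \<iota> S j"

definition standard_pps :: "'n var power_product set" where
  "standard_pps =
     {m. \<forall>j. Poly_Mapping.lookup m (Vx j) = 0 \<or> Poly_Mapping.lookup m (Vx' j) = 0}"

text \<open>
  The family \<open>b\<close> restricted to \<open>I\<close> is a basis of \<open>M\<close> as a module over the coefficient ring acting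
  through \<open>\<iota>\<close>. Injectivity is needed since \<^const>\<open>module.dependent\<close> is about sets.
\<close>

definition is_basis_of ::
    "('r::comm_ring_1 \<Rightarrow> 'f::comm_ring_1) \<Rightarrow> ('i \<Rightarrow> 'f) \<Rightarrow> 'i set \<Rightarrow> 'f set \<Rightarrow> bool" where
  "is_basis_of \<iota> b I M \<longleftrightarrow> inj_on b I \<and>
     \<not> module.dependent (\<lambda>c a. \<iota> c * a) (b ` I) \<and>
     module.span (\<lambda>c a. \<iota> c * a) (b ` I) = M"

definition relation_ideal ::
    "('p::ab_group_add group_ring \<Rightarrow> 'f::field) \<Rightarrow> ('n::finite, 'p, 'f) seed \<Rightarrow>
     ('n var, 'p group_ring) mpoly set" where
  "relation_ideal \<iota> S = {p. mp_eval \<iota> (generator \<iota> S) p = 0}"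

definition formal_exchange_poly ::
    "('n::finite, 'p::ab_group_add, 'f) seed \<Rightarrow> 'n \<Rightarrow> ('n var, 'p group_ring) mpoly" where
  "formal_exchange_poly S j = exchange_poly mp_const (\<lambda>i. mp_var (Vx i)) S j"

definition exchange_relation ::
    "('n::finite, 'p::ab_group_add, 'f) seed \<Rightarrow> 'n \<Rightarrow> ('n var, 'p group_ring) mpoly" where
  "exchange_relation S j = mp_var (Vx j) * mp_var (Vx' j) - formal_exchange_poly S j"


section \<open>Groebner bases over a commutative ring\<close>

definition ideal_gen :: "'a::comm_ring_1 set \<Rightarrow> 'a set" where
  "ideal_gen G = module.span (*) G"

text \<open>A pair \<open>(m, m')\<close> in the order means that \<open>m\<close> is at most \<open>m'\<close>.\<close>

definition term_order :: "'v power_product rel \<Rightarrow> bool" where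
  "term_order r \<longleftrightarrow> linear_order r \<and> (\<forall>m. (0, m) \<in> r) \<and>
     (\<forall>m m' u. (m, m') \<in> r \<longrightarrow> (m + u, m' + u) \<in> r)"

definition leading_pp :: "'v power_product rel \<Rightarrow> ('v, 'r::zero) mpoly \<Rightarrow> 'v power_product" where
  "leading_pp r p =
     (THE m. m \<in> Poly_Mapping.keys p \<and> (\<forall>m' \<in> Poly_Mapping.keys p. (m', m) \<in> r))"

definition leading_term :: "'v power_product rel \<Rightarrow> ('v, 'r::zero) mpoly \<Rightarrow> ('v, 'r) mpoly" where
  "leading_term r p = (if p = 0 then 0
     else Poly_Mapping.single (leading_pp r p) (Poly_Mapping.lookup p (leading_pp r p)))"

text \<open>
  The coefficient ring need not be a field, so leading terms carry their coefficients:
  the leading terms of \<open>G\<close> have to generate the ideal generated by all leading terms of \<open>I\<close>.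
\<close>

definition groebner_basis ::
    "'v power_product rel \<Rightarrow> ('v, 'r::comm_ring_1) mpoly set \<Rightarrow> ('v, 'r) mpoly set \<Rightarrow> bool" where
  "groebner_basis r G I \<longleftrightarrow> finite G \<and> G \<subseteq> I \<and>
     ideal_gen (leading_term r ` G) = ideal_gen (leading_term r ` I)"

definition much_more_expensive ::
    "'n var power_product rel \<Rightarrow> ('n::finite, 'p::ab_group_add, 'f) seed \<Rightarrow> bool" where
  "much_more_expensive r S \<longleftrightarrow>
     (\<forall>j. \<forall>m \<in> Poly_Mapping.keys (formal_exchange_poly S j).
        let t = Poly_Mapping.single (Vx j) 1 + Poly_Mapping.single (Vx' j) 1
        in m \<noteq> t \<and> (m, t) \<in> r)"

end

theory Submission
  imports Defs "HOL-Library.Function_Algebras" "HOL-Library.Product_Plus"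
begin

text \<open>
  Laurent polynomials in a cluster form a group ring \<open>Z[G]\<close>, and an element is Laurent in the cluster
  adjacent in direction \<open>j\<close> iff \<open>P\<^sub>j\<close> to the power \<open>m\<close> divides its part of degree \<open>- m\<close> in \<open>x\<^sub>j\<close>.
  If the exchange polynomials are pairwise coprime, the elements with this property for all \<open>j\<close> (the
  upper bound) are, for an acyclic seed, the combinations of standard monomials: one removes a
  source \<open>k\<close>, compares the terms of lowest degree in \<open>x\<^sub>k\<close>, and is led to the system of exchange
  polynomials at \<open>x\<^sub>k = 0\<close>, which is of the same kind except that some binomials have become monomials.
  The same argument for two directions (which are always acyclic) shows that the upper bound does
  not change under mutation. Hence it contains all cluster variables. Coprimality is achieved by
  generic auxiliary coefficients that are specialized to 1 at the end. Independence of the standard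
  monomials is proved by the same comparison of lowest terms; reduction to standard monomials modulo
  the exchange relations then gives the statements on relations and Groebner bases.
\<close>

text \<open>Two obstacles shape the argument. Sending the auxiliary variables to 1 is not injective,
  so a lifted element cannot be identified with its value in the field. Mutation is therefore
  described inside the group ring, as a relation between expansions in which powers of the exchange
  polynomial have been cleared; it determines the new expansion because that polynomial is a
  nonzerodivisor. Cancellation rests on regularity and coprimality of the particular binomials,
  which for lifts are read off from integer functionals on the exponents. The second obstacle is the
  step to \<open>x_k = 0\<close>. After division of the lowest term by a power of
  \<open>P_k\<close>, the quotient must satisfy the Laurent conditions of the degenerate system.
  Where \<open>P_j\<close> has become a monomial, it is a unit and its condition is void. Otherwise
  \<open>x_k\<close> does not occur in \<open>P_j\<close>, and sign-skew-symmetry together with the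
  choice of \<open>k\<close> shows that \<open>P_k\<close> does not involve \<open>x_j\<close>; then
  coprimality removes the power of \<open>P_k\<close> from the divisibility by powers of
  \<open>P_j\<close>.\<close>

abbreviation (input) "lookup \<equiv> Poly_Mapping.lookup"
abbreviation (input) "keys \<equiv> Poly_Mapping.keys"
abbreviation (input) "single \<equiv> Poly_Mapping.single"

section \<open>Linear extension of characters\<close>

lemma poly_mapping_sum_single: "Y = (\<Sum>g\<in>keys Y. single g (lookup Y g))"
proof (rule poly_mapping_eqI)
  fix h
  have "lookup (\<Sum>g\<in>keys Y. single g (lookup Y g)) h = (\<Sum>g\<in>keys Y. lookup Y g when g = h)"
    by (simp add: lookup_sum lookup_single)
  also have "\<dots> = (\<Sum>g\<in>keys Y. if h = g then lookup Y g else 0)"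
    by (intro sum.cong) (auto simp: when_def)
  also have "\<dots> = (if h \<in> keys Y then lookup Y h else 0)"
    by (subst sum.delta') auto
  also have "\<dots> = lookup Y h" by (auto simp: in_keys_iff)
  finally show "lookup Y h = lookup (\<Sum>g\<in>keys Y. single g (lookup Y g)) h" ..
qed

lemma sum_single_induct [case_names zero single add]:
  fixes Y :: "'a \<Rightarrow>\<^sub>0 'b::comm_monoid_add"
  assumes "P 0" and "\<And>g c. P (single g c)" and "\<And>X Y. P X \<Longrightarrow> P Y \<Longrightarrow> P (X + Y)"
  shows "P Y"
proof -
  have "P (\<Sum>g\<in>S. single g (lookup Y g))" if "finite S" for S
    using that by (induction S) (auto intro: assms)
  then show ?thesis
    by (subst poly_mapping_sum_single) auto
qed

definition lin_ext :: "('r::zero \<Rightarrow> 'f::comm_ring_1) \<Rightarrow> ('g \<Rightarrow> 'f) \<Rightarrow> ('g \<Rightarrow>\<^sub>0 'r) \<Rightarrow> 'f" where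
  "lin_ext h \<chi> Y = (\<Sum>g\<in>keys Y. h (lookup Y g) * \<chi> g)"

lemma lin_ext_superset:
  assumes "h 0 = 0" "finite S" "keys Y \<subseteq> S"
  shows "lin_ext h \<chi> Y = (\<Sum>g\<in>S. h (lookup Y g) * \<chi> g)"
  unfolding lin_ext_def using assms
  by (intro sum.mono_neutral_left) (auto simp: in_keys_iff)

text \<open>Additivity is separated from multiplicativity because \<open>std_map\<close> is additive
  without being a ring homomorphism, whereas \<open>reflect\<close> and the evaluations come from
  characters.\<close>

locale additive_ext =
  fixes h :: "'r::comm_ring_1 \<Rightarrow> 'f::comm_ring_1" and \<chi> :: "'g \<Rightarrow> 'f"
  assumes h_add: "h (a + b) = h a + h b"
begin

lemma h_zero: "h 0 = 0"
  using h_add[of 0 0] by simp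

lemma zero [simp]: "lin_ext h \<chi> 0 = 0"
  by (simp add: lin_ext_def)

lemma single [simp]: "lin_ext h \<chi> (single g c) = h c * \<chi> g"
  by (subst lin_ext_superset[of _ "{g}"]) (auto simp: h_zero)

lemma add: "lin_ext h \<chi> (X + Y) = lin_ext h \<chi> X + lin_ext h \<chi> Y"
proof -
  have f: "finite (keys X \<union> keys Y)" by simp
  have k: "keys (X + Y) \<subseteq> keys X \<union> keys Y" by (rule keys_add)
  show ?thesis
    using lin_ext_superset[of h "keys X \<union> keys Y" X \<chi>, OF h_zero f]
      lin_ext_superset[of h "keys X \<union> keys Y" Y \<chi>, OF h_zero f]
      lin_ext_superset[of h "keys X \<union> keys Y" "X + Y" \<chi>, OF h_zero f k]
    by (simp add: lookup_add h_add algebra_simps sum.distrib)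
qed

lemma minus: "lin_ext h \<chi> (- X) = - lin_ext h \<chi> X"
  using add[of X "-X"] by (simp add: minus_unique)

lemma diff: "lin_ext h \<chi> (X - Y) = lin_ext h \<chi> X - lin_ext h \<chi> Y"
  using add[of X "-Y"] by (simp add: minus)

lemma sum: "lin_ext h \<chi> (\<Sum>i\<in>I. Y i) = (\<Sum>i\<in>I. lin_ext h \<chi> (Y i))"
  by (induction I rule: infinite_finite_induct) (auto simp: add)

end

locale character_ext = additive_ext h \<chi>
  for h :: "'r::comm_ring_1 \<Rightarrow> 'f::comm_ring_1" and \<chi> :: "'g::comm_monoid_add \<Rightarrow> 'f" +
  assumes h_mult: "h (a * b) = h a * h b" and h_one: "h 1 = 1"
    and \<chi>_zero: "\<chi> 0 = 1" and \<chi>_add: "\<chi> (u + v) = \<chi> u * \<chi> v"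
begin

lemma one [simp]: "lin_ext h \<chi> 1 = 1"
  unfolding single_one[symmetric] single by (simp add: h_one \<chi>_zero)

lemma mult: "lin_ext h \<chi> (X * Y) = lin_ext h \<chi> X * lin_ext h \<chi> Y"
proof (induction X rule: sum_single_induct)
  case (single g c)
  show ?case
    by (induction Y rule: sum_single_induct)
      (auto simp: mult_single h_mult \<chi>_add algebra_simps add)
qed (auto simp: add algebra_simps)

lemma power: "lin_ext h \<chi> (X ^ n) = lin_ext h \<chi> X ^ n"
  by (induction n) (auto simp: mult)

lemma prod: "lin_ext h \<chi> (\<Prod>i\<in>I. Y i) = (\<Prod>i\<in>I. lin_ext h \<chi> (Y i))"
  by (induction I rule: infinite_finite_induct) (auto simp: mult)

end


section \<open>Homogeneous parts\<close>

definition part :: "('g \<Rightarrow> int) \<Rightarrow> int \<Rightarrow> ('g \<Rightarrow>\<^sub>0 'r::zero) \<Rightarrow> ('g \<Rightarrow>\<^sub>0 'r)" where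
  "part f d Y = Poly_Mapping.mapp (\<lambda>g c. c when f g = d) Y"

lemma lookup_part: "lookup (part f d Y) g = (lookup Y g when f g = d)"
  by (auto simp: part_def lookup_mapp when_def in_keys_iff)

lemma keys_part: "keys (part f d Y) = {g \<in> keys Y. f g = d}"
  by (auto simp: in_keys_iff lookup_part)

lemma part_zero [simp]: "part f d 0 = 0"
  by (rule poly_mapping_eqI) (simp add: lookup_part)

lemma part_single: "part f d (single g c) = (single g c when f g = d)"
  by (rule poly_mapping_eqI) (auto simp: lookup_part lookup_single when_def)

lemma part_add: "part f d (X + Y) = part f d X + part f d Y"
  by (rule poly_mapping_eqI) (auto simp: lookup_part lookup_add when_def)

lemma part_diff:
  fixes X Y :: "'g \<Rightarrow>\<^sub>0 'r::ab_group_add"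
  shows "part f d (X - Y) = part f d X - part f d Y"
  by (rule poly_mapping_eqI) (auto simp: lookup_part lookup_minus when_def)

lemma part_sum: "part f d (\<Sum>i\<in>I. Y i) = (\<Sum>i\<in>I. part f d (Y i))"
  by (induction I rule: infinite_finite_induct) (auto simp: part_add)

lemma part_part: "part f d (part f e Y) = (part f d Y when d = e)"
  by (cases "d = e"; rule poly_mapping_eqI) (simp_all add: lookup_part when_def)

lemma part_homogeneous: "(\<And>g. g \<in> keys Y \<Longrightarrow> f g = d) \<Longrightarrow> part f d Y = Y"
  by (rule poly_mapping_eqI) (auto simp: lookup_part when_def in_keys_iff)

lemma part_eq_zero: "(\<And>g. g \<in> keys Y \<Longrightarrow> f g \<noteq> d) \<Longrightarrow> part f d Y = 0"
  by (rule poly_mapping_eqI) (auto simp: lookup_part when_def in_keys_iff)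

lemma part_eqI: "(\<And>d. part f d X = part f d Y) \<Longrightarrow> X = Y"
proof (rule poly_mapping_eqI)
  fix g assume *: "\<And>d. part f d X = part f d Y"
  from *[of "f g"] have "lookup (part f (f g) X) g = lookup (part f (f g) Y) g" by simp
  then show "lookup X g = lookup Y g" by (simp add: lookup_part)
qed

lemma sum_parts:
  assumes "finite D" "f ` keys Y \<subseteq> D"
  shows "Y = (\<Sum>d\<in>D. part f d Y)"
proof (rule part_eqI)
  fix d
  have "part f d (\<Sum>e\<in>D. part f e Y) = (\<Sum>e\<in>D. if d = e then part f d Y else 0)"
    unfolding part_sum part_part by (intro sum.cong) (auto simp: when_def)
  also have "\<dots> = (if d \<in> D then part f d Y else 0)"
    using assms by (subst sum.delta') auto
  also have "\<dots> = part f d Y"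
    using assms by (auto intro!: part_eq_zero[symmetric] part_eq_zero)
  finally show "part f d Y = part f d (\<Sum>e\<in>D. part f e Y)" ..
qed

lemma part_times_homogeneous:
  fixes Z Y :: "'g::ab_group_add \<Rightarrow>\<^sub>0 'r::comm_ring_1"
  assumes "additive f" and "\<And>g. g \<in> keys Z \<Longrightarrow> f g = e"
  shows "part f d (Z * Y) = Z * part f (d - e) Y"
proof -
  interpret additive f by fact
  have 1: "part f d (single g c * Y) = single g c * part f (d - f g) Y" for g c
    by (induction Y rule: sum_single_induct)
      (auto simp: mult_single part_single part_add add algebra_simps when_def)
  have "part f d (Z * Y) = (\<Sum>g\<in>keys Z. part f d (single g (lookup Z g) * Y))"
    by (subst (1) poly_mapping_sum_single[of Z]) (simp add: sum_distrib_right part_sum)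
  also have "\<dots> = (\<Sum>g\<in>keys Z. single g (lookup Z g) * part f (d - e) Y)"
    using assms(2) by (intro sum.cong) (auto simp: 1)
  also have "\<dots> = Z * part f (d - e) Y"
    by (simp add: sum_distrib_right[symmetric] poly_mapping_sum_single[symmetric])
  finally show ?thesis .
qed

section \<open>Filtration by lower degree bounds, and lowest parts\<close>

definition at_least :: "('g \<Rightarrow> int) \<Rightarrow> int \<Rightarrow> ('g \<Rightarrow>\<^sub>0 'r::zero) set" where
  "at_least f d = {Y. \<forall>g\<in>keys Y. d \<le> f g}"

lemma at_least_single: "c = 0 \<or> d \<le> f g \<Longrightarrow> single g c \<in> at_least f d"
  by (auto simp: at_least_def)

lemma at_least_zero [simp]: "0 \<in> at_least f d"
  by (auto simp: at_least_def)

lemma at_least_add: "X \<in> at_least f d \<Longrightarrow> Y \<in> at_least f d \<Longrightarrow> X + Y \<in> at_least f d"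
  using keys_add[of X Y] by (fastforce simp: at_least_def)

lemma at_least_diff:
  fixes X Y :: "'g \<Rightarrow>\<^sub>0 'r::ab_group_add"
  shows "X \<in> at_least f d \<Longrightarrow> Y \<in> at_least f d \<Longrightarrow> X - Y \<in> at_least f d"
  by (fastforce simp: at_least_def in_keys_iff lookup_minus)

lemma at_least_mono: "Y \<in> at_least f d \<Longrightarrow> e \<le> d \<Longrightarrow> Y \<in> at_least f e"
  by (force simp: at_least_def)

lemma at_least_mult:
  fixes X Y :: "'g::ab_group_add \<Rightarrow>\<^sub>0 'r::comm_ring_1"
  assumes "additive f" "X \<in> at_least f d" "Y \<in> at_least f e"
  shows "X * Y \<in> at_least f (d + e)"
  using keys_mult[of X Y] assms(2,3) additive.add[OF assms(1)]
  by (fastforce simp: at_least_def)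

lemma at_least_mult_0:
  fixes X Y :: "'g::ab_group_add \<Rightarrow>\<^sub>0 'r::comm_ring_1"
  assumes "additive f" "X \<in> at_least f 0" "Y \<in> at_least f e"
  shows "X * Y \<in> at_least f e"
  using at_least_mult[OF assms] by simp

lemma at_least_one: "additive f \<Longrightarrow> 1 \<in> at_least f 0"
  by (auto simp: at_least_def additive.zero)

lemma at_least_power:
  fixes X :: "'g::ab_group_add \<Rightarrow>\<^sub>0 'r::comm_ring_1"
  assumes "additive f" "X \<in> at_least f 0"
  shows "X ^ n \<in> at_least f 0"
  by (induction n) (use assms in \<open>auto intro: at_least_one at_least_mult_0\<close>)

lemma at_least_prod:
  fixes X :: "'i \<Rightarrow> 'g::ab_group_add \<Rightarrow>\<^sub>0 'r::comm_ring_1"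
  assumes "additive f" "\<And>i. i \<in> I \<Longrightarrow> X i \<in> at_least f 0"
  shows "(\<Prod>i\<in>I. X i) \<in> at_least f 0"
  using assms(2)
  by (induction I rule: infinite_finite_induct)
    (use assms(1) in \<open>auto intro: at_least_one at_least_mult_0\<close>)

lemma part_at_least: "Y \<in> at_least f d \<Longrightarrow> e < d \<Longrightarrow> part f e Y = 0"
  by (rule part_eq_zero) (auto simp: at_least_def)

lemma at_least_iff_part: "Y \<in> at_least f d \<longleftrightarrow> (\<forall>e<d. part f e Y = 0)"
proof safe
  assume *: "\<forall>e<d. part f e Y = 0"
  show "Y \<in> at_least f d" unfolding at_least_def
  proof safe
    fix g assume "g \<in> keys Y"
    then have "part f (f g) Y \<noteq> 0"
      by (auto simp: in_keys_iff lookup_part poly_mapping_eq_iff fun_eq_iff intro!: exI[of _ g])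
    with * show "d \<le> f g" by (meson not_le)
  qed
qed (auto intro: part_at_least)

lemma ex_at_least: "\<exists>d. Y \<in> at_least f d"
proof -
  have "finite (f ` keys Y)" by simp
  then obtain d where "\<forall>e\<in>f ` keys Y. d \<le> e" using bdd_below_finite unfolding bdd_below_def by blast
  then show ?thesis by (auto simp: at_least_def)
qed

lemma at_least_remove_part:
  fixes Y :: "'g \<Rightarrow>\<^sub>0 'r::ab_group_add"
  assumes "Y \<in> at_least f d"
  shows "Y - part f d Y \<in> at_least f (d + 1)"
  unfolding at_least_iff_part
proof safe
  fix e assume "e < d + 1"
  then show "part f e (Y - part f d Y) = 0"
    using part_at_least[OF assms, of e]
    by (cases "e = d") (auto simp: part_diff part_part)
qed

text \<open>Once the lowest part of \<open>X\<close> is split off, the product of the remainder with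
  \<open>Y\<close> starts above degree \<open>d + e\<close>.\<close>

lemma part_times_lowest:
  fixes X Y :: "'g::ab_group_add \<Rightarrow>\<^sub>0 'r::comm_ring_1"
  assumes f: "additive f" and X: "X \<in> at_least f d" and Y: "Y \<in> at_least f e"
  shows "part f (d + e) (X * Y) = part f d X * part f e Y"
proof -
  define X' where "X' = X - part f d X"
  have 1: "X' * Y \<in> at_least f (d + 1 + e)"
    unfolding X'_def by (intro at_least_mult f at_least_remove_part X Y)
  have "X * Y = part f d X * Y + X' * Y" by (simp add: X'_def algebra_simps)
  then have "part f (d + e) (X * Y) = part f (d + e) (part f d X * Y)"
    using part_at_least[OF 1] by (simp add: part_add)
  also have "\<dots> = part f d X * part f e Y"
    by (subst part_times_homogeneous[OF f, of _ d]) (auto simp: keys_part)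
  finally show ?thesis .
qed

text \<open>On \<open>at_least f 0\<close>, taking the part of degree 0 is the substitution of 0 for
  a variable and hence multiplicative; \<open>part_0_prod\<close> is the version for
  products.\<close>

lemma part_0_power:
  fixes X :: "'g::ab_group_add \<Rightarrow>\<^sub>0 'r::comm_ring_1"
  assumes "additive f" "X \<in> at_least f 0"
  shows "part f 0 (X ^ n) = part f 0 X ^ n"
proof (induction n)
  case 0 then show ?case using assms by (auto simp: additive.zero intro!: part_homogeneous)
next
  case (Suc n)
  then show ?case
    using part_times_lowest[OF assms at_least_power[OF assms], of n] by simp
qed

lemma part_0_prod:
  fixes X :: "'i \<Rightarrow> 'g::ab_group_add \<Rightarrow>\<^sub>0 'r::comm_ring_1"
  assumes "additive f" "\<And>i. i \<in> I \<Longrightarrow> X i \<in> at_least f 0"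
  shows "part f 0 (\<Prod>i\<in>I. X i) = (\<Prod>i\<in>I. part f 0 (X i))"
  using assms(2)
proof (induction I rule: infinite_finite_induct)
  case (insert i I)
  have "prod X I \<in> at_least f 0"
    by (rule at_least_prod[OF assms(1)]) (use insert in auto)
  then have "part f 0 (X i * prod X I) = part f 0 (X i) * part f 0 (prod X I)"
    using part_times_lowest[OF assms(1), of "X i" 0 "prod X I" 0] insert.prems by auto
  then show ?case using insert by simp
qed (use assms(1) in \<open>auto simp: additive.zero intro!: part_homogeneous\<close>)

lemma homogeneous_0_power:
  fixes p :: "'g::ab_group_add \<Rightarrow>\<^sub>0 int" and f :: "'g \<Rightarrow> int"
  assumes "additive f" "\<And>g. g \<in> keys p \<Longrightarrow> f g = 0" "g \<in> keys (p ^ n)"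
  shows "f g = 0"
proof -
  have "p \<in> at_least f 0" using assms(2) by (simp add: at_least_def)
  from part_0_power[OF assms(1) this, of n] part_homogeneous[of p f 0] assms(2)
  have "part f 0 (p ^ n) = p ^ n" by simp
  then show ?thesis using assms(3) keys_part[of f 0 "p ^ n"] by auto
qed

section \<open>Exchange systems and their standard expressions\<close>

text \<open>
  \<open>Z[G]\<close> for an abelian group \<open>G\<close> with degree functions \<open>deg j\<close> plays the role of a Laurent
  polynomial ring. The term of \<open>C\<close> at \<open>g\<close> is sent to the product of \<open>g\<close> with \<open>P\<^sub>j\<close> to the power
  \<open>- deg j g\<close>, for all \<open>j\<close> in which \<open>g\<close> has a negative exponent: this is the standard monomial in
  which the negative powers of \<open>x\<^sub>j\<close> have been replaced by powers of \<open>x\<^sub>j' = P\<^sub>j / x\<^sub>j\<close>.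
\<close>

definition std_map ::
    "('i \<Rightarrow> 'g::ab_group_add \<Rightarrow> int) \<Rightarrow> ('i \<Rightarrow> 'g \<Rightarrow>\<^sub>0 int) \<Rightarrow> 'i set \<Rightarrow> ('g \<Rightarrow>\<^sub>0 int) \<Rightarrow> ('g \<Rightarrow>\<^sub>0 int)" where
  "std_map deg P J = lin_ext (single 0) (\<lambda>g. single g 1 * (\<Prod>j\<in>J. P j ^ nat (- deg j g)))"

interpretation std_ext: additive_ext "single 0 :: int \<Rightarrow> 'g::ab_group_add \<Rightarrow>\<^sub>0 int" \<chi> for \<chi>
  by unfold_locales (rule single_add)

lemma std_map_single:
  "std_map deg P J (single g c) = single g c * (\<Prod>j\<in>J. P j ^ nat (- deg j g))"
  by (simp add: std_map_def mult.assoc[symmetric] mult_single)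

lemma std_map_zero [simp]: "std_map deg P J 0 = 0"
  by (simp add: std_map_def)

lemma std_map_add: "std_map deg P J (C + D) = std_map deg P J C + std_map deg P J D"
  by (simp add: std_map_def std_ext.add)

lemma std_map_sum: "std_map deg P J (\<Sum>i\<in>I. C i) = (\<Sum>i\<in>I. std_map deg P J (C i))"
  by (simp add: std_map_def std_ext.sum)

lemma std_map_expand: "std_map deg P J C =
    (\<Sum>g\<in>keys C. single g (lookup C g) * (\<Prod>j\<in>J. P j ^ nat (- deg j g)))"
  by (subst (1) poly_mapping_sum_single[of C]) (simp add: std_map_sum std_map_single)

lemma std_map_empty [simp]: "std_map deg P {} C = C"
  by (simp add: std_map_expand poly_mapping_sum_single[symmetric])

text \<open>On terms of equal negative degree in \<open>x_k\<close> the exponent of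
  \<open>P k\<close> is constant. This is how a direction is removed from \<open>J\<close> in the
  inductions.\<close>

lemma std_map_insert:
  assumes "finite J" "k \<notin> J" "\<And>g. g \<in> keys C \<Longrightarrow> nat (- deg k g) = n"
  shows "std_map deg P (insert k J) C = P k ^ n * std_map deg P J C"
  unfolding std_map_expand sum_distrib_left
  by (rule sum.cong) (use assms in \<open>auto simp: algebra_simps\<close>)

lemma sum_at_least: "(\<And>i. i \<in> I \<Longrightarrow> X i \<in> at_least f d) \<Longrightarrow> (\<Sum>i\<in>I. X i) \<in> at_least f d"
  by (induction I rule: infinite_finite_induct) (auto intro: at_least_add)

context
  fixes deg :: "'i \<Rightarrow> 'g::ab_group_add \<Rightarrow> int"
  assumes additive_deg: "\<And>i. additive (deg i)"
begin

lemma std_map_at_least: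
  assumes "C \<in> at_least (deg k) d" and P: "\<And>j. j \<in> J \<Longrightarrow> P j \<in> at_least (deg k) 0"
  shows "std_map deg P J C \<in> at_least (deg k) d"
  unfolding std_map_expand
proof (rule sum_at_least)
  fix g assume "g \<in> keys C"
  with assms(1) have "single g (lookup C g) \<in> at_least (deg k) (d + 0)"
    by (intro at_least_single) (auto simp: at_least_def)
  then have "single g (lookup C g) * (\<Prod>j\<in>J. P j ^ nat (- deg j g)) \<in> at_least (deg k) (d + 0)"
    by (intro at_least_mult additive_deg at_least_prod at_least_power P) auto
  then show "single g (lookup C g) * (\<Prod>j\<in>J. P j ^ nat (- deg j g)) \<in> at_least (deg k) d" by simp
qed

text \<open>The factors \<open>P j\<close> cannot lower the degree in \<open>x_k\<close>, and terms
  of \<open>C\<close> above degree \<open>d\<close> do not reach down to it. So on lowest parts the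
  standard expression is formed with \<open>x_k\<close> set to zero in every
  \<open>P j\<close>.\<close>

lemma part_std_map_lowest:
  assumes C: "C \<in> at_least (deg k) d" and P: "\<And>j. j \<in> J \<Longrightarrow> P j \<in> at_least (deg k) 0"
  shows "part (deg k) d (std_map deg P J C) =
    std_map deg (\<lambda>j. part (deg k) 0 (P j)) J (part (deg k) d C)"
proof -
  let ?P' = "\<lambda>j. part (deg k) 0 (P j)"
  have *: "part (deg k) d (std_map deg P J (single g c)) = std_map deg ?P' J (part (deg k) d (single g c))"
    if "d \<le> deg k g" for g c
  proof (cases "deg k g = d")
    case True
    have "part (deg k) (d + 0) (single g c * (\<Prod>j\<in>J. P j ^ nat (- deg j g))) =
        part (deg k) d (single g c) * part (deg k) 0 (\<Prod>j\<in>J. P j ^ nat (- deg j g))"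
      by (intro part_times_lowest additive_deg at_least_single at_least_prod at_least_power P)
        (use True in auto)
    also have "part (deg k) 0 (\<Prod>j\<in>J. P j ^ nat (- deg j g)) = (\<Prod>j\<in>J. ?P' j ^ nat (- deg j g))"
      using P by (simp add: part_0_prod part_0_power additive_deg at_least_power)
    finally show ?thesis using True by (simp add: std_map_single part_single)
  next
    case False
    have "single g c \<in> at_least (deg k) (d + 1)"
      by (rule at_least_single) (use False that in auto)
    then show ?thesis
      using False part_at_least[OF std_map_at_least[where P = P and J = J and k = k, OF _ P], of "single g c" "d + 1" d]
      by (simp add: part_single)
  qed
  have "part (deg k) d (std_map deg P J C) =
      (\<Sum>g\<in>keys C. part (deg k) d (std_map deg P J (single g (lookup C g))))"
    by (subst (1) poly_mapping_sum_single[of C]) (simp add: std_map_sum part_sum)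
  also have "\<dots> = (\<Sum>g\<in>keys C. std_map deg ?P' J (part (deg k) d (single g (lookup C g))))"
    using C by (intro sum.cong refl *) (auto simp: at_least_def)
  also have "\<dots> = std_map deg ?P' J (part (deg k) d C)"
    by (subst (3) poly_mapping_sum_single[of C]) (simp add: std_map_sum part_sum)
  finally show ?thesis .
qed

text \<open>Here the grading is respected and not merely the filtration. This applies to degenerate
  systems, whose binomials have lost \<open>x_k\<close>.\<close>

lemma part_std_map_homogeneous:
  assumes P: "\<And>j g. j \<in> J \<Longrightarrow> g \<in> keys (P j) \<Longrightarrow> deg k g = 0"
  shows "part (deg k) d (std_map deg P J C) = std_map deg P J (part (deg k) d C)"
proof (induction C rule: sum_single_induct)
  case (single g c)
  have P0: "P j \<in> at_least (deg k) 0" "part (deg k) 0 (P j) = P j" if "j \<in> J" for j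
    using P that by (auto simp: at_least_def intro: part_homogeneous)
  show ?case
  proof (cases "deg k g = d")
    case True
    have "single g c \<in> at_least (deg k) d" by (rule at_least_single) (use True in auto)
    from part_std_map_lowest[OF this, of J P] P0
    have "part (deg k) d (std_map deg P J (single g c)) =
        std_map deg (\<lambda>j. part (deg k) 0 (P j)) J (part (deg k) d (single g c))" by auto
    also have "\<dots> = std_map deg P J (part (deg k) d (single g c))"
      unfolding std_map_expand using P0 by (auto intro!: sum.cong prod.cong)
    finally show ?thesis .
  next
    case False
    have "part (deg k) 0 (\<Prod>j\<in>J. P j ^ nat (- deg j g)) = (\<Prod>j\<in>J. P j ^ nat (- deg j g))"
      using P0 by (simp add: part_0_prod part_0_power additive_deg at_least_power)
    then have "part (deg k) (d - deg k g) (\<Prod>j\<in>J. P j ^ nat (- deg j g)) = 0"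
      using part_part[of "deg k" "d - deg k g" 0 "\<Prod>j\<in>J. P j ^ nat (- deg j g)"] False
      by simp
    moreover have "part (deg k) d (single g c * (\<Prod>j\<in>J. P j ^ nat (- deg j g))) =
        single g c * part (deg k) (d - deg k g) (\<Prod>j\<in>J. P j ^ nat (- deg j g))"
      by (rule part_times_homogeneous[OF additive_deg]) (auto split: if_splits)
    ultimately show ?thesis using False
      by (simp add: std_map_single part_single)
  qed
qed (auto simp: std_map_add part_add)

end


text \<open>The elements of the ring generated by \<open>x\<^sub>j\<close>, \<open>P\<^sub>j / x\<^sub>j\<close> and the monomials not involving \<open>x\<^sub>j\<close>.\<close>

definition laurent_cond ::
    "('i \<Rightarrow> 'g::ab_group_add \<Rightarrow> int) \<Rightarrow> ('i \<Rightarrow> 'g \<Rightarrow>\<^sub>0 int) \<Rightarrow> 'i \<Rightarrow> ('g \<Rightarrow>\<^sub>0 int) \<Rightarrow> bool" where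
  "laurent_cond deg P j Y \<longleftrightarrow> (\<forall>m::nat. P j ^ m dvd part (deg j) (- int m) Y)"

lemma laurent_cond_zero [simp]: "laurent_cond deg P j 0"
  by (simp add: laurent_cond_def)

lemma laurent_cond_add:
  "laurent_cond deg P j X \<Longrightarrow> laurent_cond deg P j Y \<Longrightarrow> laurent_cond deg P j (X + Y)"
  by (auto simp: laurent_cond_def part_add)

lemma laurent_cond_diff:
  "laurent_cond deg P j X \<Longrightarrow> laurent_cond deg P j Y \<Longrightarrow> laurent_cond deg P j (X - Y)"
  by (auto simp: laurent_cond_def part_diff)

lemma laurent_cond_at_least: "Y \<in> at_least (deg j) 0 \<Longrightarrow> laurent_cond deg P j Y"
  unfolding laurent_cond_def
proof
  fix m assume "Y \<in> at_least (deg j) 0"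
  then show "P j ^ m dvd part (deg j) (- int m) Y"
    by (cases "m = 0") (auto simp: part_at_least)
qed

text \<open>In a standard term the exponent of \<open>P j\<close> is the amount by which
  \<open>x_j\<close> occurs negatively, and no other factor lowers the degree in \<open>x_j\<close>.
  A nonzero part of degree \<open>- m\<close> therefore comes with at least \<open>m\<close> factors
  \<open>P j\<close>.\<close>

lemma laurent_cond_std_map:
  assumes f: "\<And>i. additive (deg i)" and J: "finite J" "j \<in> J"
    and P: "\<And>i. i \<in> J \<Longrightarrow> P i \<in> at_least (deg j) 0" and Pj: "\<And>g. g \<in> keys (P j) \<Longrightarrow> deg j g = 0"
  shows "laurent_cond deg P j (std_map deg P J C)"
proof (induction C rule: sum_single_induct)
  case (single g c)
  show ?case unfolding laurent_cond_def
  proof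
    fix m
    define R where "R = single g c * (\<Prod>i\<in>J - {j}. P i ^ nat (- deg i g))"
    have "single g c \<in> at_least (deg j) (deg j g)"
      by (rule at_least_single) simp
    then have "R \<in> at_least (deg j) (deg j g + 0)"
      unfolding R_def by (intro at_least_mult f at_least_prod at_least_power P) auto
    then have R: "R \<in> at_least (deg j) (deg j g)" by simp
    have eq: "std_map deg P J (single g c) = P j ^ nat (- deg j g) * R"
      using J by (simp add: std_map_single R_def prod.remove[of J j] algebra_simps)
    have 0: "g' \<in> keys (P j ^ n) \<Longrightarrow> deg j g' = 0" for g' n
      by (rule homogeneous_0_power[OF f Pj])
    have "part (deg j) (- int m) (std_map deg P J (single g c)) =
        P j ^ nat (- deg j g) * part (deg j) (- int m) R"
      unfolding eq by (subst part_times_homogeneous[OF f 0]) simp_all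
    moreover have "P j ^ m dvd P j ^ nat (- deg j g) * part (deg j) (- int m) R"
    proof (cases "int m \<le> - deg j g")
      case True
      then show ?thesis by (intro dvd_mult2 le_imp_power_dvd) auto
    next
      case False
      then show ?thesis using part_at_least[OF R, of "- int m"] by simp
    qed
    ultimately show "P j ^ m dvd part (deg j) (- int m) (std_map deg P J (single g c))" by simp
  qed
qed (auto simp: std_map_add intro: laurent_cond_add)

text \<open>
  The elements \<open>A j + B j\<close> are the exchange polynomials; when \<open>\<epsilon> j\<close> is false, the term \<open>A j\<close> has
  been lost by setting some other variable to zero.
\<close>

definition binom :: "('i \<Rightarrow> 'g::ab_group_add) \<Rightarrow> ('i \<Rightarrow> 'g) \<Rightarrow> ('i \<Rightarrow> bool) \<Rightarrow> 'i \<Rightarrow> 'g \<Rightarrow>\<^sub>0 int" where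
  "binom A B \<epsilon> j = (if \<epsilon> j then single (A j) 1 else 0) + single (B j) 1"

text \<open>The rank \<open>r\<close> encodes acyclicity: it increases along arrows, so a direction
  of minimal rank occurs in no \<open>B j\<close>. The last clause is the part of sign-skew-symmetry
  that is used, demanded only where the term \<open>A i\<close> is still present; in this form the
  notion survives the passage to \<open>x_k = 0\<close>.\<close>

definition exchange_system ::
    "('i \<Rightarrow> 'g::ab_group_add \<Rightarrow> int) \<Rightarrow> ('i \<Rightarrow> nat) \<Rightarrow> ('i \<Rightarrow> 'g) \<Rightarrow> ('i \<Rightarrow> 'g) \<Rightarrow> ('i \<Rightarrow> bool) \<Rightarrow> 'i set \<Rightarrow> bool"
  where
  "exchange_system deg r A B \<epsilon> J \<longleftrightarrow> finite J \<and> (\<forall>i. additive (deg i)) \<and>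
     (\<forall>j\<in>J. \<forall>i\<in>J. 0 \<le> deg i (A j) \<and> 0 \<le> deg i (B j) \<and> (0 < deg i (A j) \<longrightarrow> r i < r j) \<and>
        (0 < deg i (B j) \<longrightarrow> r j < r i \<and> (\<epsilon> i \<longrightarrow> 0 < deg j (A i))))"

text \<open>Only binomials with both terms are constrained: a single group element is a
  unit.\<close>

definition regular_system :: "('i \<Rightarrow> 'g::ab_group_add) \<Rightarrow> ('i \<Rightarrow> 'g) \<Rightarrow> ('i \<Rightarrow> bool) \<Rightarrow> 'i set \<Rightarrow> bool" where
  "regular_system A B \<epsilon> J \<longleftrightarrow> (\<forall>j\<in>J. \<epsilon> j \<longrightarrow> (\<forall>c. binom A B \<epsilon> j * c = 0 \<longrightarrow> c = 0))"

text \<open>Coprimality as being a nonzerodivisor modulo the other exchange polynomial, a form that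
  makes sense without unique factorization.\<close>

definition coprime_system :: "('i \<Rightarrow> 'g::ab_group_add) \<Rightarrow> ('i \<Rightarrow> 'g) \<Rightarrow> ('i \<Rightarrow> bool) \<Rightarrow> 'i set \<Rightarrow> bool" where
  "coprime_system A B \<epsilon> J \<longleftrightarrow> (\<forall>i\<in>J. \<forall>j\<in>J. i \<noteq> j \<longrightarrow> \<epsilon> i \<longrightarrow> \<epsilon> j \<longrightarrow>
     (\<forall>c. binom A B \<epsilon> j dvd binom A B \<epsilon> i * c \<longrightarrow> binom A B \<epsilon> j dvd c))"

lemma exchange_systemD:
  assumes "exchange_system deg r A B \<epsilon> J"
  shows "finite J" "additive (deg l)"
    "i \<in> J \<Longrightarrow> j \<in> J \<Longrightarrow> 0 \<le> deg i (A j)" "i \<in> J \<Longrightarrow> j \<in> J \<Longrightarrow> 0 \<le> deg i (B j)"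
    "i \<in> J \<Longrightarrow> j \<in> J \<Longrightarrow> r j \<le> r i \<Longrightarrow> deg i (A j) = 0"
    "i \<in> J \<Longrightarrow> j \<in> J \<Longrightarrow> r i \<le> r j \<Longrightarrow> deg i (B j) = 0"
    "i \<in> J \<Longrightarrow> j \<in> J \<Longrightarrow> \<epsilon> i \<Longrightarrow> deg j (A i) = 0 \<Longrightarrow> deg i (B j) = 0"
  using assms unfolding exchange_system_def by (force)+

lemma single_unit:
  fixes a :: "'g::ab_group_add"
  shows "single a (1::int) dvd 1"
  by (rule dvdI[of _ _ "single (- a) 1"]) (simp add: mult_single)

lemma keys_single_plus_single:
  "keys (single a (1::int) + single b 1) = {a, b}"
  by (auto simp: in_keys_iff lookup_add lookup_single when_def split: if_splits)

lemma keys_binom: "keys (binom A B \<epsilon> j) = (if \<epsilon> j then {A j, B j} else {B j})"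
  by (simp add: binom_def keys_single_plus_single)

section \<open>Degeneration of an exchange system at \<open>x_k = 0\<close>, and injectivity of
  standard expressions\<close>

context
  fixes deg :: "'i \<Rightarrow> 'g::ab_group_add \<Rightarrow> int" and r :: "'i \<Rightarrow> nat" and A B :: "'i \<Rightarrow> 'g"
begin

text \<open>For \<open>k\<close> of minimal rank no \<open>B j\<close> involves \<open>x_k\<close>,
  so setting \<open>x_k\<close> to zero can only kill \<open>A j\<close>, namely when
  \<open>x_k\<close> divides it. A term once lost stays lost.\<close>

definition degenerate :: "'i \<Rightarrow> ('i \<Rightarrow> bool) \<Rightarrow> 'i \<Rightarrow> bool" where
  "degenerate k \<epsilon> j \<longleftrightarrow> \<epsilon> j \<and> deg k (A j) = 0"

lemma exchange_system_degenerate: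
  "exchange_system deg r A B \<epsilon> J \<Longrightarrow> J' \<subseteq> J \<Longrightarrow> exchange_system deg r A B (degenerate k \<epsilon>) J'"
  unfolding exchange_system_def degenerate_def by (auto intro: finite_subset)

lemma regular_system_degenerate:
  "regular_system A B \<epsilon> J \<Longrightarrow> J' \<subseteq> J \<Longrightarrow> regular_system A B (degenerate k \<epsilon>) J'"
  unfolding regular_system_def degenerate_def binom_def by (auto split: if_splits)

lemma coprime_system_degenerate:
  "coprime_system A B \<epsilon> J \<Longrightarrow> J' \<subseteq> J \<Longrightarrow> coprime_system A B (degenerate k \<epsilon>) J'"
  unfolding coprime_system_def degenerate_def binom_def by (simp add: subset_eq) blast

lemma system_subset:
  "exchange_system deg r A B \<epsilon> J \<Longrightarrow> J' \<subseteq> J \<Longrightarrow> exchange_system deg r A B \<epsilon> J'"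
  "regular_system A B \<epsilon> J \<Longrightarrow> J' \<subseteq> J \<Longrightarrow> regular_system A B \<epsilon> J'"
  "coprime_system A B \<epsilon> J \<Longrightarrow> J' \<subseteq> J \<Longrightarrow> coprime_system A B \<epsilon> J'"
  unfolding exchange_system_def regular_system_def coprime_system_def
  by (auto intro: finite_subset)

lemma binom_regular:
  assumes "regular_system A B \<epsilon> J" "j \<in> J" "binom A B \<epsilon> j ^ n * c = 0"
  shows "c = 0"
proof (cases "\<epsilon> j")
  case True
  with assms(1,2) have "binom A B \<epsilon> j * c = 0 \<Longrightarrow> c = 0" for c by (auto simp: regular_system_def)
  then show ?thesis using assms(3) by (induction n) (auto simp: mult.assoc)
next
  case False
  then have "binom A B \<epsilon> j ^ n dvd 1"
    using dvd_power_same[OF single_unit, of "B j" n] by (simp add: binom_def)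
  then obtain u where u: "1 = binom A B \<epsilon> j ^ n * u" by (auto elim: dvdE)
  have "c = u * (binom A B \<epsilon> j ^ n * c)" using u by (metis mult.assoc mult.commute mult_1)
  then show ?thesis using assms(3) by simp
qed

context
  fixes \<epsilon> :: "'i \<Rightarrow> bool" and J :: "'i set"
  assumes sys: "exchange_system deg r A B \<epsilon> J"
begin

lemma binom_at_least: "i \<in> J \<Longrightarrow> j \<in> J \<Longrightarrow> binom A B \<epsilon> j \<in> at_least (deg i) 0"
  using exchange_systemD(3,4)[OF sys] by (auto simp: at_least_def keys_binom)

lemma binom_degree_self: "j \<in> J \<Longrightarrow> g \<in> keys (binom A B \<epsilon> j) \<Longrightarrow> deg j g = 0"
  using exchange_systemD(5,6)[OF sys, of j j] by (auto simp: keys_binom split: if_splits)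

lemma part_0_binom:
  assumes "k \<in> J" "j \<in> J" "\<And>i. i \<in> J \<Longrightarrow> r k \<le> r i"
  shows "part (deg k) 0 (binom A B \<epsilon> j) = binom A B (degenerate k \<epsilon>) j"
  using exchange_systemD(6)[OF sys, of k j] assms
  by (auto simp: binom_def degenerate_def part_add part_single)

lemma degenerate_degree:
  assumes "k \<in> J" "j \<in> J" "\<And>i. i \<in> J \<Longrightarrow> r k \<le> r i" "g \<in> keys (binom A B (degenerate k \<epsilon>) j)"
  shows "deg k g = 0"
  using exchange_systemD(6)[OF sys, of k j] assms
  by (auto simp: keys_binom degenerate_def split: if_splits)

lemma ex_minimal_rank: "J \<noteq> {} \<Longrightarrow> \<exists>k\<in>J. \<forall>i\<in>J. r k \<le> r i"
  using ex_min_if_finite[of "r ` J"] exchange_systemD(1)[OF sys]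
  by (force simp: not_less)

end

text \<open>After cancellation of the regular factor \<open>P k\<close>, the lowest part of
  \<open>C\<close> in a direction \<open>k\<close> of minimal rank is killed by the standard
  expression of the degenerate system without \<open>k\<close>. By induction on \<open>J\<close> it
  vanishes.\<close>

theorem std_map_eq_0D:
  assumes "exchange_system deg r A B \<epsilon> J" "regular_system A B \<epsilon> J"
    and "std_map deg (binom A B \<epsilon>) J C = 0"
  shows "C = 0"
proof -
  from assms(1) have "finite J" by (rule exchange_systemD)
  then show ?thesis using assms
  proof (induction J arbitrary: \<epsilon> C rule: finite_psubset_induct)
    case (psubset J)
    note sys = psubset.prems(1) and f = exchange_systemD(2)[OF psubset.prems(1)]
    show ?case
    proof (cases "J = {}")
      case False
      then obtain k where k: "k \<in> J" "\<And>i. i \<in> J \<Longrightarrow> r k \<le> r i"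
        using ex_minimal_rank[OF sys] by auto
      define J' where "J' = J - {k}"
      have J: "J = insert k J'" "k \<notin> J'" "J' \<subset> J" "finite J'"
        using k psubset.hyps by (auto simp: J'_def)
      let ?P = "binom A B \<epsilon>"
      have lowest: "part (deg k) d C = 0" if C: "C \<in> at_least (deg k) d" for d
      proof -
        let ?C1 = "part (deg k) d C"
        have "C - ?C1 \<in> at_least (deg k) (d + 1)" by (rule at_least_remove_part[OF C])
        then have 1: "std_map deg ?P J (C - ?C1) \<in> at_least (deg k) (d + 1)"
          by (rule std_map_at_least[OF f]) (use binom_at_least[OF sys] k in auto)
        have C1: "?C1 \<in> at_least (deg k) d" "part (deg k) d ?C1 = ?C1"
          by (auto simp: at_least_def keys_part part_part)
        have "std_map deg ?P J C = std_map deg ?P J ?C1 + std_map deg ?P J (C - ?C1)"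
          by (simp add: std_map_add[symmetric])
        then have "part (deg k) d (std_map deg ?P J ?C1) = 0"
          using psubset.prems(3) part_at_least[OF 1, of d] part_add[of "deg k" d "std_map deg ?P J ?C1"]
          by (metis add.right_neutral less_add_one part_zero)
        also have "std_map deg ?P J ?C1 = ?P k ^ nat (- d) * std_map deg ?P J' ?C1"
          unfolding J(1) by (rule std_map_insert) (use J in \<open>auto simp: keys_part\<close>)
        also have "part (deg k) d \<dots> = ?P k ^ nat (- d) * part (deg k) d (std_map deg ?P J' ?C1)"
        proof -
          have 0: "deg k g = 0" if "g \<in> keys (?P k ^ n)" for g n
            by (rule homogeneous_0_power[OF f binom_degree_self[OF sys k(1)] that])
          show ?thesis by (subst part_times_homogeneous[OF f 0]) simp_all
        qed
        finally have "part (deg k) d (std_map deg ?P J' ?C1) = 0"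
          using binom_regular[OF psubset.prems(2) k(1)] by blast
        also have "part (deg k) d (std_map deg ?P J' ?C1) =
            std_map deg (\<lambda>j. part (deg k) 0 (?P j)) J' (part (deg k) d ?C1)"
          by (rule part_std_map_lowest[where deg = deg, OF f C1(1)]) (use binom_at_least[OF sys k(1)] J in auto)
        also have "\<dots> = std_map deg (binom A B (degenerate k \<epsilon>)) J' ?C1"
          unfolding C1(2) std_map_expand using part_0_binom[OF sys k(1) _ k(2)] J
          by (intro sum.cong refl arg_cong2[of _ _ _ _ "(*)"] prod.cong) auto
        finally show "part (deg k) d C = 0"
          using psubset.IH[OF J(3) exchange_system_degenerate[OF sys] regular_system_degenerate[OF psubset.prems(2)]]
            J(3) by blast
      qed
      \<comment> \<open>The degree bound can be raised indefinitely, which contradicts a finite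
        nonempty support.\<close>
      obtain d0 where d0: "C \<in> at_least (deg k) d0" using ex_at_least by blast
      have "C \<in> at_least (deg k) (d0 + int n)" for n
      proof (induction n)
        case (Suc n)
        from at_least_remove_part[OF Suc] lowest[OF Suc] show ?case by (simp add: algebra_simps)
      qed (use d0 in simp)
      then have up: "C \<in> at_least (deg k) e" for e
        by (rule at_least_mono[of _ _ "d0 + int (nat (e - d0))"]) simp
      show "C = 0"
      proof (rule ccontr)
        assume "C \<noteq> 0"
        then obtain g where "g \<in> keys C" by (auto simp: poly_mapping_eq_iff in_keys_iff fun_eq_iff)
        with up[of "deg k g + 1"] show False by (auto simp: at_least_def)
      qed
    qed (use psubset.prems in simp)
  qed
qed

end

section \<open>From Laurent conditions to standard expressions\<close>

lemma part_std_map_lowest_degenerate: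
  assumes sys: "exchange_system deg r A B \<epsilon> J" and k: "k \<in> J" "\<And>i. i \<in> J \<Longrightarrow> r k \<le> r i"
    and J': "J' \<subseteq> J" and C: "C \<in> at_least (deg k) d"
  shows "part (deg k) d (std_map deg (binom A B \<epsilon>) J' C) =
    std_map deg (binom A B (degenerate deg A k \<epsilon>)) J' (part (deg k) d C)"
proof -
  note f = exchange_systemD(2)[OF sys]
  have "part (deg k) d (std_map deg (binom A B \<epsilon>) J' C) =
      std_map deg (\<lambda>j. part (deg k) 0 (binom A B \<epsilon> j)) J' (part (deg k) d C)"
    by (rule part_std_map_lowest[where deg = deg, OF f C])
      (use binom_at_least[OF sys k(1)] J' in auto)
  also have "\<dots> = std_map deg (binom A B (degenerate deg A k \<epsilon>)) J' (part (deg k) d C)"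
    unfolding std_map_expand using part_0_binom[OF sys k(1) _ k(2)] J'
    by (intro sum.cong refl arg_cong2[of _ _ _ _ "(*)"] prod.cong) auto
  finally show ?thesis .
qed

text \<open>Cancellation between standard terms cannot raise the lowest degree in
  \<open>x_k\<close>: the lowest part of the image is a standard expression of the degenerate
  system, and those are injective.\<close>

lemma at_least_std_mapD:
  assumes sys: "exchange_system deg r A B \<epsilon> J" and reg: "regular_system A B \<epsilon> J"
    and k: "k \<in> J" "\<And>i. i \<in> J \<Longrightarrow> r k \<le> r i" and J': "J' \<subseteq> J"
    and Y: "std_map deg (binom A B \<epsilon>) J' C \<in> at_least (deg k) d"
  shows "C \<in> at_least (deg k) d"
proof -
  have step: "C \<in> at_least (deg k) (e + 1)" if C: "C \<in> at_least (deg k) e" and "e < d" for e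
  proof -
    have "part (deg k) e (std_map deg (binom A B \<epsilon>) J' C) = 0"
      using part_at_least[OF Y \<open>e < d\<close>] .
    then have "std_map deg (binom A B (degenerate deg A k \<epsilon>)) J' (part (deg k) e C) = 0"
      using part_std_map_lowest_degenerate[OF sys k J' C] by simp
    then have "part (deg k) e C = 0"
      by (rule std_map_eq_0D[OF exchange_system_degenerate[OF sys J']
            regular_system_degenerate[OF reg J']])
    then show ?thesis using at_least_remove_part[OF C] by simp
  qed
  obtain d0 where d0: "C \<in> at_least (deg k) d0" using ex_at_least by blast
  have "C \<in> at_least (deg k) (min d (d0 + int n))" for n
  proof (induction n)
    case 0 then show ?case using d0 by (rule_tac at_least_mono[of _ _ d0]) auto
  next
    case (Suc n)
    show ?case
    proof (cases "d0 + int n < d")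
      case True
      with Suc have "C \<in> at_least (deg k) (d0 + int n + 1)" by (intro step) auto
      then show ?thesis by (rule at_least_mono) auto
    next
      case False
      then show ?thesis using Suc by (auto simp: min_def)
    qed
  qed
  from this[of "nat (d - d0)"] show ?thesis by (rule at_least_mono) auto
qed

text \<open>Cancel all factors \<open>z\<close> modulo \<open>p\<close>, divide by \<open>p\<close>,
  and repeat; regularity permits the division.\<close>

lemma dvd_regular_coprime_power:
  fixes p z c :: "'a::comm_ring_1"
  assumes regular: "\<And>c. p * c = 0 \<Longrightarrow> c = 0" and coprime: "\<And>c. p dvd z * c \<Longrightarrow> p dvd c"
  shows "p ^ l dvd z ^ m * c \<Longrightarrow> p ^ l dvd c"
proof (induction l arbitrary: c)
  case (Suc l)
  have cancel: "p dvd z ^ m * c \<Longrightarrow> p dvd c" for c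
  proof (induction m)
    case (Suc m)
    from Suc.prems have "p dvd z * (z ^ m * c)" by (simp add: mult.assoc)
    from Suc.IH[OF coprime[OF this]] show ?case .
  qed simp
  have "p dvd z ^ m * c" using Suc.prems by (rule dvd_trans[rotated]) simp
  from cancel[OF this] obtain c' where c: "c = p * c'" by (rule dvdE)
  from Suc.prems obtain e where e: "z ^ m * c = p ^ Suc l * e" by (rule dvdE)
  have "p * (z ^ m * c' - p ^ l * e) = z ^ m * c - p ^ Suc l * e"
    unfolding c by (simp add: algebra_simps)
  then have "p * (z ^ m * c' - p ^ l * e) = 0" unfolding e by simp
  from regular[OF this] have "z ^ m * c' = p ^ l * e" by simp
  then have "p ^ l dvd c'" using Suc.IH[of c'] by simp
  then show ?case unfolding c power_Suc by (intro mult_dvd_mono) simp_all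
qed simp

lemma dvd_unit_mult_cancel:
  fixes u :: "'a::comm_ring_1"
  assumes "u dvd 1" "p dvd u * c"
  shows "p dvd c"
proof -
  from assms(1) obtain v where v: "1 = u * v" by (auto elim: dvdE)
  have "c = (u * v) * c" using v by simp
  also have "\<dots> = (u * c) * v" by (simp only: ac_simps)
  finally have c: "c = (u * c) * v" .
  have "p dvd (u * c) * v" using assms(2) by (rule dvd_mult2)
  then show ?thesis using c by simp
qed

text \<open>The induction hypothesis serves two systems on \<open>J'\<close>: the original one, to
  see that the lowest part of \<open>Y\<close> is a standard expression of the degenerate system,
  and the degenerate one, to express the quotient of that part by a power of \<open>P k\<close>.
  Lifting the quotient back and subtracting removes the lowest part of \<open>Y\<close>.\<close>

theorem laurent_cond_imp_std_map:
  assumes "exchange_system deg r A B \<epsilon> J" "regular_system A B \<epsilon> J" "coprime_system A B \<epsilon> J"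
    and "\<And>j. j \<in> J \<Longrightarrow> laurent_cond deg (binom A B \<epsilon>) j Y"
  shows "\<exists>C. Y = std_map deg (binom A B \<epsilon>) J C"
proof -
  from assms(1) have "finite J" by (rule exchange_systemD)
  then show ?thesis using assms
  proof (induction J arbitrary: \<epsilon> Y rule: finite_psubset_induct)
    case (psubset J)
    note sys = psubset.prems(1) and reg = psubset.prems(2) and cop = psubset.prems(3)
    note f = exchange_systemD(2)[OF sys]
    show ?case
    proof (cases "J = {}")
      case True then show ?thesis by simp
    next
      case False
      then obtain k where k: "k \<in> J" "\<And>i. i \<in> J \<Longrightarrow> r k \<le> r i"
        using ex_minimal_rank[OF sys] by auto
      define J' where "J' = J - {k}"
      have J: "J = insert k J'" "k \<notin> J'" "J' \<subset> J" "J' \<subseteq> J" "finite J'"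
        using k psubset.hyps by (auto simp: J'_def)
      let ?P = "binom A B \<epsilon>" and ?\<delta> = "degenerate deg A k \<epsilon>"
      let ?Q = "binom A B ?\<delta>"
      note sys' = exchange_system_degenerate[OF sys J(4), of k]
      have Pk0: "deg k g = 0" if "g \<in> keys (?P k ^ n)" for g n
        by (rule homogeneous_0_power[OF f binom_degree_self[OF sys k(1)] that])
      have std_laurent: "laurent_cond deg ?P j (std_map deg ?P J C)" if "j \<in> J" for j C
        using that binom_at_least[OF sys] binom_degree_self[OF sys]
        by (intro laurent_cond_std_map f psubset.hyps) auto
      have IH: "\<exists>C. Y = std_map deg ?P J' C" if "\<And>j. j \<in> J \<Longrightarrow> laurent_cond deg ?P j Y" for Y
        by (rule psubset.IH[OF J(3) system_subset(1)[OF sys J(4)] system_subset(2)[OF reg J(4)]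
            system_subset(3)[OF cop J(4)]]) (use that J(4) in auto)
      have "\<exists>C. Y = std_map deg ?P J C"
        if "\<And>j. j \<in> J \<Longrightarrow> laurent_cond deg ?P j Y" "Y \<in> at_least (deg k) (- int n)" for n Y
        using that
      proof (induction n arbitrary: Y)
        case 0
        from IH[OF 0(1)] obtain C where C: "Y = std_map deg ?P J' C" by blast
        \<comment> \<open>Without negative exponents of \<open>x_k\<close> the exponent of
          \<open>P k\<close> is 0, so an expression for \<open>J'\<close> is already one for
          \<open>J\<close>.\<close>
        have "C \<in> at_least (deg k) 0"
          by (rule at_least_std_mapD[OF sys reg k J(4)]) (use 0(2) C in simp_all)
        then have "std_map deg ?P J C = ?P k ^ 0 * std_map deg ?P J' C"
          unfolding J(1) by (intro std_map_insert J) (auto simp: at_least_def)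
        with C show ?case by (intro exI[of _ C]) simp
      next
        case (Suc n)
        let ?m = "Suc n"
        from IH[OF Suc.prems(1)] obtain C where C: "Y = std_map deg ?P J' C" by blast
        have C_low: "C \<in> at_least (deg k) (- int ?m)"
          by (rule at_least_std_mapD[OF sys reg k J(4)]) (use Suc.prems(2) C in simp_all)
        let ?v = "part (deg k) (- int ?m) Y"
        have v_eq: "?v = std_map deg ?Q J' (part (deg k) (- int ?m) C)"
          unfolding C by (rule part_std_map_lowest_degenerate[OF sys k J(4) C_low])
        from Suc.prems(1)[OF k(1)] have "?P k ^ ?m dvd ?v" unfolding laurent_cond_def by blast
        then obtain w0 where w0: "?v = ?P k ^ ?m * w0" by (auto elim: dvdE)
        \<comment> \<open>The quotient \<open>w0\<close> need not be homogeneous; its part of degree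
          \<open>- ?m\<close> also works, as \<open>P k\<close> has degree 0 in
          \<open>x_k\<close>.\<close>
        define w where "w = part (deg k) (- int ?m) w0"
        have w: "?v = ?P k ^ ?m * w"
        proof -
          have "?v = part (deg k) (- int ?m) ?v" by (simp add: part_part)
          also have "\<dots> = ?P k ^ ?m * part (deg k) (- int ?m) w0"
            unfolding w0 by (subst part_times_homogeneous[OF f Pk0[where n = ?m]]) simp_all
          finally show ?thesis by (simp add: w_def)
        qed
        have "laurent_cond deg ?Q j w" if j: "j \<in> J'" for j
          unfolding laurent_cond_def
        proof
          fix l
          have jJ: "j \<in> J" "j \<noteq> k" using j J by auto
          show "?Q j ^ l dvd part (deg j) (- int l) w"
          proof (cases "?\<delta> j")
            case False
            then have "?Q j ^ l dvd 1"
              using dvd_power_same[OF single_unit, of "B j" l] by (simp add: binom_def)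
            then show ?thesis by (rule dvd_trans) simp
          next
            case True
            then have \<epsilon>: "\<epsilon> j" "deg k (A j) = 0" "?Q j = ?P j"
              by (auto simp: degenerate_def binom_def)
            \<comment> \<open>As \<open>x_k\<close> does not occur in \<open>A j\<close>,
              sign-skew-symmetry keeps \<open>x_j\<close> out of \<open>B k\<close>, and minimality
              of the rank keeps it out of \<open>A k\<close>. So multiplication by
              \<open>P k\<close> does not mix degrees in \<open>x_j\<close>.\<close>
            have "deg j (B k) = 0" "deg j (A k) = 0"
              using exchange_systemD(7)[OF sys jJ(1) k(1) \<epsilon>(1,2)]
                exchange_systemD(5)[OF sys jJ(1) k(1) k(2)[OF jJ(1)]] .
            then have Pk_deg: "deg j g = 0" if "g \<in> keys (?P k)" for g
              using that by (auto simp: keys_binom split: if_splits)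
            have Pk: "deg j g = 0" if "g \<in> keys (?P k ^ ?m)" for g
              by (rule homogeneous_0_power[OF f Pk_deg that])
            have "laurent_cond deg ?Q j ?v"
              unfolding v_eq using binom_at_least[OF sys'] binom_degree_self[OF sys'] j J
              by (intro laurent_cond_std_map f) auto
            then have "?Q j ^ l dvd part (deg j) (- int l) ?v"
              unfolding laurent_cond_def by blast
            also have "part (deg j) (- int l) ?v = ?P k ^ ?m * part (deg j) (- int l) w"
              unfolding w by (subst part_times_homogeneous[OF f Pk]) simp_all
            finally have dvd: "?P j ^ l dvd ?P k ^ ?m * part (deg j) (- int l) w"
              unfolding \<epsilon> .
            show ?thesis unfolding \<epsilon>
            proof (cases "\<epsilon> k")
              case True
              have "c = 0" if "?P j * c = 0" for c
                using reg jJ(1) \<epsilon>(1) that unfolding regular_system_def by blast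
              moreover have "?P j dvd c" if "?P j dvd ?P k * c" for c
                using cop jJ k(1) True \<epsilon>(1) that unfolding coprime_system_def by metis
              ultimately show "?P j ^ l dvd part (deg j) (- int l) w"
                by (rule dvd_regular_coprime_power[OF _ _ dvd])
            next
              case False
              then have "?P k ^ ?m dvd 1"
                using dvd_power_same[OF single_unit, of "B k" ?m] by (simp add: binom_def)
              then show "?P j ^ l dvd part (deg j) (- int l) w"
                using dvd by (rule dvd_unit_mult_cancel)
            qed
          qed
        qed
        from psubset.IH[OF J(3) sys' regular_system_degenerate[OF reg J(4)]
            coprime_system_degenerate[OF cop J(4)] this]
        obtain D where D: "w = std_map deg ?Q J' D" by blast
        \<comment> \<open>The degenerate system does not involve \<open>x_k\<close>, so
          \<open>D\<close> can be restricted to one degree. This makes the exponent of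
          \<open>P k\<close> constant, equal to \<open>?m\<close>, when \<open>k\<close> is put
          back.\<close>
        define D' where "D' = part (deg k) (- int ?m) D"
        have "part (deg k) (- int ?m) w = std_map deg ?Q J' D'"
          unfolding D D'_def
          by (rule part_std_map_homogeneous[where deg = deg, OF f])
            (use degenerate_degree[OF sys k(1) _ k(2)] J in auto)
        then have D': "w = std_map deg ?Q J' D'" by (simp add: w_def part_part)
        have D'_deg: "deg k g = - int ?m" if "g \<in> keys D'" for g
          using that by (auto simp: D'_def keys_part)
        then have D'_low: "D' \<in> at_least (deg k) (- int ?m)" by (simp add: at_least_def)
        have ins: "std_map deg ?P J D' = ?P k ^ ?m * std_map deg ?P J' D'"
          unfolding J(1) by (rule std_map_insert) (use J D'_deg in auto)
        have "part (deg k) (- int ?m) (std_map deg ?P J D') =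
            ?P k ^ ?m * part (deg k) (- int ?m) (std_map deg ?P J' D')"
          unfolding ins by (subst part_times_homogeneous[OF f Pk0[where n = ?m]]) simp_all
        also have "part (deg k) (- int ?m) (std_map deg ?P J' D') =
            std_map deg ?Q J' (part (deg k) (- int ?m) D')"
          by (rule part_std_map_lowest_degenerate[OF sys k J(4) D'_low])
        also have "part (deg k) (- int ?m) D' = D'" by (simp add: D'_def part_part)
        finally have part_eq: "part (deg k) (- int ?m) (std_map deg ?P J D') = ?v"
          using w D' by simp
        let ?Y1 = "Y - std_map deg ?P J D'"
        have "?Y1 \<in> at_least (deg k) (- int ?m)"
          by (intro at_least_diff Suc.prems(2) std_map_at_least f D'_low)
            (use binom_at_least[OF sys k(1)] in auto)
        from at_least_remove_part[OF this] have "?Y1 \<in> at_least (deg k) (- int n)"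
          unfolding part_diff part_eq by simp
        have "laurent_cond deg ?P j ?Y1" if "j \<in> J" for j
          by (intro laurent_cond_diff std_laurent Suc.prems(1) that)
        from Suc.IH[OF this \<open>?Y1 \<in> at_least (deg k) (- int n)\<close>]
        have "\<exists>C. ?Y1 = std_map deg ?P J C" .
        then obtain C1 where "?Y1 = std_map deg ?P J C1" by blast
        then have "Y = std_map deg ?P J (C1 + D')" by (simp add: std_map_add algebra_simps)
        then show ?case by blast
      qed
      note main = this
      obtain d where "Y \<in> at_least (deg k) d" using ex_at_least by blast
      then have "Y \<in> at_least (deg k) (- int (nat (- d)))" by (rule at_least_mono) simp
      with psubset.prems(4) show ?thesis by (rule main)
    qed
  qed
qed

text \<open>As \<open>w\<close> is homogeneous, each part of \<open>c\<close> is, up to a unit and a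
  multiple of \<open>w\<close>, a monomial times a part of strictly lower degree; the recursion
  starts below the support of \<open>c\<close>. The case \<open>w = 0\<close> is allowed and yields
  regularity of the binomial.\<close>

lemma dvd_binomial_mult_cancel:
  fixes w c :: "'g::ab_group_add \<Rightarrow>\<^sub>0 int" and f :: "'g \<Rightarrow> int"
  assumes f: "additive f" and "f a \<noteq> f b" and w: "\<And>g. g \<in> keys w \<Longrightarrow> f g = e"
    and "w dvd (single a 1 + single b 1) * c"
  shows "w dvd c"
proof -
  \<comment> \<open>The recursion descends by \<open>f a - f b\<close>, so its sign is normalized
    first.\<close>
  have main: "w dvd c" if ab: "f b < f a" and dvd: "w dvd (single a 1 + single b 1) * c" for a b
  proof -
    from dvd obtain q where q: "(single a 1 + single b 1) * c = w * q" by (rule dvdE)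
    have 1: "part f (f b + d) (single x 1 * c) = single x 1 * part f (f b + d - f x) c" for x d
      by (rule part_times_homogeneous[OF f]) (auto split: if_splits)
    have 2: "single b 1 * part f d c =
        w * part f (f b + d - e) q - single a 1 * part f (d - (f a - f b)) c" for d
    proof -
      have "part f (f b + d) ((single a 1 + single b 1) * c) = w * part f (f b + d - e) q"
        unfolding q by (rule part_times_homogeneous[OF f w])
      then have "single a 1 * part f (f b + d - f a) c + single b 1 * part f (f b + d - f b) c =
          w * part f (f b + d - e) q"
        by (simp only: distrib_right part_add 1)
      then show ?thesis by (simp add: algebra_simps)
    qed
    obtain d0 where d0: "c \<in> at_least f d0" using ex_at_least by blast
    have "w dvd part f (d0 + int n) c" for n
    proof (induction n rule: less_induct)
      case (less n)
      have "w dvd part f (d0 + int n - (f a - f b)) c"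
      proof (cases "int n < f a - f b")
        case True
        then show ?thesis using part_at_least[OF d0, of "d0 + int n - (f a - f b)"] by simp
      next
        case False
        then have "w dvd part f (d0 + int (nat (int n - (f a - f b)))) c" using ab by (intro less) simp
          then show ?thesis using False by (simp add: algebra_simps)
      qed
      then have "w dvd single b 1 * part f (d0 + int n) c"
        unfolding 2 by (rule dvd_diff[OF dvd_triv_left dvd_mult])
      then show ?case by (rule dvd_unit_mult_cancel[OF single_unit])
    qed
    then have *: "w dvd part f (d0 + int (nat (d - d0))) c" for d .
    have "w dvd part f d c" for d
    proof (cases "d < d0")
      case True then show ?thesis using part_at_least[OF d0, of d] by simp
    next
      case False then show ?thesis using *[of d] by simp
    qed
    then have "w dvd (\<Sum>d\<in>f ` keys c. part f d c)" by (intro dvd_sum) auto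
    then show ?thesis using sum_parts[of "f ` keys c" f c] by simp
  qed
  show ?thesis
  proof (cases "f b < f a")
    case True
    then show ?thesis using assms(4) by (rule main)
  next
    case False
    then have "f a < f b" using assms(2) by simp
    then show ?thesis by (rule main) (use assms(4) in \<open>simp only: add.commute\<close>)
  qed
qed

section \<open>Mutation of Laurent expansions\<close>

lemma int_mult_of_nat: "int_mult (int n) a = (\<Sum>_<n. a)"
  by (simp add: int_mult_def)

lemma int_mult_minus: "int_mult (- z) a = - int_mult z a"
  by (cases "z = 0") (auto simp: int_mult_def)

lemma int_mult_hom:
  assumes "f 0 = 0" "\<And>u v. f (u + v) = f u + f v" "\<And>u. f (- u) = - f u"
  shows "f (int_mult z a) = int_mult z (f a)"
proof -
  have "f (\<Sum>_<n. a) = (\<Sum>_<n. f a)" for n :: nat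
    by (induction n) (auto simp: assms)
  then show ?thesis by (simp add: int_mult_def assms)
qed

lemma int_mult_int: "int_mult z a = z * (a :: int)"
  by (simp add: int_mult_def)

lemma fst_int_mult: "fst (int_mult z a) = int_mult z (fst a)"
  by (rule int_mult_hom) auto

lemma snd_int_mult: "snd (int_mult z a) = int_mult z (snd a)"
  by (rule int_mult_hom) auto

lemma int_mult_fun_int: "int_mult z v i = z * (v i :: int)"
  using int_mult_hom[of "\<lambda>v. v i" z v] by (simp add: int_mult_int)

lemma single_power: "single a (1::int) ^ n = single (int_mult (int n) a) 1"
  unfolding int_mult_of_nat by (induction n) (auto simp: mult_single add.commute)

section \<open>Laurent polynomials over a coefficient group, and the substitution of
  \<open>p / x_k\<close> for \<open>x_k\<close>\<close>

type_synonym ('q, 'n) exponent = "'q \<times> ('n \<Rightarrow> int)"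
type_synonym ('q, 'n) laurent = "('q, 'n) exponent \<Rightarrow>\<^sub>0 int"

definition ldeg :: "'n \<Rightarrow> ('q, 'n) exponent \<Rightarrow> int" where
  "ldeg i g = snd g i"

lemma additive_ldeg: "additive (ldeg i)"
  by unfold_locales (simp add: ldeg_def)

lemma ldeg_simps [simp]:
  "ldeg i 0 = 0" "ldeg i (g + h) = ldeg i g + ldeg i h" "ldeg i (g - h) = ldeg i g - ldeg i h"
  "ldeg i (- g) = - ldeg i g" "ldeg i (a, v) = v i"
  by (auto simp: ldeg_def)

definition flip :: "'n \<Rightarrow> ('q, 'n) exponent \<Rightarrow> ('q, 'n) exponent" where
  "flip k g = (fst g, (snd g)(k := - snd g k))"

lemma flip_add: "flip k (g + h) = flip k g + flip k h"
  by (auto simp: flip_def fun_eq_iff prod_eq_iff)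

lemma flip_zero [simp]: "flip k 0 = 0"
  by (auto simp: flip_def fun_eq_iff prod_eq_iff)

lemma ldeg_flip: "ldeg i (flip k g) = (if i = k then - ldeg i g else ldeg i g)"
  by (auto simp: flip_def ldeg_def)

lemma flip_fixed: "ldeg k g = 0 \<Longrightarrow> flip k g = g"
  by (auto simp: flip_def ldeg_def fun_eq_iff prod_eq_iff)

text \<open>Inversion of \<open>x_k\<close>. The numerator of \<open>p / x_k\<close> is carried
  separately in \<open>mutates\<close>.\<close>

definition reflect :: "'n \<Rightarrow> ('q::ab_group_add, 'n) laurent \<Rightarrow> ('q, 'n) laurent" where
  "reflect k = lin_ext (single 0) (\<lambda>g. single (flip k g) 1)"

interpretation reflect_ext: character_ext "single 0 :: int \<Rightarrow> ('q::ab_group_add, 'n) laurent"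
    "\<lambda>g. single (flip k g) 1" for k
  by unfold_locales (auto simp: mult_single flip_add)

lemma reflect_single: "reflect k (single g c) = single (flip k g) c"
  by (simp add: reflect_def mult_single)

lemma reflect_zero [simp]: "reflect k 0 = 0"
  and reflect_add: "reflect k (X + Y) = reflect k X + reflect k Y"
  and reflect_mult: "reflect k (X * Y) = reflect k X * reflect k Y"
  and reflect_sum: "reflect k (\<Sum>i\<in>I. Z i) = (\<Sum>i\<in>I. reflect k (Z i))"
  by (simp_all add: reflect_def std_ext.add reflect_ext.mult std_ext.sum)

lemma reflect_fixed:
  assumes "\<And>g. g \<in> keys p \<Longrightarrow> ldeg k g = 0"
  shows "reflect k p = p"
proof -
  have "reflect k p = (\<Sum>g\<in>keys p. single (flip k g) (lookup p g))"
    by (subst (1) poly_mapping_sum_single[of p]) (simp add: reflect_sum reflect_single)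
  also have "\<dots> = (\<Sum>g\<in>keys p. single g (lookup p g))"
    using assms by (intro sum.cong) (auto simp: flip_fixed)
  finally show ?thesis using poly_mapping_sum_single[of p] by simp
qed

text \<open>
  \<open>Y\<close> is a Laurent polynomial in \<open>x\<close> and \<open>Y'\<close> is its expansion in the cluster in which \<open>x\<^sub>k\<close> has been
  replaced by \<open>p / x\<^sub>k\<close>; both sides are multiplied with a power of \<open>p\<close> to avoid fractions.
\<close>

definition mutates ::
    "'n \<Rightarrow> ('q::ab_group_add, 'n) laurent \<Rightarrow> ('q, 'n) laurent \<Rightarrow>
     ('q, 'n) laurent \<Rightarrow> bool" where
  "mutates k p Y Y' \<longleftrightarrow> (\<forall>d. reflect k (part (ldeg k) d Y) * p ^ nat d =
     part (ldeg k) (- d) Y' * p ^ nat (- d))"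

lemma mutates_zero: "mutates k p 0 0"
  by (simp add: mutates_def)

lemma mutates_add: "mutates k p X X' \<Longrightarrow> mutates k p Y Y' \<Longrightarrow> mutates k p (X + Y) (X' + Y')"
  by (simp add: mutates_def part_add reflect_add distrib_right)

text \<open>The equation is \<open>X p^e = X'\<close> with negative powers of \<open>p\<close> moved
  to the other side. The cases are the signs of \<open>e\<close> and \<open>e + c\<close>;
  \<open>p\<close> is never cancelled.\<close>

lemma power_balance_shift:
  fixes p X X' :: "'a::comm_ring_1" and c e :: int
  assumes eq: "X * p ^ nat e = X' * p ^ nat (- e)" and "0 \<le> c"
  shows "X * p ^ nat (e + c) = X' * (p ^ nat c * p ^ nat (- (e + c)))"
proof -
  consider "0 \<le> e" | "e < 0" "0 \<le> e + c" | "e + c < 0" by linarith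
  then show ?thesis
  proof cases
    case 1
    then have "X * p ^ nat (e + c) = (X * p ^ nat e) * p ^ nat c"
      using assms(2) by (simp add: nat_add_distrib power_add mult.assoc)
    also have "\<dots> = X' * (p ^ nat c * p ^ nat (- (e + c)))"
      unfolding eq using 1 assms(2) by simp
    finally show ?thesis .
  next
    case 2
    have c: "nat c = nat (- e) + nat (e + c)" using 2 by simp
    have "X * p ^ nat (e + c) = (X * p ^ nat e) * p ^ nat (e + c)" using 2 by simp
    also have "\<dots> = X' * (p ^ nat c * p ^ nat (- (e + c)))"
      unfolding eq c using 2 by (simp add: power_add mult.assoc)
    finally show ?thesis .
  next
    case 3
    have e: "nat (- e) = nat c + nat (- (e + c))" using 3 assms(2) by simp
    have "X * p ^ nat (e + c) = X * p ^ nat e" using 3 assms(2) by simp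
    also have "\<dots> = X' * (p ^ nat c * p ^ nat (- (e + c)))"
      unfolding eq e power_add ..
    finally show ?thesis .
  qed
qed

context
  fixes k :: 'n and p :: "('q::ab_group_add, 'n) laurent"
  assumes p0: "\<And>g. g \<in> keys p \<Longrightarrow> ldeg k g = 0"
begin

lemma part_power_mult: "part (ldeg k) d (p ^ n * Y) = p ^ n * part (ldeg k) d Y"
  by (subst part_times_homogeneous[OF additive_ldeg homogeneous_0_power[OF additive_ldeg p0]]) auto

lemma mutates_single:
  "mutates k p (single g c * p ^ nat (- ldeg k g)) (single (flip k g) c * p ^ nat (ldeg k g))"
  unfolding mutates_def
proof
  fix d
  have part_mult: "part (ldeg k) e (Y * p ^ n) = part (ldeg k) e Y * p ^ n" for e Y n
    using part_power_mult[of e n Y] by (simp only: mult.commute)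
  have refl_p: "reflect k (p ^ n) = p ^ n" for n
    by (rule reflect_fixed) (rule homogeneous_0_power[OF additive_ldeg p0])
  show "reflect k (part (ldeg k) d (single g c * p ^ nat (- ldeg k g))) * p ^ nat d =
      part (ldeg k) (- d) (single (flip k g) c * p ^ nat (ldeg k g)) * p ^ nat (- d)"
  proof (cases "ldeg k g = d")
    case True
    then show ?thesis
      by (simp add: part_mult part_single reflect_mult reflect_single refl_p ldeg_flip)
  next
    case False
    then show ?thesis by (simp add: part_mult part_single ldeg_flip)
  qed
qed

text \<open>A nonnegative power of \<open>x_k\<close> turns into a power of \<open>p / x_k\<close>,
  so \<open>p\<close> stays in the numerator. A negative power would put it into a
  denominator.\<close>

lemma mutates_shift:
  assumes Y: "mutates k p Y Y'" and h: "0 \<le> ldeg k h"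
  shows "mutates k p (single h 1 * Y) (single (flip k h) 1 * p ^ nat (ldeg k h) * Y')"
  unfolding mutates_def
proof
  fix d
  let ?c = "ldeg k h"
  let ?e = "d - ?c"
  have 1: "part (ldeg k) d (single h 1 * Y) = single h 1 * part (ldeg k) ?e Y"
    by (rule part_times_homogeneous[OF additive_ldeg]) auto
  have "part (ldeg k) (- d) (single (flip k h) 1 * (p ^ nat ?c * Y')) =
      single (flip k h) 1 * part (ldeg k) (- d - (- ?c)) (p ^ nat ?c * Y')"
    by (rule part_times_homogeneous[OF additive_ldeg]) (auto simp: ldeg_flip)
  then have 2: "part (ldeg k) (- d) (single (flip k h) 1 * p ^ nat ?c * Y') =
      single (flip k h) 1 * (p ^ nat ?c * part (ldeg k) (- ?e) Y')"
    by (simp add: part_power_mult mult.assoc)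
  from Y have "reflect k (part (ldeg k) ?e Y) * p ^ nat ?e =
      part (ldeg k) (- ?e) Y' * p ^ nat (- ?e)" by (simp add: mutates_def)
  from power_balance_shift[OF this h]
  have "reflect k (part (ldeg k) ?e Y) * p ^ nat d =
      part (ldeg k) (- ?e) Y' * (p ^ nat ?c * p ^ nat (- d))" by simp
  from arg_cong[OF this, of "(*) (single (flip k h) 1)"]
  show "reflect k (part (ldeg k) d (single h 1 * Y)) * p ^ nat d =
      part (ldeg k) (- d) (single (flip k h) 1 * p ^ nat ?c * Y') * p ^ nat (- d)"
    unfolding 1 2 reflect_mult reflect_single by (simp only: ac_simps)
qed

lemma power_regular:
  assumes regular: "\<And>c. p * c = 0 \<Longrightarrow> c = 0" and "p ^ n * c = 0"
  shows "c = 0"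
  using assms(2)
proof (induction n)
  case (Suc n)
  then have "p * (p ^ n * c) = 0" by (simp add: mult.assoc)
  from Suc.IH[OF regular[OF this]] show ?case .
qed simp

lemma mutates_unique:
  assumes regular: "\<And>c. p * c = 0 \<Longrightarrow> c = 0"
    and Y: "mutates k p Y Y1" "mutates k p Y Y2"
  shows "Y1 = Y2"
proof (rule part_eqI)
  fix d
  from Y have "part (ldeg k) (- (- d)) Y1 * p ^ nat (- (- d)) = part (ldeg k) (- (- d)) Y2 * p ^ nat (- (- d))"
    unfolding mutates_def by metis
  then have "p ^ nat d * (part (ldeg k) d Y1 - part (ldeg k) d Y2) = 0"
    by (simp add: right_diff_distrib mult.commute)
  from power_regular[OF regular this] show "part (ldeg k) d Y1 = part (ldeg k) d Y2" by simp
qed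

lemma mutates_eq_0D:
  assumes regular: "\<And>c. p * c = 0 \<Longrightarrow> c = 0" and Y: "mutates k p Y 0"
  shows "Y = 0"
proof (rule part_eqI)
  fix d
  have flip_flip: "flip k (flip k g) = g" for g :: "('q, 'n) exponent"
    by (auto simp: flip_def)
  have reflect_reflect: "reflect k (reflect k Z) = Z" for Z :: "('q, 'n) laurent"
    by (induction Z rule: sum_single_induct) (simp_all add: reflect_add reflect_single flip_flip)
  from Y have "p ^ nat d * reflect k (part (ldeg k) d Y) = 0"
    by (simp add: mutates_def mult.commute)
  from power_regular[OF regular this] have "reflect k (reflect k (part (ldeg k) d Y)) = 0" by simp
  then show "part (ldeg k) d Y = part (ldeg k) d 0" by (simp add: reflect_reflect)
qed

text \<open>Positive powers of the old \<open>x_k\<close> become powers of \<open>p / x_k\<close>,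
  so every negative degree of the new expansion brings its own factors \<open>p\<close>.\<close>

lemma mutates_laurent_cond:
  assumes "mutates k p Y Y'" "P k = p"
  shows "laurent_cond ldeg P k Y'"
  unfolding laurent_cond_def
proof
  fix m
  from assms have "reflect k (part (ldeg k) (int m) Y) * P k ^ nat (int m) =
      part (ldeg k) (- int m) Y' * p ^ nat (- int m)" unfolding mutates_def by blast
  then have "part (ldeg k) (- int m) Y' = P k ^ m * reflect k (part (ldeg k) (int m) Y)"
    by (simp add: mult.commute)
  then show "P k ^ m dvd part (ldeg k) (- int m) Y'" by simp
qed

end

text \<open>Split \<open>X\<close> into homogeneous parts. In a product of parts of degrees
  \<open>d\<close> and \<open>- m - d\<close>, the negative degrees of the two factors together
  supply at least \<open>m\<close> factors \<open>P j\<close>.\<close>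

lemma laurent_cond_mult:
  assumes f: "\<And>i. additive (deg i)" and X: "laurent_cond deg P j X" and Y: "laurent_cond deg P j Y"
  shows "laurent_cond deg P j (X * Y)"
  unfolding laurent_cond_def
proof
  fix m
  have "P j ^ m dvd part (deg j) d X * part (deg j) (- int m - d) Y" for d
  proof -
    have Y': "P j ^ nat (int m + d) dvd part (deg j) (- int m - d) Y" if "0 \<le> int m + d"
    proof -
      have "- int (nat (int m + d)) = - int m - d" using that by simp
      then show ?thesis using Y[unfolded laurent_cond_def, rule_format, of "nat (int m + d)"] by simp
    qed
    have X': "P j ^ nat (- d) dvd part (deg j) d X" if "d \<le> 0"
      using X[unfolded laurent_cond_def, rule_format, of "nat (- d)"] that by simp
    consider "0 \<le> d" | "d < 0" "0 \<le> int m + d" | "d < 0" "int m + d < 0" by linarith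
    then show ?thesis
    proof cases
      case 1
      then have "P j ^ m dvd P j ^ nat (int m + d)" by (intro le_imp_power_dvd) auto
      also have "\<dots> dvd part (deg j) (- int m - d) Y" using 1 by (intro Y') simp
      finally show ?thesis by (rule dvd_mult)
    next
      case 2
      then have "m = nat (- d) + nat (int m + d)" by auto
      then have "P j ^ m = P j ^ nat (- d) * P j ^ nat (int m + d)" by (metis power_add)
      moreover have "P j ^ nat (- d) * P j ^ nat (int m + d) dvd
          part (deg j) d X * part (deg j) (- int m - d) Y"
        using 2 by (intro mult_dvd_mono X' Y') auto
      ultimately show ?thesis by simp
    next
      case 3
      then have "P j ^ m dvd P j ^ nat (- d)" by (intro le_imp_power_dvd) auto
      also have "\<dots> dvd part (deg j) d X" using 3 by (intro X') simp
      finally show ?thesis by (rule dvd_mult2)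
    qed
  qed
  moreover have "part (deg j) (- int m) (part (deg j) d X * Y) =
      part (deg j) d X * part (deg j) (- int m - d) Y" for d
    by (rule part_times_homogeneous[OF f]) (auto simp: keys_part)
  ultimately have "P j ^ m dvd (\<Sum>d\<in>deg j ` keys X. part (deg j) (- int m) (part (deg j) d X * Y))"
    by (intro dvd_sum) auto
  also have "\<dots> = part (deg j) (- int m) ((\<Sum>d\<in>deg j ` keys X. part (deg j) d X) * Y)"
    by (simp add: part_sum sum_distrib_right)
  also have "(\<Sum>d\<in>deg j ` keys X. part (deg j) d X) = X"
    by (rule sum_parts[symmetric]) auto
  finally show "P j ^ m dvd part (deg j) (- int m) (X * Y)" .
qed

lemma laurent_cond_power:
  assumes "\<And>i. additive (deg i)" "laurent_cond deg P j X"
  shows "laurent_cond deg P j (X ^ n)"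
proof (induction n)
  case 0
  then show ?case using assms(1) by (simp add: laurent_cond_at_least at_least_one)
next
  case (Suc n)
  then show ?case using laurent_cond_mult[OF assms] by simp
qed

section \<open>Exchange binomials and their behavior under mutation\<close>

definition pos_term :: "('n \<Rightarrow> 'n \<Rightarrow> int) \<Rightarrow> ('n \<Rightarrow> 'q) \<Rightarrow> 'n \<Rightarrow> ('q, 'n) exponent" where
  "pos_term B a j = (a j, \<lambda>i. max 0 (B i j))"

definition neg_term :: "('n \<Rightarrow> 'n \<Rightarrow> int) \<Rightarrow> ('n \<Rightarrow> 'q) \<Rightarrow> 'n \<Rightarrow> ('q, 'n) exponent" where
  "neg_term B b j = (b j, \<lambda>i. max 0 (- B i j))"

definition lpoly ::
    "('n \<Rightarrow> 'n \<Rightarrow> int) \<Rightarrow> ('n \<Rightarrow> 'q::ab_group_add) \<Rightarrow> ('n \<Rightarrow> 'q) \<Rightarrow> 'n \<Rightarrow> ('q, 'n) laurent" where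
  "lpoly B a b = binom (pos_term B a) (neg_term B b) (\<lambda>_. True)"

lemma lpoly_eq: "lpoly B a b j = single (pos_term B a j) 1 + single (neg_term B b j) 1"
  by (simp add: lpoly_def binom_def)

lemma keys_lpoly: "keys (lpoly B a b j) = {pos_term B a j, neg_term B b j}"
  by (simp add: lpoly_def keys_binom)

lemma sign_skew_diag: "sign_skew_symmetric B \<Longrightarrow> B j j = 0"
  unfolding sign_skew_symmetric_def by (metis not_square_less_zero)

lemma lpoly_degree_self:
  assumes "sign_skew_symmetric B" "g \<in> keys (lpoly B a b j)"
  shows "ldeg j g = 0"
  using assms sign_skew_diag[OF assms(1)] by (auto simp: keys_lpoly pos_term_def neg_term_def)

text \<open>The coefficient rule of \<open>seed_mutation\<close> over an arbitrary group, so that it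
  covers both the original coefficients and their lifts.\<close>

definition coeff_mutation ::
    "'n \<Rightarrow> ('n \<Rightarrow> 'n \<Rightarrow> int) \<Rightarrow> ('n \<Rightarrow> 'q::ab_group_add) \<Rightarrow> ('n \<Rightarrow> 'q) \<Rightarrow> ('n \<Rightarrow> 'q) \<Rightarrow> ('n \<Rightarrow> 'q) \<Rightarrow> bool" where
  "coeff_mutation k B a b a' b' \<longleftrightarrow> a' k = b k \<and> b' k = a k \<and>
     (\<forall>i. i \<noteq> k \<longrightarrow> (B k i \<ge> 0 \<longrightarrow> a' i - b' i = int_mult (B k i) (a k) + (a i - b i)) \<and>
        (B k i \<le> 0 \<longrightarrow> a' i - b' i = int_mult (B k i) (b k) + (a i - b i)))"

lemma sign_skew_pos:
  assumes "sign_skew_symmetric B"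
  shows "0 < B i j \<longleftrightarrow> B j i < 0"
proof -
  have "B i j = 0 \<and> B j i = 0 \<or> B i j * B j i < 0"
    using assms by (auto simp: sign_skew_symmetric_def)
  then show ?thesis by (auto simp: mult_less_0_iff)
qed

lemma mutation_term_neg:
  "(- (\<bar>x\<bar> * y) - x * \<bar>y\<bar>) div 2 = - ((\<bar>x\<bar> * y + x * \<bar>y\<bar>) div 2)" for x y :: int
proof -
  have "even (\<bar>x\<bar> * y + x * \<bar>y\<bar>)" by (auto simp: abs_if)
  then obtain c where c: "\<bar>x\<bar> * y + x * \<bar>y\<bar> = 2 * c" by (rule evenE)
  have "- (\<bar>x\<bar> * y) - x * \<bar>y\<bar> = 2 * (- c)" using c by simp
  then show ?thesis unfolding c by simp
qed

lemma matrix_mutation_neg: "matrix_mutation k (\<lambda>i j. - B i j) = (\<lambda>i j. - matrix_mutation k B i j)"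
  by (auto simp: matrix_mutation_def fun_eq_iff mutation_term_neg)

lemma matrix_mutation_nonneg:
  assumes "i \<noteq> k" "j \<noteq> k" "0 \<le> B k j"
  shows "matrix_mutation k B i j = B i j + B k j * max 0 (B i k)"
  using assms by (cases "0 \<le> B i k") (auto simp: matrix_mutation_def max_def)

text \<open>Part of the symmetry that reduces mutation to the case \<open>0 \<le> B k j\<close>; the
  companions are \<open>matrix_mutation_neg\<close> and \<open>coeff_mutation_neg\<close>.\<close>

lemma lpoly_neg: "lpoly (\<lambda>i j. - B i j) b a = lpoly B a b"
  by (auto simp: fun_eq_iff lpoly_eq pos_term_def neg_term_def add.commute)

lemma coeff_mutation_neg:
  fixes a :: "'n \<Rightarrow> 'q::ab_group_add"
  assumes "coeff_mutation k B a b a' b'"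
  shows "coeff_mutation k (\<lambda>i j. - B i j) b a b' a'"
proof -
  have *: "y - x = v - u - z" if "x - y = z + (u - v)" for x y z u v :: 'q
    using arg_cong[OF that, of uminus] by (simp add: algebra_simps)
  show ?thesis using assms unfolding coeff_mutation_def by (auto simp: int_mult_minus intro!: *)
qed

lemma lpoly_mutation_self:
  assumes "coeff_mutation k B a b a' b'"
  shows "lpoly (matrix_mutation k B) a' b' k = lpoly B a b k"
  using assms by (simp add: lpoly_eq pos_term_def neg_term_def coeff_mutation_def
      matrix_mutation_def add.commute)

text \<open>The binomial theorem modulo \<open>y\<close>. What matters is that \<open>V\<close>
  stays in \<open>at_least f 0\<close>, so that it cannot undo a positive degree contributed by
  \<open>y\<close>.\<close>

lemma power_sum_expand:
  fixes x y :: "'g::ab_group_add \<Rightarrow>\<^sub>0 int"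
  assumes f: "additive f" and x: "x \<in> at_least f 0" and y: "y \<in> at_least f 0"
  shows "\<exists>V\<in>at_least f 0. (x + y) ^ n = x ^ n + y * V"
proof (induction n)
  case (Suc n)
  then obtain V where V: "V \<in> at_least f 0" "(x + y) ^ n = x ^ n + y * V" by blast
  have "(x + y) ^ Suc n = x ^ Suc n + y * (x ^ n + (x + y) * V)"
    by (simp add: V(2) algebra_simps)
  moreover have "x ^ n + (x + y) * V \<in> at_least f 0"
    by (intro at_least_add at_least_power at_least_mult_0 f x y V)
  ultimately show ?case by blast
qed (auto intro: bexI[of _ 0])

definition unit_vec :: "'n \<Rightarrow> ('q::zero, 'n) exponent" where
  "unit_vec j = (0, \<lambda>i. if i = j then 1 else 0)"

lemma ldeg_unit_vec: "ldeg i (unit_vec j) = (if i = j then 1 else 0)"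
  by (simp add: unit_vec_def)

context
  fixes B B' :: "'n \<Rightarrow> 'n \<Rightarrow> int" and a b a' b' :: "'n \<Rightarrow> 'q::ab_group_add" and j k :: 'n
  assumes skew: "sign_skew_symmetric B" and skew': "sign_skew_symmetric B'"
    and B': "B' = matrix_mutation k B" and coeff: "coeff_mutation k B a b a' b'"
    and jk: "j \<noteq> k" and nonneg: "0 \<le> B k j"
begin

text \<open>The mutation rules for matrix and coefficients at \<open>j \<noteq> k\<close>, combined
  into one identity of exponents. It makes the mutated \<open>P_j\<close>, reduced modulo
  \<open>x_j\<close>, a monomial times the new exchange polynomial.\<close>

lemma exponent_mutation:
  "flip k (pos_term B a j) + int_mult (B k j) (pos_term B a k) - neg_term B b j =
    pos_term B' a' j - neg_term B' b' j"
proof (rule prod_eqI)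
  have "a' j - b' j = int_mult (B k j) (a k) + (a j - b j)"
    using coeff jk nonneg by (auto simp: coeff_mutation_def)
  then show "fst (flip k (pos_term B a j) + int_mult (B k j) (pos_term B a k) - neg_term B b j) =
      fst (pos_term B' a' j - neg_term B' b' j)"
    by (simp add: flip_def pos_term_def neg_term_def fst_int_mult algebra_simps)
next
  have "(if i = k then - max 0 (B k j) else max 0 (B i j)) + B k j * max 0 (B i k) - max 0 (- B i j) =
      max 0 (B' i j) - max 0 (- B' i j)" for i
  proof -
    have "max 0 x - max 0 (- x) = x" for x :: int by auto
    moreover have "B' i j = (if i = k then - B k j else B i j + B k j * max 0 (B i k))"
      using jk nonneg by (auto simp: B' matrix_mutation_nonneg) (simp add: matrix_mutation_def)
    ultimately show ?thesis
      using nonneg sign_skew_diag[OF skew] by (auto simp: max_def)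
  qed
  then show "snd (flip k (pos_term B a j) + int_mult (B k j) (pos_term B a k) - neg_term B b j) =
      snd (pos_term B' a' j - neg_term B' b' j)"
    by (auto simp: flip_def pos_term_def neg_term_def snd_int_mult int_mult_fun_int fun_eq_iff)
qed

text \<open>The expansion of \<open>P\<^sub>j\<close> after substituting \<open>P\<^sub>k / x\<^sub>k\<close> for \<open>x\<^sub>k\<close>.\<close>

definition lpoly_mutated :: "('q, 'n) laurent" where
  "lpoly_mutated = single (flip k (pos_term B a j)) 1 * lpoly B a b k ^ nat (B k j) +
     single (neg_term B b j) 1"

text \<open>This element is the old \<open>x_j'\<close> written in the new cluster. It is a monomial
  free of \<open>x_j\<close> times the new \<open>x_j'\<close>, plus a term \<open>W\<close> without
  negative powers of \<open>x_j\<close>.\<close>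

lemma laurent_cond_lpoly_mutated:
  "laurent_cond ldeg (lpoly B' a' b') j (single (- unit_vec j) 1 * lpoly_mutated)"
proof -
  let ?A = "pos_term B a k" and ?N = "neg_term B b k" and ?c = "nat (B k j)"
  let ?h = "flip k (pos_term B a j)" and ?e = "- unit_vec j :: ('q, 'n) exponent"
  let ?u = "neg_term B b j - neg_term B' b' j"
  note f = additive_ldeg
  have pos: "single ?A 1 \<in> at_least (ldeg j) 0" "single ?N 1 \<in> at_least (ldeg j) 0"
    by (auto intro!: at_least_single simp: pos_term_def neg_term_def)
  obtain V where V: "V \<in> at_least (ldeg j) 0"
    "(single ?A 1 + single ?N 1) ^ ?c = single ?A (1::int) ^ ?c + single ?N 1 * V"
    using power_sum_expand[OF f pos] by blast
  \<comment> \<open>If \<open>B k j > 0\<close>, sign-skew-symmetry puts \<open>x_j\<close> into the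
    second term of \<open>P_k\<close>, which compensates \<open>- unit_vec j\<close>. If
    \<open>B k j = 0\<close>, then \<open>P_k\<close> does not enter.\<close>
  define W where "W = (if B k j = 0 then 0 else single (?h + ?N + ?e) 1 * V)"
  have h0: "ldeg j ?h = 0"
    using jk sign_skew_diag[OF skew] by (simp add: ldeg_flip pos_term_def)
  have W: "W \<in> at_least (ldeg j) 0"
  proof (cases "B k j = 0")
    case False
    then have "B j k < 0" using nonneg sign_skew_pos[OF skew, of k j] by auto
    then have "0 \<le> ldeg j (?h + ?N + ?e)"
      using h0 by (simp add: ldeg_unit_vec neg_term_def)
    then have "single (?h + ?N + ?e) 1 * V \<in> at_least (ldeg j) 0"
      by (intro at_least_mult_0 f V at_least_single) auto
    then show ?thesis using False by (simp add: W_def)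
  qed (simp add: W_def)
  have exps: "?h + int_mult (B k j) ?A = ?u + pos_term B' a' j"
    using exponent_mutation by (simp add: algebra_simps)
  have "single ?h 1 * single ?A 1 ^ ?c + single (neg_term B b j) 1 =
      single ?u 1 * lpoly B' a' b' j"
    using nonneg exps by (simp add: single_power mult_single lpoly_eq distrib_left)
  then have main: "single ?e 1 * (single ?h 1 * single ?A 1 ^ ?c + single (neg_term B b j) 1) =
      single ?u 1 * (single ?e 1 * lpoly B' a' b' j)" by (simp only: mult.left_commute)
  have "single ?e 1 * lpoly_mutated =
      single ?e 1 * (single ?h 1 * single ?A 1 ^ ?c + single (neg_term B b j) 1) + W"
  proof (cases "B k j = 0")
    case False
    have W_eq: "W = single ?e 1 * (single ?h 1 * (single ?N 1 * V))"
      using False by (simp add: W_def mult_single mult.assoc[symmetric] ac_simps)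
    show ?thesis
      unfolding lpoly_mutated_def lpoly_eq V(2) W_eq by (simp only: distrib_left ac_simps)
  qed (simp add: lpoly_mutated_def W_def)
  also have "\<dots> = single ?u 1 * (single ?e 1 * lpoly B' a' b' j) + W" unfolding main ..
  also have "laurent_cond ldeg (lpoly B' a' b') j \<dots>"
  proof (rule laurent_cond_add[OF laurent_cond_mult[OF f]])
    show "laurent_cond ldeg (lpoly B' a' b') j W" using W by (rule laurent_cond_at_least)
    have "ldeg j ?u = 0" using sign_skew_diag[OF skew] sign_skew_diag[OF skew']
      by (simp add: neg_term_def)
    then show "laurent_cond ldeg (lpoly B' a' b') j (single ?u 1)"
      by (intro laurent_cond_at_least at_least_single) auto
    have "ldeg j g = 0" if "g \<in> keys (lpoly B' a' b' j)" for g
      by (rule lpoly_degree_self[OF skew' that])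
    then have "part (ldeg j) (- int m) (lpoly B' a' b' j * single ?e 1) =
        lpoly B' a' b' j * part (ldeg j) (- int m - 0) (single ?e 1)" for m
      by (intro part_times_homogeneous f)
    then show "laurent_cond ldeg (lpoly B' a' b') j (single ?e 1 * lpoly B' a' b' j)"
      unfolding laurent_cond_def
      by (auto simp: part_single ldeg_unit_vec when_def mult.commute[of "single _ _"])
  qed
  finally show ?thesis .
qed

text \<open>Each factor \<open>P_j\<close> is split into its two monomials. By
  \<open>0 \<le> B k j\<close> both have nonnegative degree in \<open>x_k\<close>, as
  \<open>mutates_shift\<close> requires.\<close>

lemma mutates_lpoly_power:
  assumes "mutates k (lpoly B a b k) Y Y'"
  shows "mutates k (lpoly B a b k) (lpoly B a b j ^ n * Y) (lpoly_mutated ^ n * Y')"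
proof (induction n)
  case (Suc n)
  let ?p = "lpoly B a b k"
  have p0: "g \<in> keys ?p \<Longrightarrow> ldeg k g = 0" for g
    by (rule lpoly_degree_self[OF skew])
  have 1: "ldeg k (pos_term B a j) = B k j" "ldeg k (neg_term B b j) = 0"
    using nonneg by (auto simp: pos_term_def neg_term_def)
  have "mutates k ?p (single (pos_term B a j) 1 * (lpoly B a b j ^ n * Y) +
        single (neg_term B b j) 1 * (lpoly B a b j ^ n * Y))
      (single (flip k (pos_term B a j)) 1 * ?p ^ nat (ldeg k (pos_term B a j)) * (lpoly_mutated ^ n * Y') +
       single (flip k (neg_term B b j)) 1 * ?p ^ nat (ldeg k (neg_term B b j)) * (lpoly_mutated ^ n * Y'))"
    by (intro mutates_add mutates_shift p0 Suc.IH) (use 1 nonneg in auto)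
  moreover have "single (pos_term B a j) 1 * (lpoly B a b j ^ n * Y) +
        single (neg_term B b j) 1 * (lpoly B a b j ^ n * Y) = lpoly B a b j ^ Suc n * Y"
    unfolding power_Suc by (subst (3) lpoly_eq) (simp only: distrib_right mult.assoc)
  moreover have "single (flip k (pos_term B a j)) 1 * ?p ^ nat (ldeg k (pos_term B a j)) * (lpoly_mutated ^ n * Y') +
       single (flip k (neg_term B b j)) 1 * ?p ^ nat (ldeg k (neg_term B b j)) * (lpoly_mutated ^ n * Y') =
       lpoly_mutated ^ Suc n * Y'"
    unfolding power_Suc by (subst (3) lpoly_mutated_def)
      (simp add: 1 flip_fixed[OF 1(2)] distrib_right mult.assoc)
  ultimately show ?case by simp
qed (use assms in simp)

lemma ex_mutates_std_map:
  "\<exists>Z. mutates k (lpoly B a b k) (std_map ldeg (lpoly B a b) {k, j} C) Z \<and>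
     laurent_cond ldeg (lpoly B' a' b') j Z"
proof (induction C rule: sum_single_induct)
  case zero
  then show ?case by (intro exI[of _ 0]) (simp add: mutates_zero)
next
  case (add C D)
  then show ?case by (metis std_map_add mutates_add laurent_cond_add)
next
  case (single g c)
  let ?p = "lpoly B a b k" and ?L = "laurent_cond ldeg (lpoly B' a' b') j"
  note f = additive_ldeg
  have p0: "g \<in> keys ?p \<Longrightarrow> ldeg k g = 0" for g
    by (rule lpoly_degree_self[OF skew])
  define n where "n = nat (- ldeg j g)"
  let ?Z = "lpoly_mutated ^ n * (single (flip k g) c * ?p ^ nat (ldeg k g))"
  have "mutates k ?p (lpoly B a b j ^ n * (single g c * ?p ^ nat (- ldeg k g))) ?Z"
    by (intro mutates_lpoly_power mutates_single p0)
  moreover have "lpoly B a b j ^ n * (single g c * ?p ^ nat (- ldeg k g)) =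
      std_map ldeg (lpoly B a b) {k, j} (single g c)"
    using jk by (simp add: std_map_single n_def ac_simps)
  moreover have "?L ?Z"
  proof -
    let ?e = "unit_vec j :: ('q, 'n) exponent"
    \<comment> \<open>Each of the \<open>n\<close> factors \<open>lpoly_mutated\<close> is paired
      with one inverse of \<open>x_j\<close> taken from the monomial; what remains has no negative
      power of \<open>x_j\<close>.\<close>
    let ?h = "flip k g + int_mult (int n) ?e"
    have "ldeg j (int_mult (int n) ?e) = int n"
      by (simp add: unit_vec_def ldeg_def snd_int_mult int_mult_fun_int)
    then have h: "0 \<le> ldeg j ?h" using jk by (simp add: ldeg_flip n_def)
    have "single (- ?e) (1::int) ^ n = single (- int_mult (int n) ?e) 1"
      unfolding single_power using int_mult_hom[of uminus "int n" ?e] by simp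
    then have "single (flip k g) c = single ?h c * single (- ?e) 1 ^ n"
      by (simp add: mult_single)
    then have Z: "?Z = (single (- ?e) 1 * lpoly_mutated) ^ n * (single ?h c * ?p ^ nat (ldeg k g))"
      by (simp add: power_mult_distrib ac_simps)
    have "?p \<in> at_least (ldeg j) 0"
      by (auto simp: at_least_def keys_lpoly pos_term_def neg_term_def)
    then have "single ?h c * ?p ^ nat (ldeg k g) \<in> at_least (ldeg j) 0"
      by (intro at_least_mult_0 f at_least_power at_least_single) (use h in auto)
    then have "?L (single ?h c * ?p ^ nat (ldeg k g))" by (rule laurent_cond_at_least)
    then show ?thesis
      unfolding Z by (rule laurent_cond_mult[OF f laurent_cond_power[OF f laurent_cond_lpoly_mutated]])
  qed
  ultimately show ?case by auto
qed

text \<open>As \<open>0 \<le> B k j\<close>, an arrow can only lead from \<open>k\<close> to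
  \<open>j\<close>, which dictates the ranks 0 and 1.\<close>

lemma exchange_system_pair:
  "exchange_system ldeg (\<lambda>i. if i = k then 0 else 1) (pos_term B a) (neg_term B b) (\<lambda>_. True) {k, j}"
proof -
  have "B j k \<le> 0" "0 < - B j k \<longrightarrow> 0 < B k j"
    using nonneg sign_skew_pos[OF skew, of j k] sign_skew_pos[OF skew, of k j] by auto
  then show ?thesis
    unfolding exchange_system_def
    using jk nonneg sign_skew_diag[OF skew] additive_ldeg
    by (auto simp: pos_term_def neg_term_def)
qed

end

lemma exchange_system_singleton:
  assumes "sign_skew_symmetric B"
  shows "exchange_system ldeg r (pos_term B a) (neg_term B b) (\<lambda>_. True) {k}"
  using sign_skew_diag[OF assms] additive_ldeg
  by (auto simp: exchange_system_def pos_term_def neg_term_def)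

section \<open>Invariance of the upper bound under mutation\<close>

definition generic_system :: "('n \<Rightarrow> 'n \<Rightarrow> int) \<Rightarrow> ('n \<Rightarrow> 'q::ab_group_add) \<Rightarrow> ('n \<Rightarrow> 'q) \<Rightarrow> bool" where
  "generic_system B a b \<longleftrightarrow> regular_system (pos_term B a) (neg_term B b) (\<lambda>_. True) UNIV \<and>
     coprime_system (pos_term B a) (neg_term B b) (\<lambda>_. True) UNIV"

lemma generic_systemD:
  assumes "generic_system B a b"
  shows "regular_system (pos_term B a) (neg_term B b) (\<lambda>_. True) J"
    and "coprime_system (pos_term B a) (neg_term B b) (\<lambda>_. True) J"
  using assms system_subset(2,3)[of "pos_term B a" "neg_term B b" "\<lambda>_. True" UNIV J]
  by (simp_all add: generic_system_def)

lemma generic_system_neg: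
  assumes "generic_system B a b"
  shows "generic_system (\<lambda>i j. - B i j) b a"
proof -
  have "binom (pos_term (\<lambda>i j. - B i j) b) (neg_term (\<lambda>i j. - B i j) a) (\<lambda>_. True) =
      binom (pos_term B a) (neg_term B b) (\<lambda>_. True)"
    using lpoly_neg[of B b a] by (simp add: lpoly_def)
  with assms show ?thesis
    unfolding generic_system_def regular_system_def coprime_system_def by (simp only:)
qed

lemma ex_mutates_laurent_cond:
  fixes B :: "'n \<Rightarrow> 'n \<Rightarrow> int" and a b :: "'n \<Rightarrow> 'q::ab_group_add"
  assumes skew: "sign_skew_symmetric B" "sign_skew_symmetric (matrix_mutation k B)"
    and gen: "generic_system B a b" and coeff: "coeff_mutation k B a b a' b'" and jk: "j \<noteq> k"
    and Y: "laurent_cond ldeg (lpoly B a b) k Y" "laurent_cond ldeg (lpoly B a b) j Y"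
  shows "\<exists>Z. mutates k (lpoly B a b k) Y Z \<and> laurent_cond ldeg (lpoly (matrix_mutation k B) a' b') j Z"
proof -
  have main: "\<exists>Z. mutates k (lpoly B a b k) Y Z \<and> laurent_cond ldeg (lpoly (matrix_mutation k B) a' b') j Z"
    if skew: "sign_skew_symmetric B" "sign_skew_symmetric (matrix_mutation k B)"
      and gen: "generic_system B a b" and coeff: "coeff_mutation k B a b a' b'" and nonneg: "0 \<le> B k j"
      and Y: "laurent_cond ldeg (lpoly B a b) k Y" "laurent_cond ldeg (lpoly B a b) j Y"
    for B :: "'n \<Rightarrow> 'n \<Rightarrow> int" and a b a' b' :: "'n \<Rightarrow> 'q"
  proof -
    have "\<exists>C. Y = std_map ldeg (binom (pos_term B a) (neg_term B b) (\<lambda>_. True)) {k, j} C"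
      by (rule laurent_cond_imp_std_map[OF exchange_system_pair[OF skew refl coeff jk nonneg]
            generic_systemD[OF gen]])
        (use Y in \<open>auto simp: lpoly_def\<close>)
    then obtain C where "Y = std_map ldeg (lpoly B a b) {k, j} C" by (auto simp: lpoly_def)
    then show ?thesis using ex_mutates_std_map[OF skew refl coeff jk nonneg, of C] by simp
  qed
  show ?thesis
  proof (cases "0 \<le> B k j")
    case True
    from main[OF skew gen coeff this Y] show ?thesis .
  next
    case False
    have neg: "sign_skew_symmetric (\<lambda>i j. - M i j)" if "sign_skew_symmetric M" for M :: "'n \<Rightarrow> 'n \<Rightarrow> int"
      using that by (simp add: sign_skew_symmetric_def)
    have "\<exists>Z. mutates k (lpoly (\<lambda>i j. - B i j) b a k) Y Z \<and>
        laurent_cond ldeg (lpoly (matrix_mutation k (\<lambda>i j. - B i j)) b' a') j Z"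
      by (rule main[OF neg[OF skew(1)] _ generic_system_neg[OF gen] coeff_mutation_neg[OF coeff]])
        (use False neg[OF skew(2)] Y in \<open>simp_all add: matrix_mutation_neg lpoly_neg\<close>)
    then show ?thesis by (simp add: matrix_mutation_neg lpoly_neg)
  qed
qed

text \<open>The condition in direction \<open>k\<close> yields a new expansion, which automatically
  satisfies its own condition in direction \<open>k\<close>. For every other \<open>j\<close> the
  pair of directions yields an expansion with the condition at \<open>j\<close>; uniqueness
  identifies all of these with \<open>Y'\<close>.\<close>

theorem upper_bound_mutation:
  fixes B :: "'n \<Rightarrow> 'n \<Rightarrow> int" and a b :: "'n \<Rightarrow> 'q::ab_group_add"
  assumes skew: "sign_skew_symmetric B" "sign_skew_symmetric (matrix_mutation k B)"
    and gen: "generic_system B a b" and coeff: "coeff_mutation k B a b a' b'"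
    and Y: "\<And>j. laurent_cond ldeg (lpoly B a b) j Y"
  obtains Y' where "mutates k (lpoly B a b k) Y Y'"
    "\<And>j. laurent_cond ldeg (lpoly (matrix_mutation k B) a' b') j Y'"
proof -
  let ?p = "lpoly B a b k"
  have p0: "g \<in> keys ?p \<Longrightarrow> ldeg k g = 0" for g
    by (rule lpoly_degree_self[OF skew(1)])
  have reg: "c = 0" if "?p * c = 0" for c
    using gen that unfolding generic_system_def regular_system_def lpoly_def by blast
  have "\<exists>C. Y = std_map ldeg (binom (pos_term B a) (neg_term B b) (\<lambda>_. True)) {k} C"
    by (rule laurent_cond_imp_std_map[OF exchange_system_singleton[OF skew(1)] generic_systemD[OF gen]])
      (use Y in \<open>auto simp: lpoly_def\<close>)
  then obtain C where C: "Y = std_map ldeg (lpoly B a b) {k} C" by (auto simp: lpoly_def)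
  have "\<exists>Z. mutates k ?p (std_map ldeg (lpoly B a b) {k} C) Z"
  proof (induction C rule: sum_single_induct)
    case (single g c)
    have "mutates k ?p (single g c * ?p ^ nat (- ldeg k g)) (single (flip k g) c * ?p ^ nat (ldeg k g))"
      by (rule mutates_single) (rule p0)
    then have "mutates k ?p (std_map ldeg (lpoly B a b) {k} (single g c))
        (single (flip k g) c * ?p ^ nat (ldeg k g))" by (simp add: std_map_single)
    then show ?case by (rule exI)
  next
    case (add C D)
    then show ?case by (metis std_map_add mutates_add)
  qed (auto intro: mutates_zero)
  then obtain Y' where Y': "mutates k ?p Y Y'" unfolding C by blast
  have "laurent_cond ldeg (lpoly (matrix_mutation k B) a' b') j Y'" for j
  proof (cases "j = k")
    case True
    then show ?thesis
      using mutates_laurent_cond[OF p0 Y', of "lpoly (matrix_mutation k B) a' b'"]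
        lpoly_mutation_self[OF coeff] by simp
  next
    case False
    from ex_mutates_laurent_cond[OF skew gen coeff False Y Y] obtain Z
      where Z: "mutates k ?p Y Z" "laurent_cond ldeg (lpoly (matrix_mutation k B) a' b') j Z" by blast
    with mutates_unique[OF p0 reg Y' Z(1)] show ?thesis by simp
  qed
  with Y' show thesis by (rule that)
qed

section \<open>Evaluation of Laurent expansions\<close>

definition leval :: "('q \<Rightarrow> 'f::field) \<Rightarrow> ('n::finite \<Rightarrow> 'f) \<Rightarrow> ('q, 'n) laurent \<Rightarrow> 'f" where
  "leval \<kappa> x = lin_ext of_int (\<lambda>g. \<kappa> (fst g) * (\<Prod>i\<in>UNIV. x i powi snd g i))"

locale laurent_eval =
  fixes \<kappa> :: "'q::ab_group_add \<Rightarrow> 'f::field" and x :: "'n::finite \<Rightarrow> 'f"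
  assumes \<kappa>_zero: "\<kappa> 0 = 1" and \<kappa>_add: "\<kappa> (u + v) = \<kappa> u * \<kappa> v" and nonzero: "x i \<noteq> 0"
begin

sublocale ev: character_ext "of_int :: int \<Rightarrow> 'f" "\<lambda>g. \<kappa> (fst g) * (\<Prod>i\<in>UNIV. x i powi snd g i)"
  by unfold_locales
    (auto simp: \<kappa>_zero \<kappa>_add power_int_add nonzero prod.distrib ac_simps)

lemma leval_single: "leval \<kappa> x (single g c) = of_int c * (\<kappa> (fst g) * (\<Prod>i\<in>UNIV. x i powi snd g i))"
  and leval_zero: "leval \<kappa> x 0 = 0"
  and leval_add: "leval \<kappa> x (X + Y) = leval \<kappa> x X + leval \<kappa> x Y"
  and leval_mult: "leval \<kappa> x (X * Y) = leval \<kappa> x X * leval \<kappa> x Y"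
  and leval_power: "leval \<kappa> x (X ^ n) = leval \<kappa> x X ^ n"
  and leval_sum: "leval \<kappa> x (\<Sum>s\<in>I. Z s) = (\<Sum>s\<in>I. leval \<kappa> x (Z s))"
  and leval_prod: "leval \<kappa> x (\<Prod>s\<in>I. Z s) = (\<Prod>s\<in>I. leval \<kappa> x (Z s))"
  unfolding leval_def by (simp_all only: ev.single ev.zero ev.add ev.mult ev.power ev.sum ev.prod)

end

text \<open>Since \<open>x' k\<close> is nonzero, so is the value of \<open>p\<close>, and the
  powers of \<open>p\<close> in \<open>mutates\<close> can be cancelled in the field.\<close>

lemma leval_mutates:
  fixes x x' :: "'n::finite \<Rightarrow> 'f::field" and \<kappa> :: "'q::ab_group_add \<Rightarrow> 'f"
  assumes x: "laurent_eval \<kappa> x" and x': "laurent_eval \<kappa> x'"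
    and p0: "\<And>g. g \<in> keys p \<Longrightarrow> ldeg k g = 0"
    and x'_eq: "x' = x(k := leval \<kappa> x p / x k)"
    and Y: "mutates k p Y Y'"
  shows "leval \<kappa> x' Y' = leval \<kappa> x Y"
proof -
  interpret e: laurent_eval \<kappa> x by fact
  interpret e': laurent_eval \<kappa> x' by fact
  define \<pi> where "\<pi> = leval \<kappa> x p"
  have \<pi>: "\<pi> \<noteq> 0" using e'.nonzero[of k] by (auto simp: x'_eq \<pi>_def)
  have char: "(\<Prod>i\<in>UNIV. x' i powi snd (flip k g) i) = (\<Prod>i\<in>UNIV. x i powi snd g i) * \<pi> powi (- ldeg k g)"
    for g :: "('q, 'n) exponent"
  proof -
    have "x' k powi (- n) = x k powi n * \<pi> powi (- n)" for n
      by (simp add: x'_eq \<pi>_def power_int_divide_distrib power_int_minus field_simps)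
    moreover have "(\<Prod>i\<in>UNIV - {k}. x' i powi snd (flip k g) i) = (\<Prod>i\<in>UNIV - {k}. x i powi snd g i)"
      by (intro prod.cong) (auto simp: x'_eq flip_def)
    ultimately show ?thesis
      by (simp add: prod.remove[of UNIV k] flip_def ldeg_def ac_simps)
  qed
  have refl: "leval \<kappa> x' (reflect k Z) = leval \<kappa> x Z * \<pi> powi (- d)"
    if "\<And>g. g \<in> keys Z \<Longrightarrow> ldeg k g = d" for Z d
  proof -
    have "leval \<kappa> x' (reflect k Z) = (\<Sum>g\<in>keys Z. leval \<kappa> x' (single (flip k g) (lookup Z g)))"
      by (subst (1) poly_mapping_sum_single[of Z]) (simp add: reflect_sum reflect_single e'.leval_sum)
    also have "\<dots> = (\<Sum>g\<in>keys Z. leval \<kappa> x (single g (lookup Z g)) * \<pi> powi (- d))"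
      by (intro sum.cong refl) (simp add: e'.leval_single e.leval_single char that, simp add: flip_def)
    also have "\<dots> = leval \<kappa> x Z * \<pi> powi (- d)"
      by (subst (3) poly_mapping_sum_single[of Z]) (simp add: e.leval_sum sum_distrib_right)
    finally show ?thesis .
  qed
  have "leval \<kappa> x' (reflect k p) = leval \<kappa> x p * \<pi> powi (- 0)"
    by (rule refl) (rule p0)
  then have p': "leval \<kappa> x' p = \<pi>" using reflect_fixed[OF p0] by (simp add: \<pi>_def)
  have parts: "leval \<kappa> x' (part (ldeg k) (- d) Y') = leval \<kappa> x (part (ldeg k) d Y)" for d
  proof -
    from Y have "leval \<kappa> x' (reflect k (part (ldeg k) d Y) * p ^ nat d) =
        leval \<kappa> x' (part (ldeg k) (- d) Y' * p ^ nat (- d))" by (simp add: mutates_def)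
    moreover have "leval \<kappa> x' (reflect k (part (ldeg k) d Y)) = leval \<kappa> x (part (ldeg k) d Y) * \<pi> powi (- d)"
      by (rule refl) (simp add: keys_part)
    ultimately have eq: "leval \<kappa> x (part (ldeg k) d Y) * \<pi> powi (- d) * \<pi> ^ nat d =
        leval \<kappa> x' (part (ldeg k) (- d) Y') * \<pi> ^ nat (- d)"
      by (simp add: e'.leval_mult e'.leval_power p')
    have "\<pi> powi (- d) * \<pi> ^ nat d = \<pi> ^ nat (- d)"
      using \<pi> by (cases "0 \<le> d") (auto simp: power_int_def power_inverse)
    with eq have "leval \<kappa> x (part (ldeg k) d Y) * \<pi> ^ nat (- d) =
        leval \<kappa> x' (part (ldeg k) (- d) Y') * \<pi> ^ nat (- d)" by (simp only: mult.assoc)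
    then show ?thesis using \<pi> by simp
  qed
  define D where "D = ldeg k ` keys Y \<union> uminus ` ldeg k ` keys Y'"
  have D: "finite D" "ldeg k ` keys Y \<subseteq> D" "ldeg k ` keys Y' \<subseteq> uminus ` D"
    by (auto simp: D_def image_image image_Un)
  have "leval \<kappa> x' Y' = (\<Sum>d\<in>uminus ` D. leval \<kappa> x' (part (ldeg k) d Y'))"
    unfolding e'.leval_sum[symmetric] using sum_parts[of "uminus ` D" "ldeg k" Y'] D by simp
  also have "\<dots> = (\<Sum>d\<in>D. leval \<kappa> x' (part (ldeg k) (- d) Y'))"
    by (subst sum.reindex) auto
  also have "\<dots> = leval \<kappa> x Y"
    unfolding parts e.leval_sum[symmetric] using sum_parts[of D "ldeg k" Y] D by simp
  finally show ?thesis .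
qed


section \<open>Seeds up to relabeling\<close>

lemma ring_embeddingD:
  assumes "ring_embedding \<iota>"
  shows "inj \<iota>" "\<iota> 1 = 1" "\<iota> (a + b) = \<iota> a + \<iota> b" "\<iota> (a * b) = \<iota> a * \<iota> b" "\<iota> 0 = 0"
proof -
  show "inj \<iota>" "\<iota> 1 = 1" "\<iota> (a + b) = \<iota> a + \<iota> b" "\<iota> (a * b) = \<iota> a * \<iota> b" for a b
    using assms by (simp_all add: ring_embedding_def)
  from this(3)[of 0 0] show "\<iota> 0 = 0" by simp
qed

lemma ring_embedding_eq_0_iff: "ring_embedding \<iota> \<Longrightarrow> \<iota> a = 0 \<longleftrightarrow> a = 0"
  using ring_embeddingD(1,5) by (metis injD)

lemma ring_embedding_of_int:
  assumes "ring_embedding \<iota>"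
  shows "\<iota> (of_int z) = of_int z"
proof -
  note h = ring_embeddingD[OF assms]
  have nat: "\<iota> (of_nat n) = of_nat n" for n by (induction n) (auto simp: h)
  have "\<iota> (- a) = - \<iota> a" for a
    using h(3)[of a "- a"] h(5) by (simp add: minus_unique)
  then show ?thesis using nat by (cases z rule: int_cases2) auto
qed

definition group_char :: "('p::ab_group_add group_ring \<Rightarrow> 'f::field) \<Rightarrow> 'p \<Rightarrow> 'f" where
  "group_char \<iota> p = \<iota> (single p 1)"

lemma group_char_hom:
  assumes "ring_embedding \<iota>"
  shows "group_char \<iota> 0 = 1" "group_char \<iota> (u + v) = group_char \<iota> u * group_char \<iota> v"
proof -
  show "group_char \<iota> 0 = 1" using ring_embeddingD(2)[OF assms] by (simp add: group_char_def)
  have "single (u + v) (1::int) = single u 1 * single v 1" by (simp add: mult_single)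
  then show "group_char \<iota> (u + v) = group_char \<iota> u * group_char \<iota> v"
    unfolding group_char_def using ring_embeddingD(4)[OF assms] by metis
qed

lemma embedding_single:
  assumes "ring_embedding \<iota>"
  shows "\<iota> (single p c) = of_int c * group_char \<iota> p"
proof -
  have "single p c = of_int c * single p 1"
    by (metis mult_single add_0 mult.right_neutral single_of_int of_int_eq_id id_apply)
  then show ?thesis
    by (simp add: ring_embeddingD(4)[OF assms] ring_embedding_of_int[OF assms] group_char_def)
qed

lemma exchange_poly_eq_leval:
  assumes "laurent_eval \<kappa> x" and "\<kappa> (a j) = group_char \<iota> (pplus S j)" "\<kappa> (b j) = group_char \<iota> (pminus S j)"
  shows "leval \<kappa> x (lpoly (exch S) a b j) = exchange_poly \<iota> x S j"
proof -
  interpret laurent_eval \<kappa> x by fact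
  have "(\<Prod>i\<in>UNIV. x i powi max 0 (f i)) = (\<Prod>i | f i > 0. x i ^ nat (f i))" for f
    by (rule prod.mono_neutral_cong_right) (auto simp: max_def power_int_def)
  from this[of "\<lambda>i. exch S i j"] this[of "\<lambda>i. - exch S i j"] show ?thesis
    by (simp add: lpoly_eq leval_add leval_single exchange_poly_def assms(2,3)
        pos_term_def neg_term_def) (simp add: group_char_def)
qed

text \<open>Retains of \<open>seed_mutation\<close> what evaluating expansions needs, with nonzero
  variables in place of transcendence bases. Symmetry and invariance under relabeling become direct
  computations.\<close>

definition weak_mutation ::
    "('p::ab_group_add group_ring \<Rightarrow> 'f::field) \<Rightarrow> 'n \<Rightarrow>
     ('n::finite, 'p, 'f) seed \<Rightarrow> ('n, 'p, 'f) seed \<Rightarrow> bool" where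
  "weak_mutation \<iota> k S S' \<longleftrightarrow> (\<forall>i. cluster S i \<noteq> 0) \<and> (\<forall>i. cluster S' i \<noteq> 0) \<and>
     sign_skew_symmetric (exch S) \<and> sign_skew_symmetric (exch S') \<and>
     cluster S' = (cluster S)(k := new_var \<iota> S k) \<and> exch S' = matrix_mutation k (exch S) \<and>
     coeff_mutation k (exch S) (pplus S) (pminus S) (pplus S') (pminus S')"

lemma matrix_mutation_involutive: "matrix_mutation k (matrix_mutation k B) = B"
  by (auto simp: matrix_mutation_def fun_eq_iff mutation_term_neg)

lemma coeff_mutation_sym:
  assumes "coeff_mutation k B a b a' b'"
  shows "coeff_mutation k (matrix_mutation k B) a' b' a b"
proof -
  have "matrix_mutation k B k i = - B k i" for i by (simp add: matrix_mutation_def)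
  then show ?thesis using assms
    unfolding coeff_mutation_def by (auto simp: int_mult_minus)
qed

text \<open>\<open>P_k\<close> does not involve \<open>x_k\<close>, and negating column
  \<open>k\<close> while swapping the two coefficients leaves it unchanged. So both seeds share one
  exchange relation in direction \<open>k\<close>.\<close>

lemma weak_mutation_sym:
  assumes "weak_mutation \<iota> k S S'"
  shows "weak_mutation \<iota> k S' S"
proof -
  have c: "cluster S' = (cluster S)(k := new_var \<iota> S k)" and e: "exch S' = matrix_mutation k (exch S)"
    and co: "coeff_mutation k (exch S) (pplus S) (pminus S) (pplus S') (pminus S')"
    and sk: "sign_skew_symmetric (exch S)" and nz: "\<forall>i. cluster S i \<noteq> 0" "\<forall>i. cluster S' i \<noteq> 0"
    using assms unfolding weak_mutation_def by blast+
  have ek: "exch S' i k = - exch S i k" for i by (simp add: e matrix_mutation_def)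
  have pk: "pplus S' k = pminus S k" "pminus S' k = pplus S k" using co by (auto simp: coeff_mutation_def)
  have cl: "exch S i k \<noteq> 0 \<Longrightarrow> cluster S' i = cluster S i" for i
    using sign_skew_diag[OF sk, of k] by (auto simp: c)
  have 1: "(\<Prod>i | exch S i k < 0. cluster S' i ^ nat (- exch S i k)) = (\<Prod>i | exch S i k < 0. cluster S i ^ nat (- exch S i k))"
    "(\<Prod>i | exch S i k > 0. cluster S' i ^ nat (exch S i k)) = (\<Prod>i | exch S i k > 0. cluster S i ^ nat (exch S i k))"
    by (auto intro!: prod.cong simp: cl)
  have "exchange_poly \<iota> (cluster S') S' k = exchange_poly \<iota> (cluster S) S k"
    by (simp add: exchange_poly_def ek pk 1)
  moreover have "cluster S' k = exchange_poly \<iota> (cluster S) S k / cluster S k"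
    by (simp add: c new_var_def)
  ultimately have "new_var \<iota> S' k = cluster S k"
    using nz(1)[rule_format, of k] nz(2)[rule_format, of k] by (auto simp: new_var_def)
  then have "cluster S = (cluster S')(k := new_var \<iota> S' k)" by (simp add: c)
  then show ?thesis using assms coeff_mutation_sym[OF co]
    by (simp add: weak_mutation_def e matrix_mutation_involutive)
qed

definition relabel :: "('n \<Rightarrow> 'n) \<Rightarrow> ('n, 'p, 'f) seed \<Rightarrow> ('n, 'p, 'f) seed" where
  "relabel \<sigma> S = \<lparr>cluster = cluster S \<circ> \<sigma>, pplus = pplus S \<circ> \<sigma>, pminus = pminus S \<circ> \<sigma>,
     exch = (\<lambda>i j. exch S (\<sigma> i) (\<sigma> j))\<rparr>"

lemma relabel_simps [simp]:
  "cluster (relabel \<sigma> S) = cluster S \<circ> \<sigma>" "pplus (relabel \<sigma> S) = pplus S \<circ> \<sigma>"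
  "pminus (relabel \<sigma> S) = pminus S \<circ> \<sigma>" "exch (relabel \<sigma> S) = (\<lambda>i j. exch S (\<sigma> i) (\<sigma> j))"
  by (simp_all add: relabel_def)

lemma relabel_relabel: "relabel \<tau> (relabel \<sigma> S) = relabel (\<sigma> \<circ> \<tau>) S"
  by (simp add: relabel_def comp_assoc)

lemma relabel_id: "relabel id S = S"
  by (simp add: relabel_def)

lemma seed_relabeling_iff: "seed_relabeling S S' \<longleftrightarrow> (\<exists>\<sigma>. bij \<sigma> \<and> S' = relabel \<sigma> S)"
  by (auto simp: seed_relabeling_def relabel_def)

lemma new_var_relabel:
  fixes S :: "('n::finite, 'p::ab_group_add, 'f::field) seed"
  assumes "bij \<sigma>"
  shows "new_var \<iota> (relabel \<sigma> S) j = new_var \<iota> S (\<sigma> j)"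
proof -
  have "(\<Prod>i | P (\<sigma> i). f (\<sigma> i)) = (\<Prod>i | P i. f i)" for P and f :: "'n \<Rightarrow> 'f"
    by (rule prod.reindex_bij_witness[of _ "inv \<sigma>" \<sigma>])
      (use assms in \<open>auto simp: bij_is_inj bij_is_surj surj_f_inv_f\<close>)
  from this[where P = "\<lambda>i. exch S i (\<sigma> j) > 0" and f = "\<lambda>i. cluster S i ^ nat (exch S i (\<sigma> j))"]
    this[where P = "\<lambda>i. exch S i (\<sigma> j) < 0" and f = "\<lambda>i. cluster S i ^ nat (- exch S i (\<sigma> j))"]
  show ?thesis by (simp add: new_var_def exchange_poly_def)
qed

lemma weak_mutation_relabel:
  fixes S :: "('n::finite, 'p::ab_group_add, 'f::field) seed"
  assumes \<sigma>: "bij \<sigma>" and "weak_mutation \<iota> (\<sigma> k) S S'"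
  shows "weak_mutation \<iota> k (relabel \<sigma> S) (relabel \<sigma> S')"
proof -
  have inj: "\<sigma> i = \<sigma> j \<longleftrightarrow> i = j" for i j using \<sigma> by (auto simp: bij_def inj_def)
  have mm: "matrix_mutation k (\<lambda>i j. B (\<sigma> i) (\<sigma> j)) = (\<lambda>i j. matrix_mutation (\<sigma> k) B (\<sigma> i) (\<sigma> j))" for B
    by (auto simp: matrix_mutation_def fun_eq_iff inj)
  have upd: "(f(\<sigma> k := v)) \<circ> \<sigma> = (f \<circ> \<sigma>)(k := v)" for f and v :: 'f
    by (auto simp: fun_eq_iff inj)
  have skew: "sign_skew_symmetric B \<Longrightarrow> sign_skew_symmetric (\<lambda>i j. B (\<sigma> i) (\<sigma> j))" for B
    by (simp add: sign_skew_symmetric_def)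
  have coeff: "coeff_mutation (\<sigma> k) B a b a' b' \<Longrightarrow>
      coeff_mutation k (\<lambda>i j. B (\<sigma> i) (\<sigma> j)) (a \<circ> \<sigma>) (b \<circ> \<sigma>) (a' \<circ> \<sigma>) (b' \<circ> \<sigma>)" for B and a b a' b' :: "'n \<Rightarrow> 'p"
    by (simp add: coeff_mutation_def inj)
  have "cluster S i \<noteq> 0" "cluster S' i \<noteq> 0" "sign_skew_symmetric (exch S)" "sign_skew_symmetric (exch S')"
    "cluster S' = (cluster S)(\<sigma> k := new_var \<iota> S (\<sigma> k))" "exch S' = matrix_mutation (\<sigma> k) (exch S)"
    "coeff_mutation (\<sigma> k) (exch S) (pplus S) (pminus S) (pplus S') (pminus S')" for i
    using assms(2) unfolding weak_mutation_def by blast+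
  note h = this
  have "new_var \<iota> S (\<sigma> k) \<noteq> 0" using h(2)[of "\<sigma> k"] h(5) by simp
  then show ?thesis
    unfolding weak_mutation_def relabel_simps new_var_relabel[OF \<sigma>] mm
    using h(1,2) skew[OF h(3)] skew[OF h(4)] coeff[OF h(7)] h(6) arg_cong[OF h(5), of "\<lambda>f. f \<circ> \<sigma>"]
    unfolding upd by simp
qed

lemma coeff_field_0_1:
  assumes "ring_embedding \<iota>"
  shows "0 \<in> coeff_field \<iota>" "1 \<in> coeff_field \<iota>"
proof -
  show "0 \<in> coeff_field \<iota>" unfolding coeff_field_def
    by (intro CollectI exI[of _ 0] exI[of _ 1]) (simp add: ring_embeddingD(5)[OF assms])
  show "1 \<in> coeff_field \<iota>" unfolding coeff_field_def
    by (intro CollectI exI[of _ 1] exI[of _ 1]) (simp add: ring_embeddingD(2)[OF assms])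
qed

lemma alg_independent_nonzero:
  fixes y :: "'n \<Rightarrow> 'f::field"
  assumes "ring_embedding \<iota>" "alg_independent (coeff_field \<iota>) y"
  shows "y i \<noteq> 0"
proof
  assume "y i = 0"
  then have "mp_eval (\<lambda>c. c) y (mp_var i) = 0"
    by (simp add: mp_eval_def mp_var_def pp_eval_def)
  moreover have "Poly_Mapping.range (mp_var i :: ('n, 'f) mpoly) \<subseteq> coeff_field \<iota>"
    using coeff_field_0_1[OF assms(1)] by (auto simp: mp_var_def)
  ultimately have "(mp_var i :: ('n, 'f) mpoly) = 0"
    using assms(2) unfolding alg_independent_def by blast
  then have "keys (mp_var i :: ('n, 'f) mpoly) = {}" by simp
  then show False by (simp add: mp_var_def)
qed

lemma is_seed_nonzero: "ring_embedding \<iota> \<Longrightarrow> is_seed \<iota> S \<Longrightarrow> cluster S i \<noteq> 0"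
  by (rule alg_independent_nonzero) (auto simp: is_seed_def transcendence_basis_def)

lemma seed_mutation_imp_weak:
  assumes \<iota>: "ring_embedding \<iota>" and mut: "seed_mutation \<iota> k S S'"
  shows "weak_mutation \<iota> k S S'"
proof -
  have seeds: "is_seed \<iota> S" "is_seed \<iota> S'" using mut unfolding seed_mutation_def by blast+
  then have "sign_skew_symmetric (exch S)" "sign_skew_symmetric (exch S')"
    unfolding is_seed_def by blast+
  then show ?thesis
    using mut is_seed_nonzero[OF \<iota> seeds(1)] is_seed_nonzero[OF \<iota> seeds(2)]
    unfolding seed_mutation_def weak_mutation_def coeff_mutation_def by blast
qed

section \<open>Generic lifts\<close>

abbreviation (input) lower_bound :: "('p::ab_group_add group_ring \<Rightarrow> 'f::field) \<Rightarrow> ('n::finite, 'p, 'f) seed \<Rightarrow> 'f set" where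
  "lower_bound \<iota> S \<equiv> is_subalgebra \<iota> hull (range (generator \<iota> S))"

lemma hull_is_subalgebra: "is_subalgebra \<iota> (is_subalgebra \<iota> hull X)"
proof (rule hull_in)
  fix T assume T: "\<forall>A\<in>T. is_subalgebra \<iota> A"
  have A: "\<iota> c \<in> A" "a \<in> A \<Longrightarrow> b \<in> A \<Longrightarrow> a + b \<in> A" "a \<in> A \<Longrightarrow> b \<in> A \<Longrightarrow> a * b \<in> A"
    if "A \<in> T" for A a b c
    using T[rule_format, OF that] by (simp_all add: is_subalgebra_def image_subset_iff)
  show "is_subalgebra \<iota> (\<Inter>T)"
    unfolding is_subalgebra_def by (intro conjI ballI image_subsetI InterI) (simp_all add: A)
qed

lemma subalgebra_closed:
  assumes "is_subalgebra \<iota> L" "ring_embedding \<iota>"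
  shows "\<iota> c \<in> L" "u \<in> L \<Longrightarrow> v \<in> L \<Longrightarrow> u + v \<in> L" "u \<in> L \<Longrightarrow> v \<in> L \<Longrightarrow> u * v \<in> L"
    "0 \<in> L" "1 \<in> L" "u \<in> L \<Longrightarrow> u ^ n \<in> L"
    "(\<And>i. i \<in> I \<Longrightarrow> f i \<in> L) \<Longrightarrow> (\<Prod>i\<in>I. f i) \<in> L"
    "(\<And>i. i \<in> I \<Longrightarrow> f i \<in> L) \<Longrightarrow> (\<Sum>i\<in>I. f i) \<in> L"
proof -
  show 1: "\<iota> c \<in> L" for c using assms by (auto simp: is_subalgebra_def)
  show 2: "u \<in> L \<Longrightarrow> v \<in> L \<Longrightarrow> u + v \<in> L" and 3: "u \<in> L \<Longrightarrow> v \<in> L \<Longrightarrow> u * v \<in> L" for u v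
    using assms by (auto simp: is_subalgebra_def)
  show 4: "0 \<in> L" "1 \<in> L" using 1[of 0] 1[of 1] ring_embeddingD[OF assms(2)] by auto
  show "u \<in> L \<Longrightarrow> u ^ n \<in> L" by (induction n) (auto intro: 3 4)
  show "(\<And>i. i \<in> I \<Longrightarrow> f i \<in> L) \<Longrightarrow> (\<Prod>i\<in>I. f i) \<in> L"
    by (induction I rule: infinite_finite_induct) (auto intro: 3 4)
  show "(\<And>i. i \<in> I \<Longrightarrow> f i \<in> L) \<Longrightarrow> (\<Sum>i\<in>I. f i) \<in> L"
    by (induction I rule: infinite_finite_induct) (auto intro: 2 4)
qed

text \<open>The rank is the number of proper predecessors. Along an edge the predecessor sets grow
  strictly, because no vertex precedes itself.\<close>

lemma acyclic_rank:
  fixes E :: "('n::finite \<times> 'n) set"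
  assumes "acyclic E"
  obtains r :: "'n \<Rightarrow> nat" where "\<And>i j. (i, j) \<in> E \<Longrightarrow> r i < r j"
proof (rule that)
  fix i j assume "(i, j) \<in> E"
  then have "{l. (l, i) \<in> E\<^sup>+} \<subseteq> {l. (l, j) \<in> E\<^sup>+}" by auto
  moreover have "i \<in> {l. (l, j) \<in> E\<^sup>+}" "i \<notin> {l. (l, i) \<in> E\<^sup>+}"
    using \<open>(i, j) \<in> E\<close> assms by (auto simp: acyclic_def)
  ultimately show "card {l. (l, i) \<in> E\<^sup>+} < card {l. (l, j) \<in> E\<^sup>+}"
    by (intro psubset_card_mono) auto
qed

lemma acyclic_exchange_system:
  fixes S :: "('n::finite, 'p::ab_group_add, 'f) seed"
  assumes "acyclic_seed S" "sign_skew_symmetric (exch S)"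
  obtains r where "exchange_system ldeg r (pos_term (exch S) a) (neg_term (exch S) b) (\<lambda>_. True) UNIV"
proof -
  from assms(1) obtain r :: "'n \<Rightarrow> nat" where r: "exch S i j > 0 \<Longrightarrow> r i < r j" for i j
    unfolding acyclic_seed_def by (rule acyclic_rank) auto
  have "exch S i j < 0 \<Longrightarrow> r j < r i" "exch S i j < 0 \<Longrightarrow> 0 < exch S j i" for i j
    using r[of j i] sign_skew_pos[OF assms(2), of j i] by blast+
  then have "exchange_system ldeg r (pos_term (exch S) a) (neg_term (exch S) b) (\<lambda>_. True) UNIV"
    unfolding exchange_system_def
    using r by (simp add: pos_term_def neg_term_def less_max_iff_disj additive_ldeg)
  then show thesis by (rule that)
qed

text \<open>
  Coprimality of the exchange polynomials can fail for the given coefficients. Every \<open>p\<^sub>j\<^sup>\<plusminus>\<close> is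
  therefore multiplied by a Laurent monomial in auxiliary variables, such that \<open>p\<^sub>j\<^sup>+ / p\<^sub>j\<^sup>-\<close> is
  multiplied by the monomial with exponent vector \<open>d j\<close>. As seeds need not be normalized, all
  mutations of the lift can be chosen such that the two exponent vectors at \<open>j\<close> are multiples of
  \<open>d j\<close>, and the existence of the dual functionals \<open>f\<close> makes the lift generic.
  Evaluation sends all auxiliary variables to 1.
\<close>

definition lift_plus :: "('n \<Rightarrow> 'p) \<Rightarrow> ('n \<Rightarrow> int) \<Rightarrow> ('n \<Rightarrow> 'n \<Rightarrow> int) \<Rightarrow> 'n \<Rightarrow> 'p \<times> ('n \<Rightarrow> int)" where
  "lift_plus p m d j = (p j, int_mult (m j) (d j))"

definition lift_minus :: "('n \<Rightarrow> 'p) \<Rightarrow> ('n \<Rightarrow> int) \<Rightarrow> ('n \<Rightarrow> 'n \<Rightarrow> int) \<Rightarrow> 'n \<Rightarrow> 'p \<times> ('n \<Rightarrow> int)" where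
  "lift_minus p m d j = (p j, int_mult (m j - 1) (d j))"

text \<open>Certifies independence of the \<open>d j\<close> in a form that mutation can update
  explicitly; each functional singles out one exchange binomial.\<close>

definition dual_system :: "('n \<Rightarrow> ('n \<Rightarrow> int) \<Rightarrow> int) \<Rightarrow> ('n \<Rightarrow> 'n \<Rightarrow> int) \<Rightarrow> bool" where
  "dual_system f d \<longleftrightarrow> (\<forall>i. additive (f i)) \<and> (\<forall>i j. f i (d j) = (if i = j then 1 else 0))"

text \<open>For some generic lift, the upper bound at \<open>S\<close> specializes into
  \<open>L\<close>. The target \<open>L\<close> stays fixed while the seed and the witnesses
  move.\<close>

definition liftable ::
    "('p::ab_group_add group_ring \<Rightarrow> 'f::field) \<Rightarrow> ('n::finite, 'p, 'f) seed \<Rightarrow> 'f set \<Rightarrow> bool" where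
  "liftable \<iota> S L \<longleftrightarrow> (\<exists>d m f. dual_system f d \<and>
     (\<forall>Y. (\<forall>j. laurent_cond ldeg
         (lpoly (exch S) (lift_plus (pplus S) m d) (lift_minus (pminus S) m d)) j Y) \<longrightarrow>
       leval (\<lambda>q. group_char \<iota> (fst q)) (cluster S) Y \<in> L))"

lemma additive_int_mult: "additive f \<Longrightarrow> f (int_mult z v) = z * (f v :: int)"
  using int_mult_hom[of f z v] by (simp add: additive.zero additive.add additive.minus int_mult_int)

text \<open>The functional \<open>f i\<close> gives the two terms of \<open>P_i\<close> the degrees
  \<open>m i\<close> and \<open>m i - 1\<close>, and all other \<open>P_j\<close> degree 0. So
  \<open>dvd_binomial_mult_cancel\<close> applies, with \<open>w = 0\<close> for regularity and
  \<open>w = P_j\<close> for coprimality.\<close>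

lemma generic_system_lift:
  fixes B :: "'n \<Rightarrow> 'n \<Rightarrow> int" and p q :: "'n \<Rightarrow> 'p::ab_group_add"
  assumes "dual_system f d"
  shows "generic_system B (lift_plus p m d) (lift_minus q m d)"
proof -
  let ?A = "pos_term B (lift_plus p m d)" and ?N = "neg_term B (lift_minus q m d)"
  define F where "F i g = f i (snd (fst g))" for i and g :: "('p \<times> ('n \<Rightarrow> int), 'n) exponent"
  have F: "additive (F i)" for i
    using assms by (simp add: dual_system_def F_def additive_def)
  have AN: "F i (?A j) = (if i = j then m j else 0)" "F i (?N j) = (if i = j then m j - 1 else 0)" for i j
    using assms by (auto simp: dual_system_def F_def pos_term_def neg_term_def lift_plus_def
        lift_minus_def additive_int_mult)
  have P: "binom ?A ?N (\<lambda>_. True) i = single (?A i) 1 + single (?N i) 1" for i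
    by (simp add: binom_def)
  have cancel: "w dvd c" if "w dvd (single (?A i) 1 + single (?N i) 1) * c"
    "\<And>g. g \<in> keys w \<Longrightarrow> F i g = 0" for i and w c :: "_ \<Rightarrow>\<^sub>0 int"
    by (rule dvd_binomial_mult_cancel[OF F _ that(2,1)]) (simp_all add: AN)
  show ?thesis
    unfolding generic_system_def
  proof
    have "c = 0" if "(single (?A j) 1 + single (?N j) 1) * c = 0" for j and c :: "_ \<Rightarrow>\<^sub>0 int"
      using cancel[of 0 j c] that by simp
    then show "regular_system ?A ?N (\<lambda>_. True) UNIV"
      unfolding regular_system_def P by blast
    have "single (?A j) 1 + single (?N j) 1 dvd c"
      if "i \<noteq> j" "single (?A j) 1 + single (?N j) 1 dvd (single (?A i) 1 + single (?N i) 1) * c" for i j and c :: "_ \<Rightarrow>\<^sub>0 int"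
      by (rule cancel[OF that(2)]) (use that(1) in \<open>auto simp: keys_single_plus_single AN\<close>)
    then show "coprime_system ?A ?N (\<lambda>_. True) UNIV"
      unfolding coprime_system_def P by blast
  qed
qed

lemma laurent_eval_group_char:
  assumes "ring_embedding \<iota>" "\<And>i. x i \<noteq> 0"
  shows "laurent_eval (\<lambda>q. group_char \<iota> (fst q)) x" "laurent_eval (group_char \<iota>) x"
  using group_char_hom[OF assms(1)] assms(2) by (simp_all add: laurent_eval_def)

text \<open>Elements travel backwards: an expansion at \<open>S'\<close> is mutated to
  \<open>S\<close>, where membership in \<open>L\<close> is known, without changing its value. Hence
  the coefficient mutation is reversed after the lift at \<open>S'\<close> has been built.\<close>

lemma liftable_mutation:
  assumes \<iota>: "ring_embedding \<iota>" and lift: "liftable \<iota> S L" and mut: "weak_mutation \<iota> k S S'"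
  shows "liftable \<iota> S' L"
proof -
  from lift obtain d m f where dual: "dual_system f d" and L: "\<And>Y. (\<And>j. laurent_cond ldeg
         (lpoly (exch S) (lift_plus (pplus S) m d) (lift_minus (pminus S) m d)) j Y) \<Longrightarrow>
       leval (\<lambda>q. group_char \<iota> (fst q)) (cluster S) Y \<in> L"
    unfolding liftable_def by blast
  let ?B = "exch S"
  \<comment> \<open>The lifted ratio at \<open>j \<noteq> k\<close> acquires the power
    \<open>?B k j\<close> of a lifted coefficient at \<open>k\<close>, whose exponent vector is
    \<open>m k\<close> or \<open>m k - 1\<close> times \<open>d k\<close>. Swapping the coefficients
    at \<open>k\<close> suggests \<open>- d k\<close> and \<open>1 - m k\<close>; elsewhere only
    ratios are prescribed and \<open>m' j = 1\<close> is a free choice. \<open>f'\<close> is dual to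
    \<open>d'\<close>.\<close>
  define \<mu> where "\<mu> j = ?B k j * (if ?B k j \<ge> 0 then m k else m k - 1)" for j
  define d' where "d' j = (if j = k then - d k else d j + int_mult (\<mu> j) (d k))" for j
  define m' where "m' j = (if j = k then 1 - m k else 1)" for j
  define f' where "f' i v = (if i = k then - f k v + (\<Sum>j\<in>UNIV - {k}. \<mu> j * f j v) else f i v)" for i v
  have f: "additive (f i)" and fd: "f i (d j) = (if i = j then 1 else 0)" for i j
    using dual by (auto simp: dual_system_def)
  have dual': "dual_system f' d'"
    unfolding dual_system_def
  proof (intro conjI allI)
    fix i
    show "additive (f' i)"
      by unfold_locales (simp add: f'_def additive.add[OF f] sum.distrib distrib_left)
    fix j
    have fd': "f i (d' j) = (if j = k then - (if i = k then 1 else 0) else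
        (if i = j then 1 else 0) + \<mu> j * (if i = k then 1 else 0))" for i
      by (simp add: d'_def additive.minus[OF f] additive.add[OF f] additive_int_mult[OF f] fd)
    have "(\<Sum>l\<in>UNIV - {k}. \<mu> l * f l (d' j)) = (\<Sum>l\<in>UNIV - {k}. if l = j then \<mu> l else 0)"
      by (intro sum.cong) (auto simp: fd')
    also have "\<dots> = (if j = k then 0 else \<mu> j)" by (simp add: sum.delta)
    finally show "f' i (d' j) = (if i = j then 1 else 0)"
      by (auto simp: f'_def fd')
  qed
  let ?a = "lift_plus (pplus S) m d" and ?b = "lift_minus (pminus S) m d"
  let ?a' = "lift_plus (pplus S') m' d'" and ?b' = "lift_minus (pminus S') m' d'"
  have skew: "sign_skew_symmetric ?B" "sign_skew_symmetric (exch S')" "exch S' = matrix_mutation k ?B"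
    and co: "coeff_mutation k ?B (pplus S) (pminus S) (pplus S') (pminus S')"
    and nz: "cluster S i \<noteq> 0" "cluster S' i \<noteq> 0" for i
    using mut unfolding weak_mutation_def by blast+
  have "coeff_mutation k ?B ?a ?b ?a' ?b'"
    using co unfolding coeff_mutation_def
    by (auto simp: lift_plus_def lift_minus_def prod_eq_iff fst_int_mult snd_int_mult fun_eq_iff
        int_mult_fun_int m'_def d'_def \<mu>_def algebra_simps)
  then have coeff: "coeff_mutation k (exch S') ?a' ?b' ?a ?b"
    unfolding skew(3) by (rule coeff_mutation_sym)
  have mut_back: "matrix_mutation k (exch S') = ?B" by (simp add: skew(3) matrix_mutation_involutive)
  note ev = laurent_eval_group_char(1)[OF \<iota>]
  let ?\<kappa> = "\<lambda>q. group_char \<iota> (fst q)"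
  have "leval ?\<kappa> (cluster S') Y' \<in> L"
    if Y': "\<And>j. laurent_cond ldeg (lpoly (exch S') ?a' ?b') j Y'" for Y'
  proof -
    have "sign_skew_symmetric (matrix_mutation k (exch S'))" by (simp add: mut_back skew(1))
    from upper_bound_mutation[OF skew(2) this generic_system_lift[OF dual'] coeff Y']
    obtain Y where Y: "mutates k (lpoly (exch S') ?a' ?b' k) Y' Y"
      "\<And>j. laurent_cond ldeg (lpoly (matrix_mutation k (exch S')) ?a ?b) j Y" by blast
    have "cluster S = (cluster S')(k := new_var \<iota> S' k)"
      using weak_mutation_sym[OF mut] by (simp add: weak_mutation_def)
    moreover have "leval ?\<kappa> (cluster S') (lpoly (exch S') ?a' ?b' k) = exchange_poly \<iota> (cluster S') S' k"
      by (rule exchange_poly_eq_leval[OF ev[OF nz(2)]]) (simp_all add: lift_plus_def lift_minus_def)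
    ultimately have cl: "cluster S = (cluster S')(k :=
        leval ?\<kappa> (cluster S') (lpoly (exch S') ?a' ?b' k) / cluster S' k)"
      by (simp add: new_var_def)
    have "leval ?\<kappa> (cluster S) Y = leval ?\<kappa> (cluster S') Y'"
      by (rule leval_mutates[OF ev[OF nz(2)] ev[OF nz(1)] lpoly_degree_self[OF skew(2)] cl Y(1)])
    moreover have "leval ?\<kappa> (cluster S) Y \<in> L"
      by (rule L) (use Y(2) in \<open>simp add: mut_back\<close>)
    ultimately show ?thesis by simp
  qed
  then show ?thesis using dual' unfolding liftable_def by blast
qed

lemma leval_std_term:
  assumes \<iota>: "ring_embedding \<iota>" and ev: "laurent_eval \<kappa> (cluster S)"
    and a: "\<And>j. \<kappa> (a j) = group_char \<iota> (pplus S j)" and b: "\<And>j. \<kappa> (b j) = group_char \<iota> (pminus S j)"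
  shows "leval \<kappa> (cluster S) (std_map ldeg (lpoly (exch S) a b) UNIV (single g c)) =
    of_int c * \<kappa> (fst g) *
      (\<Prod>i\<in>UNIV. cluster S i ^ nat (ldeg i g) * new_var \<iota> S i ^ nat (- ldeg i g))"
proof -
  interpret laurent_eval \<kappa> "cluster S" by fact
  have "cluster S i powi v * exchange_poly \<iota> (cluster S) S i ^ nat (- v) =
      cluster S i ^ nat v * new_var \<iota> S i ^ nat (- v)" for i v
    using nonzero[of i]
    by (cases "0 \<le> v") (auto simp: power_int_def new_var_def power_divide field_simps power_inverse)
  then show ?thesis
    by (simp add: std_map_single leval_mult leval_single leval_prod leval_power ldeg_def
        exchange_poly_eq_leval[OF ev a b] mult.assoc prod.distrib[symmetric])
qed

lemma liftable_acyclic: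
  fixes S :: "('n::finite, 'p::ab_group_add, 'f::field) seed"
  assumes \<iota>: "ring_embedding \<iota>" and "acyclic_seed S" and skew: "sign_skew_symmetric (exch S)"
    and nz: "\<And>i. cluster S i \<noteq> 0"
  shows "liftable \<iota> S (lower_bound \<iota> S)"
proof -
  let ?L = "lower_bound \<iota> S"
  \<comment> \<open>The simplest generic lift: each plus coefficient gets its own auxiliary
    variable, and the minus coefficients are unchanged because \<open>m j - 1 = 0\<close>.\<close>
  define d :: "'n \<Rightarrow> 'n \<Rightarrow> int" where "d j = (\<lambda>i. if i = j then 1 else 0)" for j
  define m :: "'n \<Rightarrow> int" where "m j = 1" for j
  let ?a = "lift_plus (pplus S) m d" and ?b = "lift_minus (pminus S) m d"
  let ?\<kappa> = "\<lambda>q. group_char \<iota> (fst q)"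
  have dual: "dual_system (\<lambda>i v. v i) d"
    by (auto simp: dual_system_def d_def additive_def)
  note L = subalgebra_closed[OF hull_is_subalgebra \<iota>]
  have gen: "generator \<iota> S v \<in> ?L" for v by (rule hull_inc) simp
  have cl: "cluster S i \<in> ?L" "new_var \<iota> S i \<in> ?L" for i
    using gen[of "Vx i"] gen[of "Vx' i"] by simp_all
  have ev: "laurent_eval ?\<kappa> (cluster S)" by (rule laurent_eval_group_char(1)[OF \<iota> nz])
  then interpret laurent_eval ?\<kappa> "cluster S" .
  have "leval ?\<kappa> (cluster S) (std_map ldeg (lpoly (exch S) ?a ?b) UNIV C) \<in> ?L" for C
  proof (induction C rule: sum_single_induct)
    case zero then show ?case by (simp add: leval_zero L)
  next
    case (add C D) then show ?case by (simp add: std_map_add leval_add L)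
  next
    case (single g c)
    have "?\<kappa> (?a j) = group_char \<iota> (pplus S j)" "?\<kappa> (?b j) = group_char \<iota> (pminus S j)" for j
      by (simp_all add: lift_plus_def lift_minus_def)
    note eq = leval_std_term[OF \<iota> ev this, of g c]
    have "of_int c * ?\<kappa> (fst g) \<in> ?L"
      using L(1)[of "single (fst (fst g)) c"] embedding_single[OF \<iota>] by simp
    then show ?case unfolding eq by (rule L(3)) (intro L(3,6,7) cl)
  qed
  moreover obtain r where sys: "exchange_system ldeg r (pos_term (exch S) ?a) (neg_term (exch S) ?b) (\<lambda>_. True) UNIV"
    using acyclic_exchange_system[OF assms(2) skew] .
  have "\<exists>C. Y = std_map ldeg (lpoly (exch S) ?a ?b) UNIV C"
    if "\<And>j. laurent_cond ldeg (lpoly (exch S) ?a ?b) j Y" for Y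
    using laurent_cond_imp_std_map[OF sys generic_systemD[OF generic_system_lift[OF dual]], of Y] that
    by (simp add: lpoly_def)
  ultimately have "leval ?\<kappa> (cluster S) Y \<in> ?L"
    if "\<And>j. laurent_cond ldeg (lpoly (exch S) ?a ?b) j Y" for Y
    using that by metis
  then show ?thesis using dual unfolding liftable_def by blast
qed

text \<open>On a finite set acyclicity amounts to well-foundedness, which passes to inverse
  images.\<close>

lemma acyclic_seed_relabel:
  fixes S :: "('n::finite, 'p, 'f) seed"
  assumes "acyclic_seed S"
  shows "acyclic_seed (relabel \<sigma> S)"
proof -
  have "wf {(i, j). exch S i j > 0}"
    using assms finite_acyclic_wf unfolding acyclic_seed_def by (meson finite_code)
  then have "wf (inv_image {(i, j). exch S i j > 0} \<sigma>)" by (rule wf_inv_image)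
  then show ?thesis unfolding acyclic_seed_def by (auto dest: wf_acyclic simp: inv_image_def)
qed

lemma range_generator_relabel:
  fixes S :: "('n::finite, 'p::ab_group_add, 'f::field) seed"
  assumes "bij \<sigma>"
  shows "range (generator \<iota> (relabel \<sigma> S)) = range (generator \<iota> S)"
proof -
  have r: "range (generator \<iota> T) = range (cluster T) \<union> range (new_var \<iota> T)" for T :: "('n, 'p, 'f) seed"
  proof
    show "range (generator \<iota> T) \<subseteq> range (cluster T) \<union> range (new_var \<iota> T)"
    proof safe
      fix v assume "generator \<iota> T v \<notin> range (new_var \<iota> T)"
      then show "generator \<iota> T v \<in> range (cluster T)" by (cases v) auto
    qed
    have "cluster T i = generator \<iota> T (Vx i)" "new_var \<iota> T i = generator \<iota> T (Vx' i)" for i by simp_all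
    then show "range (cluster T) \<union> range (new_var \<iota> T) \<subseteq> range (generator \<iota> T)" by blast
  qed
  have "new_var \<iota> (relabel \<sigma> S) = new_var \<iota> S \<circ> \<sigma>"
    by (simp add: fun_eq_iff new_var_relabel[OF assms])
  moreover have "range (h \<circ> \<sigma>) = range h" for h :: "'n \<Rightarrow> 'f"
    using bij_is_surj[OF assms] by (metis image_comp)
  ultimately show ?thesis unfolding r by simp
qed

text \<open>Quantifying over \<open>\<sigma>\<close> absorbs relabeling steps, so that only
  mutations need an argument. Steps may be traversed in either direction, hence
  \<open>weak_mutation_sym\<close>.\<close>

theorem equivalent_liftable:
  assumes \<iota>: "ring_embedding \<iota>" and S: "is_seed \<iota> S" "acyclic_seed S"
    and equiv: "seed_mutation_equiv \<iota> S S'" and "bij \<sigma>"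
  shows "liftable \<iota> (relabel \<sigma> S') (lower_bound \<iota> S) \<and> (\<forall>i. cluster (relabel \<sigma> S') i \<noteq> 0)"
  using equiv[unfolded seed_mutation_equiv_def] \<open>bij \<sigma>\<close>
proof (induction arbitrary: \<sigma> rule: equivclp_induct)
  case base
  have "sign_skew_symmetric (exch (relabel \<sigma> S))"
    using S(1) by (simp add: is_seed_def sign_skew_symmetric_def)
  moreover have nz: "cluster (relabel \<sigma> S) i \<noteq> 0" for i
    using is_seed_nonzero[OF \<iota> S(1)] by simp
  ultimately have "liftable \<iota> (relabel \<sigma> S)
      (lower_bound \<iota> (relabel \<sigma> S))"
    by (rule liftable_acyclic[OF \<iota> acyclic_seed_relabel[OF S(2)]])
  then have "liftable \<iota> (relabel \<sigma> S) (lower_bound \<iota> S)"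
    by (simp only: range_generator_relabel[OF base])
  with nz show ?case by blast
next
  case (step T T')
  let ?goal = "liftable \<iota> (relabel \<sigma> T') (lower_bound \<iota> S) \<and> (\<forall>i. cluster (relabel \<sigma> T') i \<noteq> 0)"
  have mut: ?goal
    if "weak_mutation \<iota> k T T'" for k
  proof -
    have "k = \<sigma> (inv \<sigma> k)" using step.prems by (simp add: bij_is_surj surj_f_inv_f)
    then have wm: "weak_mutation \<iota> (inv \<sigma> k) (relabel \<sigma> T) (relabel \<sigma> T')"
      using that by (intro weak_mutation_relabel[OF step.prems]) simp
    have "liftable \<iota> (relabel \<sigma> T) (lower_bound \<iota> S)" using step.IH[OF step.prems] by blast
    from liftable_mutation[OF \<iota> this wm] show ?thesis
      using wm unfolding weak_mutation_def by blast
  qed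
  have rel: ?goal
    if "T' = relabel \<tau> T" "bij \<tau>" for \<tau>
    using step.IH[OF bij_comp[OF step.prems that(2)]] unfolding that(1) relabel_relabel .
  from step.hyps(2) consider k where "seed_mutation \<iota> k T T'" | k where "seed_mutation \<iota> k T' T"
    | "seed_relabeling T T'" | "seed_relabeling T' T" by blast
  then show ?case
  proof cases
    case 1 then show ?thesis by (rule mut[OF seed_mutation_imp_weak[OF \<iota>]])
  next
    case 2 then show ?thesis by (rule mut[OF weak_mutation_sym[OF seed_mutation_imp_weak[OF \<iota>]]])
  next
    case 3
    then obtain \<tau> where "bij \<tau>" "T' = relabel \<tau> T" by (auto simp: seed_relabeling_iff)
    then show ?thesis by (intro rel)
  next
    case 4
    then obtain \<tau> where \<tau>: "bij \<tau>" "T = relabel \<tau> T'" by (auto simp: seed_relabeling_iff)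
    have "\<tau> \<circ> inv \<tau> = id" using \<tau>(1) by (simp add: bij_is_surj surj_iff[symmetric])
    then have "T' = relabel (inv \<tau>) T" by (simp only: \<tau>(2) relabel_relabel relabel_id)
    then show ?thesis by (rule rel) (rule bij_imp_bij_inv[OF \<tau>(1)])
  qed
qed

text \<open>In its own cluster a cluster variable is a monomial without negative exponents, so all
  Laurent conditions hold trivially.\<close>

corollary cluster_variable_in_lower_bound:
  fixes S S' :: "('n::finite, 'p::ab_group_add, 'f::field) seed"
  assumes \<iota>: "ring_embedding \<iota>" and S: "is_seed \<iota> S" "acyclic_seed S"
    and equiv: "seed_mutation_equiv \<iota> S S'"
  shows "cluster S' i \<in> lower_bound \<iota> S"
proof -
  let ?L = "lower_bound \<iota> S"
  from equivalent_liftable[OF \<iota> S equiv bij_id]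
  have "liftable \<iota> (relabel id S') ?L" and nz: "cluster S' i \<noteq> 0" for i by simp_all
  interpret laurent_eval "\<lambda>q. group_char \<iota> (fst q)" "cluster S'"
    by (rule laurent_eval_group_char(1)[OF \<iota> nz])
  from \<open>liftable \<iota> (relabel id S') ?L\<close> obtain d m where L: "\<And>Y. (\<And>j. laurent_cond ldeg
         (lpoly (exch S') (lift_plus (pplus S') m d) (lift_minus (pminus S') m d)) j Y) \<Longrightarrow>
       leval (\<lambda>q. group_char \<iota> (fst q)) (cluster S') Y \<in> ?L"
    unfolding liftable_def relabel_id by blast
  have "leval (\<lambda>q. group_char \<iota> (fst q)) (cluster S')
      (single (unit_vec i :: ('p \<times> ('n \<Rightarrow> int), 'n) exponent) 1) \<in> ?L"
    by (intro L laurent_cond_at_least at_least_single) (simp add: ldeg_unit_vec)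
  moreover have "(\<Prod>l\<in>UNIV. cluster S' l powi (if l = i then 1 else 0)) = cluster S' i"
    by (subst prod.remove[of UNIV i]) auto
  ultimately show ?thesis
    using group_char_hom(1)[OF \<iota>] by (simp add: leval_single unit_vec_def)
qed

section \<open>Algebraic independence and Laurent polynomials\<close>

lemma pp_eval_superset:
  assumes "finite V" "keys m \<subseteq> V"
  shows "pp_eval y m = (\<Prod>v\<in>V. y v ^ lookup m v)"
  unfolding pp_eval_def using assms
  by (intro prod.mono_neutral_left) (auto simp: in_keys_iff)

lemma pp_eval_zero: "pp_eval y 0 = 1"
  by (simp add: pp_eval_def)

lemma pp_eval_add: "pp_eval y (u + v) = pp_eval y u * pp_eval y v"
proof -
  have k: "keys (u + v) \<subseteq> keys u \<union> keys v" by (rule keys_add)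
  show ?thesis
    using pp_eval_superset[of "keys u \<union> keys v" "u + v" y] pp_eval_superset[of "keys u \<union> keys v" u y]
      pp_eval_superset[of "keys u \<union> keys v" v y] k
    by (simp add: lookup_add power_add prod.distrib)
qed

lemma mp_eval_eq_lin_ext: "mp_eval h y = lin_ext h (pp_eval y)"
  by (simp add: fun_eq_iff mp_eval_def lin_ext_def)

lemma mp_eval_character_ext:
  "ring_embedding \<iota> \<Longrightarrow> character_ext \<iota> (pp_eval y)"
  by unfold_locales (simp_all add: ring_embeddingD pp_eval_zero pp_eval_add)

lemma lookup_sum_single_inj:
  assumes "finite I" "inj_on e I" "s \<in> I"
  shows "lookup (\<Sum>i\<in>I. single (e i) (c i)) (e s) = c s"
proof -
  have "lookup (\<Sum>i\<in>I. single (e i) (c i)) (e s) = (\<Sum>i\<in>I. if i = s then c i else 0)"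
    unfolding lookup_sum lookup_single using assms(2,3)
    by (intro sum.cong) (auto simp: when_def inj_on_eq_iff)
  then show ?thesis using assms(1,3) by (simp add: sum.delta)
qed

lemma common_denominator:
  assumes \<iota>: "ring_embedding (\<iota> :: 'r::comm_ring_1 \<Rightarrow> 'f::field)" and "finite A" "A \<subseteq> coeff_field \<iota>"
  shows "\<exists>b. b \<noteq> 0 \<and> (\<forall>c\<in>A. \<exists>a. \<iota> b * c = \<iota> a)"
  using assms(2,3)
proof (induction A)
  case empty
  have "(1 :: 'r) \<noteq> 0" using ring_embeddingD(2,5)[OF \<iota>] by (metis zero_neq_one)
  then show ?case by blast
next
  case (insert c A)
  note h = ring_embeddingD(4)[OF \<iota>] and z = ring_embedding_eq_0_iff[OF \<iota>]
  from insert obtain b where b: "b \<noteq> 0" "\<And>c. c \<in> A \<Longrightarrow> \<exists>a. \<iota> b * c = \<iota> a" by auto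
  from insert.prems obtain u v where c: "c = \<iota> u / \<iota> v" "v \<noteq> 0" by (auto simp: coeff_field_def)
  have "b * v \<noteq> 0" using b(1) c(2) z h by (metis mult_eq_0_iff)
  moreover have "\<exists>a. \<iota> (b * v) * c' = \<iota> a" if "c' \<in> insert c A" for c'
  proof (cases "c' = c")
    case True
    then show ?thesis using c z[of v] by (intro exI[of _ "b * u"]) (simp add: h)
  next
    case False
    with that b(2) obtain a where "\<iota> b * c' = \<iota> a" by auto
    then show ?thesis by (intro exI[of _ "a * v"]) (simp add: h ac_simps)
  qed
  ultimately show ?case by blast
qed

text \<open>A common denominator of the finitely many coefficients moves a relation from the
  fraction field into the coefficient ring.\<close>

lemma alg_independent_coeff_field_iff:
  fixes \<iota> :: "'r::comm_ring_1 \<Rightarrow> 'f::field" and x :: "'n \<Rightarrow> 'f"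
  assumes \<iota>: "ring_embedding \<iota>"
  shows "alg_independent (coeff_field \<iota>) x \<longleftrightarrow> (\<forall>Q :: ('n, 'r) mpoly. mp_eval \<iota> x Q = 0 \<longrightarrow> Q = 0)"
proof (intro iffI allI impI)
  fix Q :: "('n, 'r) mpoly"
  assume ind: "alg_independent (coeff_field \<iota>) x" and Q: "mp_eval \<iota> x Q = 0"
  have lk: "lookup (Poly_Mapping.map \<iota> Q) m = \<iota> (lookup Q m)" for m
    using ring_embeddingD(5)[OF \<iota>] by (simp add: map.rep_eq when_def)
  have k: "keys (Poly_Mapping.map \<iota> Q) = keys Q"
    by (auto simp: in_keys_iff lk ring_embedding_eq_0_iff[OF \<iota>])
  have "Poly_Mapping.range (Poly_Mapping.map \<iota> Q) \<subseteq> coeff_field \<iota>"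
  proof
    fix c assume "c \<in> Poly_Mapping.range (Poly_Mapping.map \<iota> Q)"
    then obtain m where "c = lookup (Poly_Mapping.map \<iota> Q) m" by (auto simp: range.rep_eq)
    then have "c = \<iota> (lookup Q m) / \<iota> 1" using ring_embeddingD(2)[OF \<iota>] by (simp add: lk)
    moreover have "(1 :: 'r) \<noteq> 0" using ring_embeddingD(2,5)[OF \<iota>] by (metis zero_neq_one)
    ultimately show "c \<in> coeff_field \<iota>" unfolding coeff_field_def by blast
  qed
  moreover have "mp_eval (\<lambda>c. c) x (Poly_Mapping.map \<iota> Q) = 0"
    using Q by (simp add: mp_eval_def k lk)
  ultimately have "Poly_Mapping.map \<iota> Q = 0" using ind unfolding alg_independent_def by blast
  then have "keys Q = {}" using k by simp
  then show "Q = 0" by (metis poly_mapping_sum_single sum.empty)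
next
  assume inj: "\<forall>Q :: ('n, 'r) mpoly. mp_eval \<iota> x Q = 0 \<longrightarrow> Q = 0"
  show "alg_independent (coeff_field \<iota>) x"
    unfolding alg_independent_def
  proof (intro allI impI)
    fix p :: "('n, 'f) mpoly"
    assume p: "Poly_Mapping.range p \<subseteq> coeff_field \<iota>" "mp_eval (\<lambda>c. c) x p = 0"
    interpret mp: character_ext \<iota> "pp_eval x" by (rule mp_eval_character_ext[OF \<iota>])
    from common_denominator[OF \<iota> _ p(1)] obtain b where
      b: "b \<noteq> 0" "\<And>c. c \<in> Poly_Mapping.range p \<Longrightarrow> \<exists>a. \<iota> b * c = \<iota> a" by auto
    have "\<exists>a. \<iota> b * lookup p m = \<iota> a" if "m \<in> keys p" for m
      using that by (intro b(2)) simp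
    then obtain a where a: "\<And>m. m \<in> keys p \<Longrightarrow> \<iota> b * lookup p m = \<iota> (a m)" by metis
    define Q :: "('n, 'r) mpoly" where "Q = (\<Sum>m\<in>keys p. single m (a m))"
    have "mp_eval \<iota> x Q = (\<Sum>m\<in>keys p. \<iota> (a m) * pp_eval x m)"
      by (simp add: mp_eval_eq_lin_ext Q_def mp.sum)
    also have "\<dots> = \<iota> b * mp_eval (\<lambda>c. c) x p"
      unfolding mp_eval_def sum_distrib_left
      by (intro sum.cong) (simp_all add: a[symmetric] mult.assoc)
    finally have "Q = 0" using inj p(2) by simp
    have "keys p = {}"
    proof (rule ccontr)
      assume "keys p \<noteq> {}"
      then obtain m where m: "m \<in> keys p" by blast
      have "lookup Q m = a m"
        unfolding Q_def using m lookup_sum_single_inj[of "keys p" id m a] by simp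
      with \<open>Q = 0\<close> a[OF m] have "\<iota> b * lookup p m = 0" using ring_embeddingD(5)[OF \<iota>] by simp
      with b(1) m show False by (simp add: ring_embedding_eq_0_iff[OF \<iota>] in_keys_iff)
    qed
    then show "p = 0" by (metis poly_mapping_sum_single sum.empty)
  qed
qed

lemma pp_eval_finite: "pp_eval y m = (\<Prod>v\<in>UNIV. y (v::'n::finite) ^ lookup m v)"
  by (rule pp_eval_superset) auto

definition pp_of :: "('n::finite \<Rightarrow> int) \<Rightarrow> 'n power_product" where
  "pp_of v = Abs_poly_mapping (\<lambda>i. nat (v i))"

lemma lookup_pp_of: "lookup (pp_of v) i = nat (v i)"
  unfolding pp_of_def by (subst lookup_Abs_poly_mapping) (rule finite, rule refl)

lemma leval_eq_0_nonneg:
  fixes x :: "'n::finite \<Rightarrow> 'f::field" and \<iota> :: "'p::ab_group_add group_ring \<Rightarrow> 'f"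
  assumes \<iota>: "ring_embedding \<iota>"
    and inj: "\<And>Q :: ('n, 'p group_ring) mpoly. mp_eval \<iota> x Q = 0 \<Longrightarrow> Q = 0"
    and Y: "leval (group_char \<iota>) x Y = 0" and nonneg: "\<And>i g. g \<in> keys Y \<Longrightarrow> 0 \<le> ldeg i g"
  shows "Y = 0"
proof -
  interpret mp: character_ext \<iota> "pp_eval x" by (rule mp_eval_character_ext[OF \<iota>])
  define Q :: "('n, 'p group_ring) mpoly" where
    "Q = (\<Sum>g\<in>keys Y. single (pp_of (snd g)) (single (fst g) (lookup Y g)))"
  have "mp_eval \<iota> x Q = (\<Sum>g\<in>keys Y. \<iota> (single (fst g) (lookup Y g)) * pp_eval x (pp_of (snd g)))"
    by (simp add: mp_eval_eq_lin_ext Q_def mp.sum)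
  also have "\<dots> = leval (group_char \<iota>) x Y"
    unfolding leval_def lin_ext_def
  proof (rule sum.cong)
    fix g assume g: "g \<in> keys Y"
    have "pp_eval x (pp_of (snd g)) = (\<Prod>i\<in>UNIV. x i powi snd g i)"
      unfolding pp_eval_finite using nonneg[OF g]
      by (intro prod.cong) (auto simp: lookup_pp_of power_int_def ldeg_def)
    then show "\<iota> (single (fst g) (lookup Y g)) * pp_eval x (pp_of (snd g)) =
        of_int (lookup Y g) * (group_char \<iota> (fst g) * (\<Prod>i\<in>UNIV. x i powi snd g i))"
      by (simp add: embedding_single[OF \<iota>] mult.assoc)
  qed simp
  finally have "Q = 0" using Y by (intro inj) simp
  have "keys Y = {}"
  proof (rule ccontr)
    assume "keys Y \<noteq> {}"
    then obtain h where h: "h \<in> keys Y" by blast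
    have pp: "pp_of (snd g) = pp_of (snd h) \<longleftrightarrow> snd g = snd h" if "g \<in> keys Y" for g
    proof
      assume eq: "pp_of (snd g) = pp_of (snd h)"
      have "snd g i = snd h i" for i
        using arg_cong[OF eq, of "\<lambda>m. lookup m i"] nonneg[OF that, of i] nonneg[OF h, of i]
        by (simp add: lookup_pp_of ldeg_def)
      then show "snd g = snd h" by (simp add: fun_eq_iff)
    qed simp
    have "lookup (lookup Q (pp_of (snd h))) (fst h) =
        (\<Sum>g\<in>keys Y. lookup (single (fst g) (lookup Y g) when pp_of (snd g) = pp_of (snd h)) (fst h))"
      by (simp add: Q_def lookup_sum lookup_single)
    also have "\<dots> = (\<Sum>g\<in>keys Y. if g = h then lookup Y g else 0)"
      by (intro sum.cong) (auto simp: pp when_def lookup_single prod_eq_iff)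
    also have "\<dots> = lookup Y h" using h by (simp add: sum.delta)
    finally show False using h \<open>Q = 0\<close> by (simp add: in_keys_iff)
  qed
  then show ?thesis by (metis poly_mapping_sum_single sum.empty)
qed

lemma single_mult_eq_0D:
  fixes Y :: "'g::ab_group_add \<Rightarrow>\<^sub>0 int"
  assumes "single h 1 * Y = 0"
  shows "Y = 0"
proof -
  have "Y = single (- h) 1 * (single h 1 * Y)" by (simp add: mult.assoc[symmetric] mult_single)
  then show ?thesis using assms by simp
qed

text \<open>A large monomial clears the negative exponents. This injectivity concerns the original
  coefficients; it fails for lifts, where the auxiliary variables become 1.\<close>

lemma leval_eq_0D:
  fixes x :: "'n::finite \<Rightarrow> 'f::field" and \<iota> :: "'p::ab_group_add group_ring \<Rightarrow> 'f"
  assumes \<iota>: "ring_embedding \<iota>" and ind: "alg_independent (coeff_field \<iota>) x"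
    and Y: "leval (group_char \<iota>) x Y = 0"
  shows "Y = 0"
proof -
  interpret laurent_eval "group_char \<iota>" x
    by (rule laurent_eval_group_char(2)[OF \<iota> alg_independent_nonzero[OF \<iota> ind]])
  have "\<exists>d. \<forall>g\<in>keys Y. - int d \<le> ldeg i g" for i
  proof -
    obtain d where "Y \<in> at_least (ldeg i) d" using ex_at_least by blast
    then show ?thesis by (intro exI[of _ "nat (- d)"]) (force simp: at_least_def)
  qed
  then obtain d :: "'n \<Rightarrow> nat" where d: "\<And>i g. g \<in> keys Y \<Longrightarrow> - int (d i) \<le> ldeg i g" by metis
  define h :: "('p, 'n) exponent" where "h = (0, \<lambda>i. int (d i))"
  have "0 \<le> ldeg i g" if "g \<in> keys (single h 1 * Y)" for i g
  proof -
    from that keys_mult[of "single h 1" Y] obtain g' where "g' \<in> keys Y" "g = h + g'" by auto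
    then show ?thesis using d[of g' i] by (simp add: h_def)
  qed
  moreover have "leval (group_char \<iota>) x (single h 1 * Y) = 0" using Y by (simp add: leval_mult)
  ultimately have "single h 1 * Y = 0"
    using ind unfolding alg_independent_coeff_field_iff[OF \<iota>]
    by (intro leval_eq_0_nonneg[OF \<iota>]) blast+
  then show ?thesis by (rule single_mult_eq_0D)
qed

lemma leval_lpoly_nonzero:
  fixes \<iota> :: "'p::ab_group_add group_ring \<Rightarrow> 'f::field" and x :: "'n::finite \<Rightarrow> 'f"
  assumes "ring_embedding \<iota>" "alg_independent (coeff_field \<iota>) x"
  shows "leval (group_char \<iota>) x (lpoly B a b j) \<noteq> 0"
proof
  assume "leval (group_char \<iota>) x (lpoly B a b j) = 0"
  then have "lpoly B a b j = 0" by (rule leval_eq_0D[OF assms])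
  then show False using keys_lpoly[of B a b j] by simp
qed

text \<open>For the given coefficients regularity comes from the field: evaluation is injective and
  the binomial has a nonzero value.\<close>

lemma lpoly_regular:
  fixes \<iota> :: "'p::ab_group_add group_ring \<Rightarrow> 'f::field" and x :: "'n::finite \<Rightarrow> 'f"
    and c :: "('p, 'n) laurent"
  assumes \<iota>: "ring_embedding \<iota>" and ind: "alg_independent (coeff_field \<iota>) x"
    and "lpoly B a b j * c = 0"
  shows "c = 0"
proof (rule leval_eq_0D[OF \<iota> ind])
  interpret laurent_eval "group_char \<iota>" x
    by (rule laurent_eval_group_char(2)[OF \<iota> alg_independent_nonzero[OF \<iota> ind]])
  have "leval (group_char \<iota>) x (lpoly B a b j) * leval (group_char \<iota>) x c = 0"
    using arg_cong[OF assms(3), of "leval (group_char \<iota>) x"] by (simp add: leval_mult leval_zero)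
  then show "leval (group_char \<iota>) x c = 0" using leval_lpoly_nonzero[OF \<iota> ind] by simp
qed

lemma mp_eval_double_sum:
  fixes \<iota> :: "'p::ab_group_add group_ring \<Rightarrow> 'f::field" and Q :: "('v, 'p group_ring) mpoly"
  assumes \<iota>: "ring_embedding \<iota>"
  shows "mp_eval \<iota> y Q = (\<Sum>(m, p)\<in>(SIGMA m:keys Q. keys (lookup Q m)).
    \<iota> (single p (lookup (lookup Q m) p)) * pp_eval y m)"
proof -
  have hom: "\<iota> (\<Sum>p\<in>A. f p) = (\<Sum>p\<in>A. \<iota> (f p))" for A :: "'p set" and f
    by (induction A rule: infinite_finite_induct) (simp_all add: ring_embeddingD[OF \<iota>])
  have coeff: "\<iota> (lookup Q m) = (\<Sum>p\<in>keys (lookup Q m). \<iota> (single p (lookup (lookup Q m) p)))" for m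
    using hom[of "\<lambda>p. single p (lookup (lookup Q m) p)" "keys (lookup Q m)"]
    unfolding poly_mapping_sum_single[of "lookup Q m", symmetric] .
  have "mp_eval \<iota> y Q =
      (\<Sum>m\<in>keys Q. \<Sum>p\<in>keys (lookup Q m). \<iota> (single p (lookup (lookup Q m) p)) * pp_eval y m)"
    unfolding mp_eval_def coeff sum_distrib_right ..
  also have "\<dots> = (\<Sum>(m, p)\<in>(SIGMA m:keys Q. keys (lookup Q m)).
      \<iota> (single p (lookup (lookup Q m) p)) * pp_eval y m)"
    by (rule sum.Sigma) simp_all
  finally show ?thesis .
qed

lemma alg_independentI:
  fixes x :: "'n::finite \<Rightarrow> 'f::field" and \<iota> :: "'p::ab_group_add group_ring \<Rightarrow> 'f"
  assumes \<iota>: "ring_embedding \<iota>" and nz: "\<And>i. x i \<noteq> 0"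
    and inj: "\<And>Y. leval (group_char \<iota>) x Y = 0 \<Longrightarrow> Y = 0"
  shows "alg_independent (coeff_field \<iota>) x"
  unfolding alg_independent_coeff_field_iff[OF \<iota>]
proof (intro allI impI)
  fix Q :: "('n, 'p group_ring) mpoly"
  assume Q: "mp_eval \<iota> x Q = 0"
  interpret laurent_eval "group_char \<iota>" x by (rule laurent_eval_group_char(2)[OF \<iota> nz])
  interpret mp: character_ext \<iota> "pp_eval x" by (rule mp_eval_character_ext[OF \<iota>])
  define I where "I = (SIGMA m:keys Q. keys (lookup Q m))"
  define e :: "'n power_product \<times> 'p \<Rightarrow> ('p, 'n) exponent" where
    "e = (\<lambda>(m, p). (p, \<lambda>i. int (lookup m i)))"
  define c where "c = (\<lambda>(m, p). lookup (lookup Q m) p)"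
  define Y where "Y = (\<Sum>s\<in>I. single (e s) (c s))"
  have I: "finite I" by (simp add: I_def)
  have e: "inj_on e I"
    by (auto simp: inj_on_def e_def fun_eq_iff intro: poly_mapping_eqI)
  have "leval (group_char \<iota>) x Y = (\<Sum>(m, p)\<in>I. \<iota> (single p (lookup (lookup Q m) p)) * pp_eval x m)"
    unfolding Y_def leval_sum
    by (intro sum.cong) (auto simp: leval_single e_def c_def embedding_single[OF \<iota>] pp_eval_finite mult.assoc)
  also have "\<dots> = 0" using Q unfolding mp_eval_double_sum[OF \<iota>] I_def .
  finally have "Y = 0" by (rule inj)
  have "lookup (lookup Q m) p = 0" for m p
  proof (rule ccontr)
    assume "lookup (lookup Q m) p \<noteq> 0"
    then have mem: "(m, p) \<in> I" by (auto simp: I_def in_keys_iff)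
    have "lookup Y (e (m, p)) = c (m, p)"
      unfolding Y_def by (rule lookup_sum_single_inj[OF I e mem])
    then show False using \<open>Y = 0\<close> \<open>lookup (lookup Q m) p \<noteq> 0\<close> by (simp add: c_def)
  qed
  then show "Q = 0" by (intro poly_mapping_eqI) simp
qed


section \<open>Existence of seed mutations\<close>

lemma leval_upd:
  assumes "laurent_eval \<kappa> x" "\<And>g. g \<in> keys p \<Longrightarrow> ldeg k g = 0"
  shows "leval \<kappa> (x(k := v)) p = leval \<kappa> x p"
  unfolding leval_def lin_ext_def using assms(2)
  by (intro sum.cong refl arg_cong2[of _ _ _ _ "(*)"] prod.cong) (auto simp: ldeg_def)

text \<open>The old cluster is regarded as the mutation of the new one, with the same
  \<open>P_k\<close>. A relation in the new cluster is carried to the old one, where it vanishes by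
  independence; regularity of \<open>P_k\<close> brings the vanishing back.\<close>

lemma alg_independent_mutation:
  fixes S :: "('n::finite, 'p::ab_group_add, 'f::field) seed"
  assumes \<iota>: "ring_embedding \<iota>" and ind: "alg_independent (coeff_field \<iota>) (cluster S)"
    and skew: "sign_skew_symmetric (exch S)"
  shows "alg_independent (coeff_field \<iota>) ((cluster S)(k := new_var \<iota> S k))" "new_var \<iota> S k \<noteq> 0"
proof -
  let ?x = "cluster S" and ?x' = "(cluster S)(k := new_var \<iota> S k)" and ?\<kappa> = "group_char \<iota>"
  let ?p = "lpoly (exch S) (pplus S) (pminus S) k"
  have nz: "?x i \<noteq> 0" for i by (rule alg_independent_nonzero[OF \<iota> ind])
  have ev: "laurent_eval ?\<kappa> ?x" by (rule laurent_eval_group_char(2)[OF \<iota> nz])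
  interpret e: laurent_eval ?\<kappa> ?x by (rule ev)
  have p0: "g \<in> keys ?p \<Longrightarrow> ldeg k g = 0" for g
    by (rule lpoly_degree_self[OF skew])
  have p: "leval ?\<kappa> ?x ?p = exchange_poly \<iota> ?x S k"
    by (rule exchange_poly_eq_leval[OF ev refl refl])
  have p_nz: "leval ?\<kappa> ?x ?p \<noteq> 0" by (rule leval_lpoly_nonzero[OF \<iota> ind])
  then show nv: "new_var \<iota> S k \<noteq> 0" using p nz by (simp add: new_var_def)
  have reg: "c = 0" if "?p * c = 0" for c by (rule lpoly_regular[OF \<iota> ind that])
  have nz': "?x' i \<noteq> 0" for i using nz nv by simp
  have ev': "laurent_eval ?\<kappa> ?x'" by (rule laurent_eval_group_char(2)[OF \<iota> nz'])
  interpret e': laurent_eval ?\<kappa> ?x' by (rule ev')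
  have x_eq: "?x = ?x'(k := leval ?\<kappa> ?x' ?p / ?x' k)"
  proof -
    have "leval ?\<kappa> ?x' ?p / ?x' k = ?x k"
      using leval_upd[OF ev p0, where v = "new_var \<iota> S k"] p p_nz nz[of k] by (simp add: new_var_def)
    then show ?thesis by simp
  qed
  show "alg_independent (coeff_field \<iota>) ?x'"
  proof (rule alg_independentI[OF \<iota> nz'])
    fix Y assume Y: "leval ?\<kappa> ?x' Y = 0"
    obtain d where "Y \<in> at_least (ldeg k) d" using ex_at_least by blast
    then have d: "- \<bar>d\<bar> \<le> ldeg k g" if "g \<in> keys Y" for g
      using that unfolding at_least_def by fastforce
    \<comment> \<open>After this shift the \<open>k\<close>-th exponents are nonnegative, so the
      mutated expansion exists without division by \<open>P_k\<close>.\<close>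
    define h :: "('p, 'n) exponent" where "h = (0, \<lambda>i. \<bar>d\<bar>)"
    define Z where "Z = single h 1 * Y"
    have Z0: "leval ?\<kappa> ?x' Z = 0" using Y by (simp add: Z_def e'.leval_mult)
    have nonneg: "0 \<le> ldeg k g" if "g \<in> keys Z" for g
    proof -
      from that keys_mult[of "single h 1" Y] obtain g' where "g' \<in> keys Y" "g = h + g'"
        by (auto simp: Z_def)
      then show ?thesis using d[of g'] by (simp add: h_def)
    qed
    have mut: "mutates k ?p (single g c) (single (flip k g) c * ?p ^ nat (ldeg k g))"
      if "0 \<le> ldeg k g" for g c
    proof -
      have "mutates k ?p (single g c * ?p ^ nat (- ldeg k g)) (single (flip k g) c * ?p ^ nat (ldeg k g))"
        by (rule mutates_single) (rule p0)
      then show ?thesis using that by simp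
    qed
    have "mutates k ?p (\<Sum>g\<in>A. single g (lookup Z g))
        (\<Sum>g\<in>A. single (flip k g) (lookup Z g) * ?p ^ nat (ldeg k g))" if "A \<subseteq> keys Z" for A
      using finite_subset[OF that finite_keys] that
    proof (induction A)
      case (insert g A)
      then have "0 \<le> ldeg k g" by (intro nonneg) simp
      with insert show ?case by (simp add: mutates_add mut)
    qed (simp add: mutates_zero)
    from this[OF order.refl] obtain Z' where Z': "mutates k ?p Z Z'"
      unfolding poly_mapping_sum_single[of Z, symmetric] by (rule that)
    have "leval ?\<kappa> ?x Z' = leval ?\<kappa> ?x' Z"
      by (rule leval_mutates[OF ev' ev _ x_eq Z']) (rule p0)
    then have "Z' = 0" using Z0 by (intro leval_eq_0D[OF \<iota> ind]) simp
    have "Z = 0"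
      by (rule mutates_eq_0D[OF _ _ Z'[unfolded \<open>Z' = 0\<close>]]) (fact p0, fact reg)
    then show "Y = 0" unfolding Z_def by (rule single_mult_eq_0D)
  qed
qed

lemma subfield_closed:
  assumes "subfield_of H"
  shows "0 \<in> H" "1 \<in> H" "a \<in> H \<Longrightarrow> b \<in> H \<Longrightarrow> a + b \<in> H" "a \<in> H \<Longrightarrow> b \<in> H \<Longrightarrow> a * b \<in> H"
    "a \<in> H \<Longrightarrow> b \<in> H \<Longrightarrow> a / b \<in> H" "a \<in> H \<Longrightarrow> a ^ n \<in> H"
    "(\<And>i. i \<in> I \<Longrightarrow> f i \<in> H) \<Longrightarrow> (\<Prod>i\<in>I. f i) \<in> H"
proof -
  have s: "0 \<in> H" "1 \<in> H" "a \<in> H \<Longrightarrow> b \<in> H \<Longrightarrow> a - b \<in> H" "a \<in> H \<Longrightarrow> b \<in> H \<Longrightarrow> a * b \<in> H"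
    "a \<in> H \<Longrightarrow> inverse a \<in> H" for a b
    using assms by (simp_all add: subfield_of_def)
  show "0 \<in> H" "1 \<in> H" "a \<in> H \<Longrightarrow> b \<in> H \<Longrightarrow> a * b \<in> H" by (rule s; assumption)+
  show "a \<in> H \<Longrightarrow> b \<in> H \<Longrightarrow> a + b \<in> H" using s(3)[of a "0 - b"] s(3)[of 0 b] s(1) by simp
  show "a \<in> H \<Longrightarrow> b \<in> H \<Longrightarrow> a / b \<in> H" using s(4)[of a "inverse b"] s(5)[of b] by (simp add: field_simps)
  show "a \<in> H \<Longrightarrow> a ^ n \<in> H" by (induction n) (simp_all add: s)
  show "(\<And>i. i \<in> I \<Longrightarrow> f i \<in> H) \<Longrightarrow> (\<Prod>i\<in>I. f i) \<in> H"
    by (induction I rule: infinite_finite_induct) (simp_all add: s)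
qed

lemma hull_subfield: "subfield_of (subfield_of hull X)"
proof (rule hull_in)
  fix T :: "'a set set" assume T: "\<forall>A\<in>T. subfield_of A"
  have s: "0 \<in> A" "1 \<in> A" "a \<in> A \<Longrightarrow> b \<in> A \<Longrightarrow> a - b \<in> A" "a \<in> A \<Longrightarrow> b \<in> A \<Longrightarrow> a * b \<in> A"
    "a \<in> A \<Longrightarrow> inverse a \<in> A" if "A \<in> T" for A a b
    using T[rule_format, OF that] by (simp_all add: subfield_of_def)
  show "subfield_of (\<Inter>T)"
    unfolding subfield_of_def by (intro conjI ballI InterI) (simp_all add: s)
qed

lemma embedding_in_coeff_field:
  assumes "ring_embedding \<iota>"
  shows "\<iota> c \<in> coeff_field \<iota>"
proof -
  have "\<iota> c = \<iota> c / \<iota> 1" "(1 :: 'a) \<noteq> 0"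
    using ring_embeddingD(2,5)[OF assms] by (simp, metis zero_neq_one)
  then show ?thesis unfolding coeff_field_def by blast
qed

text \<open>\<open>P_k\<close> involves only the retained variables, so
  \<open>x_k = P_k / x_k'\<close> is recovered.\<close>

lemma adjoin_mutation:
  fixes S :: "('n::finite, 'p::ab_group_add, 'f::field) seed"
  assumes \<iota>: "ring_embedding \<iota>" and full: "adjoin (coeff_field \<iota>) (cluster S) = UNIV"
    and skew: "sign_skew_symmetric (exch S)" and nz: "cluster S k \<noteq> 0" "new_var \<iota> S k \<noteq> 0"
  shows "adjoin (coeff_field \<iota>) ((cluster S)(k := new_var \<iota> S k)) = UNIV"
proof -
  let ?x' = "(cluster S)(k := new_var \<iota> S k)"
  let ?H = "adjoin (coeff_field \<iota>) ?x'"
  have H: "subfield_of ?H" unfolding adjoin_def by (rule hull_subfield)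
  note c = subfield_closed[OF H]
  have K: "a \<in> ?H" if "a \<in> coeff_field \<iota>" for a
    unfolding adjoin_def using that by (intro hull_inc) simp
  have "?x' i \<in> ?H" for i unfolding adjoin_def by (rule hull_inc) (rule UnI2, rule rangeI)
  then have x: "cluster S i \<in> ?H" "new_var \<iota> S k \<in> ?H" if "i \<noteq> k" for i
    using that by (metis fun_upd_apply)+
  have "?x' k \<in> ?H" unfolding adjoin_def by (rule hull_inc) (rule UnI2, rule rangeI)
  then have nv: "new_var \<iota> S k \<in> ?H" by simp
  have "exchange_poly \<iota> (cluster S) S k \<in> ?H"
    unfolding exchange_poly_def using sign_skew_diag[OF skew, of k]
    by (intro c(3,4,6,7) K embedding_in_coeff_field[OF \<iota>] x) auto
  then have "exchange_poly \<iota> (cluster S) S k / new_var \<iota> S k \<in> ?H" using nv by (rule c(5))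
  moreover have "exchange_poly \<iota> (cluster S) S k / new_var \<iota> S k = cluster S k"
    using nz by (auto simp: new_var_def)
  ultimately have "cluster S i \<in> ?H" for i using x by (cases "i = k") auto
  then have "adjoin (coeff_field \<iota>) (cluster S) \<subseteq> ?H"
    unfolding adjoin_def[of _ "cluster S"] by (intro hull_minimal H) (auto intro: K)
  then show ?thesis using full by blast
qed

lemma algebraic_over_UNIV: "algebraic_over UNIV a"
  unfolding algebraic_over_def by (intro exI[of _ "[:- a, 1:]"]) simp

lemma ex_seed_mutation:
  assumes \<iota>: "ring_embedding \<iota>" and S: "is_seed \<iota> S"
    and skew': "sign_skew_symmetric (matrix_mutation k (exch S))"
  shows "\<exists>S'. seed_mutation \<iota> k S S'"
proof -
  have ind: "alg_independent (coeff_field \<iota>) (cluster S)"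
    and full: "adjoin (coeff_field \<iota>) (cluster S) = UNIV" and skew: "sign_skew_symmetric (exch S)"
    using S by (simp_all add: is_seed_def transcendence_basis_def)
  note mut = alg_independent_mutation[OF \<iota> ind skew, of k]
  define q where "q i = int_mult (exch S k i) (if exch S k i \<ge> 0 then pplus S k else pminus S k) +
    (pplus S i - pminus S i)" for i
  \<comment> \<open>For \<open>i \<noteq> k\<close> only the ratio is prescribed; the second
    coefficient is taken to be trivial and the first carries the whole ratio.\<close>
  let ?S' = "\<lparr>cluster = (cluster S)(k := new_var \<iota> S k),
    pplus = (\<lambda>i. if i = k then pminus S k else q i), pminus = (\<lambda>i. if i = k then pplus S k else 0),
    exch = matrix_mutation k (exch S)\<rparr>"
  have "is_seed \<iota> ?S'"
    unfolding is_seed_def transcendence_basis_def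
    using mut(1) adjoin_mutation[OF \<iota> full skew alg_independent_nonzero[OF \<iota> ind] mut(2)] skew'
    by (simp, intro allI algebraic_over_UNIV)
  then have "seed_mutation \<iota> k S ?S'"
    using S by (auto simp: seed_mutation_def q_def int_mult_def)
  then show ?thesis by blast
qed

section \<open>Reduction to standard monomials\<close>

lemma ring_module: "module ((*) :: 'a::comm_ring_1 \<Rightarrow> 'a \<Rightarrow> 'a)"
  by unfold_locales (simp_all add: algebra_simps)

lemma ideal_gen_closed:
  "x \<in> G \<Longrightarrow> x \<in> ideal_gen G" "0 \<in> ideal_gen G"
  "x \<in> ideal_gen G \<Longrightarrow> y \<in> ideal_gen G \<Longrightarrow> x + y \<in> ideal_gen G"
  "x \<in> ideal_gen G \<Longrightarrow> y \<in> ideal_gen G \<Longrightarrow> x - y \<in> ideal_gen G"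
  "x \<in> ideal_gen G \<Longrightarrow> c * x \<in> ideal_gen G"
  "(\<And>i. i \<in> I \<Longrightarrow> f i \<in> ideal_gen G) \<Longrightarrow> (\<Sum>i\<in>I. f i) \<in> ideal_gen G"
  unfolding ideal_gen_def
  by (fact module.span_base[OF ring_module] module.span_zero[OF ring_module] module.span_add[OF ring_module] module.span_diff[OF ring_module]
      module.span_scale[OF ring_module] module.span_sum[OF ring_module])+

lemma ideal_gen_minimal:
  assumes "G \<subseteq> I" "0 \<in> I" "\<And>x y. x \<in> I \<Longrightarrow> y \<in> I \<Longrightarrow> x + y \<in> I" "\<And>c x. x \<in> I \<Longrightarrow> c * x \<in> I"
  shows "ideal_gen G \<subseteq> I"
  unfolding ideal_gen_def
  by (rule module.span_minimal[OF ring_module assms(1)]) (use assms(2-4) in \<open>simp add: module.subspace_def[OF ring_module]\<close>)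

lemma poly_mapping_expand_scaled: "Q = (\<Sum>m\<in>keys Q. single 0 (lookup Q m) * single m 1)"
  for Q :: "'g::comm_monoid_add \<Rightarrow>\<^sub>0 'r::comm_ring_1"
  by (subst (1) poly_mapping_sum_single[of Q]) (simp add: mult_single)

lemma keys_scaled: "keys (single 0 c * Q) \<subseteq> keys Q"
  for Q :: "'g::comm_monoid_add \<Rightarrow>\<^sub>0 'r::comm_ring_1"
  using keys_mult[of "single 0 c" Q] by (auto split: if_splits)

lemma keys_sum_subset: "keys (\<Sum>i\<in>I. f i) \<subseteq> (\<Union>i\<in>I. keys (f i))"
  for f :: "'i \<Rightarrow> 'g \<Rightarrow>\<^sub>0 'r::comm_monoid_add"
proof (induction I rule: infinite_finite_induct)
  case (insert i I)
  then show ?case using keys_add[of "f i" "\<Sum>i\<in>I. f i"] by auto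
qed auto

definition unprimed :: "('n var, 'r::zero) mpoly set" where
  "unprimed = {p. \<forall>m\<in>keys p. \<forall>i. lookup m (Vx' i) = 0}"

lemma unprimed_closed:
  fixes p q :: "('n var, 'r::comm_ring_1) mpoly"
  shows "p \<in> unprimed \<Longrightarrow> q \<in> unprimed \<Longrightarrow> p + q \<in> unprimed"
    and "p \<in> unprimed \<Longrightarrow> q \<in> unprimed \<Longrightarrow> p * q \<in> unprimed"
    and "mp_const c \<in> unprimed" and "mp_var (Vx i) \<in> unprimed"
proof -
  show "p \<in> unprimed \<Longrightarrow> q \<in> unprimed \<Longrightarrow> p + q \<in> unprimed"
    using keys_add[of p q] unfolding unprimed_def by blast
  show "p \<in> unprimed \<Longrightarrow> q \<in> unprimed \<Longrightarrow> p * q \<in> unprimed"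
    using keys_mult[of p q] unfolding unprimed_def by (fastforce simp: lookup_add)
qed (auto simp: unprimed_def mp_const_def mp_var_def lookup_single)

lemma unprimed_prod_power:
  fixes f :: "'i \<Rightarrow> ('n var, 'r::comm_ring_1) mpoly"
  assumes "\<And>i. i \<in> I \<Longrightarrow> f i \<in> unprimed"
  shows "(\<Prod>i\<in>I. f i ^ e i) \<in> unprimed"
proof -
  have one: "(1 :: ('n var, 'r) mpoly) \<in> unprimed" by (simp add: unprimed_def)
  have "f i ^ n \<in> unprimed" if "i \<in> I" for i n
    using assms[OF that] by (induction n) (simp_all add: one unprimed_closed)
  then show ?thesis
    by (induction I rule: infinite_finite_induct) (simp_all add: one unprimed_closed)
qed

lemma formal_exchange_poly_unprimed: "formal_exchange_poly S j \<in> unprimed"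
  unfolding formal_exchange_poly_def exchange_poly_def
  by (intro unprimed_closed unprimed_prod_power)

definition pair_pp :: "'n \<Rightarrow> 'n var power_product" where
  "pair_pp j = single (Vx j) 1 + single (Vx' j) 1"

lemma exchange_relation_eq: "exchange_relation S j = single (pair_pp j) 1 - formal_exchange_poly S j"
  by (simp add: exchange_relation_def mp_var_def mult_single pair_pp_def)

lemma not_standardE:
  assumes "m \<notin> standard_pps"
  obtains j m0 where "m = m0 + pair_pp j"
proof -
  from assms obtain j where j: "lookup m (Vx j) \<noteq> 0" "lookup m (Vx' j) \<noteq> 0"
    by (auto simp: standard_pps_def)
  have "m = (m - pair_pp j) + pair_pp j"
  proof (rule poly_mapping_eqI)
    fix v
    show "lookup m v = lookup (m - pair_pp j + pair_pp j) v"
      using j by (cases v) (auto simp: lookup_add lookup_minus pair_pp_def lookup_single when_def)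
  qed
  then show thesis by (rule that)
qed

lemma term_orderD:
  assumes "term_order r"
  shows "(m, m) \<in> r" "(m, m') \<in> r \<Longrightarrow> (m', m'') \<in> r \<Longrightarrow> (m, m'') \<in> r"
    "(m, m') \<in> r \<Longrightarrow> (m', m) \<in> r \<Longrightarrow> m = m'" "(m, m') \<in> r \<or> (m', m) \<in> r"
    "(m, m') \<in> r \<Longrightarrow> (u + m, u + m') \<in> r"
proof -
  have lin: "linear_order r" using assms by (simp add: term_order_def)
  then show "(m, m) \<in> r"
    by (simp add: order_on_defs refl_on_def)
  show "(m, m') \<in> r \<Longrightarrow> (m', m'') \<in> r \<Longrightarrow> (m, m'') \<in> r"
    using lin by (meson order_on_defs(1-3) transD)
  show "(m, m') \<in> r \<Longrightarrow> (m', m) \<in> r \<Longrightarrow> m = m'"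
    using lin by (meson order_on_defs(1-3) antisymD)
  show "(m, m') \<in> r \<or> (m', m) \<in> r"
    using lin \<open>(m, m) \<in> r\<close> by (cases "m = m'") (auto simp: order_on_defs total_on_def)
  show "(m, m') \<in> r \<Longrightarrow> (u + m, u + m') \<in> r"
    using assms by (auto simp: term_order_def add.commute)
qed

abbreviation (input) exchange_ideal :: "('n::finite, 'p::ab_group_add, 'f) seed \<Rightarrow> ('n var, 'p group_ring) mpoly set" where
  "exchange_ideal S \<equiv> ideal_gen (range (exchange_relation S))"

text \<open>All admissible term orders are treated at once, because the normal form is later chosen
  independently of an order.\<close>

definition normal_form_of ::
    "('n::finite, 'p::ab_group_add, 'f) seed \<Rightarrow> 'n var power_product \<Rightarrow> ('n var, 'p group_ring) mpoly \<Rightarrow> bool" where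
  "normal_form_of S m s \<longleftrightarrow> keys s \<subseteq> standard_pps \<and>
     single m 1 - s \<in> exchange_ideal S \<and>
     (m \<in> standard_pps \<longrightarrow> s = single m 1) \<and>
     (\<forall>r. term_order r \<longrightarrow> much_more_expensive r S \<longrightarrow>
        (\<forall>m'\<in>keys s. (m', m) \<in> r \<and> (m \<notin> standard_pps \<longrightarrow> m' \<noteq> m)))"

text \<open>Replacing \<open>x\<^sub>j x\<^sub>j'\<close> by \<open>P\<^sub>j\<close> lowers the total degree in the \<open>x\<^sub>i'\<close>, so reduction terminates.\<close>

lemma ex_normal_form:
  fixes S :: "('n::finite, 'p::ab_group_add, 'f) seed"
  shows "\<exists>s. normal_form_of S m s"
proof (induction "\<Sum>j\<in>UNIV. lookup m (Vx' j)" arbitrary: m rule: less_induct)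
  case less
  let ?E = "exchange_ideal S"
  show ?case
  proof (cases "m \<in> standard_pps")
    case True
    then have "normal_form_of S m (single m 1)"
      by (auto simp: normal_form_of_def ideal_gen_closed(2) term_orderD(1))
    then show ?thesis ..
  next
    case False
    then obtain j m0 where m: "m = m0 + pair_pp j" by (rule not_standardE)
    let ?f = "formal_exchange_poly S j"
    have IH: "\<exists>s. normal_form_of S (m0 + n) s" if n: "n \<in> keys ?f" for n
    proof (rule less)
      have "lookup n (Vx' i) = 0" for i
        using formal_exchange_poly_unprimed[of S j] n by (simp add: unprimed_def)
      then have "(\<Sum>i\<in>UNIV. lookup (m0 + n) (Vx' i)) < (\<Sum>i\<in>UNIV. lookup m0 (Vx' i)) + (\<Sum>i\<in>UNIV. if j = i then 1 else 0)"
        by (simp add: lookup_add)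
      also have "\<dots> = (\<Sum>i\<in>UNIV. lookup m (Vx' i))"
        unfolding m sum.distrib[symmetric]
        by (intro sum.cong) (auto simp: lookup_add pair_pp_def lookup_single when_def)
      finally show "(\<Sum>i\<in>UNIV. lookup (m0 + n) (Vx' i)) < (\<Sum>i\<in>UNIV. lookup m (Vx' i))" .
    qed
    then obtain s where s: "\<And>n. n \<in> keys ?f \<Longrightarrow> normal_form_of S (m0 + n) (s n)" by metis
    define t where "t = (\<Sum>n\<in>keys ?f. single 0 (lookup ?f n) * s n)"
    have keys_t: "\<exists>n\<in>keys ?f. m' \<in> keys (s n)" if "m' \<in> keys t" for m'
      using that keys_sum_subset[of "\<lambda>n. single 0 (lookup ?f n) * s n" "keys ?f"] keys_scaled
      unfolding t_def by blast
    have "single m 1 - t = single m0 1 * exchange_relation S j +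
        (\<Sum>n\<in>keys ?f. single 0 (lookup ?f n) * (single (m0 + n) 1 - s n))"
    proof -
      have "single m0 1 * ?f = (\<Sum>n\<in>keys ?f. single 0 (lookup ?f n) * single (m0 + n) 1)"
        by (subst (1) poly_mapping_expand_scaled[of ?f])
          (simp add: sum_distrib_left mult_single)
      then show ?thesis
        by (simp add: t_def m exchange_relation_eq right_diff_distrib sum_subtractf mult_single)
    qed
    also have "\<dots> \<in> ?E"
    proof -
      have "exchange_relation S j \<in> ?E" by (rule ideal_gen_closed(1)) simp
      moreover have "single (m0 + n) 1 - s n \<in> ?E" if "n \<in> keys ?f" for n
        using s[OF that] unfolding normal_form_of_def by blast
      ultimately show ?thesis by (intro ideal_gen_closed(3,5,6))
    qed
    finally have in_E: "single m 1 - t \<in> ?E" .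
    have order: "(m', m) \<in> r \<and> m' \<noteq> m"
      if r: "term_order r" "much_more_expensive r S" and m': "m' \<in> keys t" for r m'
    proof -
      note o = term_orderD[OF r(1)]
      from keys_t[OF m'] obtain n where n: "n \<in> keys ?f" "m' \<in> keys (s n)" by blast
      have 1: "(m', m0 + n) \<in> r" using s[OF n(1)] r n(2) by (auto simp: normal_form_of_def)
      have "n \<noteq> pair_pp j" "(n, pair_pp j) \<in> r"
        using r(2) n(1) by (auto simp: much_more_expensive_def pair_pp_def Let_def)
      then have 2: "(m0 + n, m) \<in> r" "m0 + n \<noteq> m" unfolding m by (auto intro: o(5))
      show ?thesis using o(2)[OF 1 2(1)] o(3)[of "m0 + n" m] 1 2 by blast
    qed
    have "keys t \<subseteq> standard_pps"
    proof
      fix m' assume "m' \<in> keys t"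
      from keys_t[OF this] obtain n where "n \<in> keys ?f" "m' \<in> keys (s n)" by blast
      with s show "m' \<in> standard_pps" unfolding normal_form_of_def by blast
    qed
    then have "normal_form_of S m t"
      unfolding normal_form_of_def using in_E order False by blast
    then show ?thesis ..
  qed
qed

definition normal_form ::
    "('n::finite, 'p::ab_group_add, 'f) seed \<Rightarrow> ('n var, 'p group_ring) mpoly \<Rightarrow> ('n var, 'p group_ring) mpoly" where
  "normal_form S Q = (\<Sum>m\<in>keys Q. single 0 (lookup Q m) * (SOME s. normal_form_of S m s))"

lemma some_normal_form: "normal_form_of S m (SOME s. normal_form_of S m s)"
  using ex_normal_form by (rule someI_ex)

lemma keys_normal_form: "keys (normal_form S Q) \<subseteq> standard_pps"
proof -
  have "keys (normal_form S Q) \<subseteq> (\<Union>m\<in>keys Q. keys (SOME s. normal_form_of S m s))"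
    unfolding normal_form_def using keys_sum_subset keys_scaled by fastforce
  then show ?thesis using some_normal_form[of S] unfolding normal_form_of_def by blast
qed

lemma minus_normal_form: "Q - normal_form S Q \<in> exchange_ideal S"
proof -
  have "Q - normal_form S Q =
      (\<Sum>m\<in>keys Q. single 0 (lookup Q m) * (single m 1 - (SOME s. normal_form_of S m s)))"
    by (subst (1) poly_mapping_expand_scaled[of Q])
      (simp add: normal_form_def right_diff_distrib sum_subtractf)
  also have "\<dots> \<in> exchange_ideal S"
    using some_normal_form[of S] unfolding normal_form_of_def
    by (intro ideal_gen_closed(5,6)) blast
  finally show ?thesis .
qed

text \<open>The other terms of \<open>Q\<close> reduce to power products not above themselves, so
  none can produce the maximal \<open>m\<close>. Consequently a nonzero element with normal form 0
  has a nonstandard leading power product.\<close>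

lemma lookup_normal_form_leading:
  assumes r: "term_order r" "much_more_expensive r S" and m: "m \<in> keys Q" "m \<in> standard_pps"
    and max: "\<And>m'. m' \<in> keys Q \<Longrightarrow> (m', m) \<in> r"
  shows "lookup (normal_form S Q) m = lookup Q m"
proof -
  note o = term_orderD[OF r(1)]
  let ?s = "\<lambda>m. SOME s. normal_form_of S m s"
  have scale: "lookup (single 0 c * s) m = c * lookup s m" for c and s :: "('a var, 'b group_ring) mpoly"
    by (induction s rule: sum_single_induct)
      (simp_all add: mult_single lookup_single when_def distrib_left lookup_add)
  have "lookup (?s m') m = (if m' = m then 1 else 0)" if "m' \<in> keys Q" for m'
  proof (cases "m' = m")
    case True
    then have "?s m' = single m 1" using some_normal_form[of S m] m(2) unfolding normal_form_of_def by blast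
    then show ?thesis using True by simp
  next
    case False
    have "m \<notin> keys (?s m')"
    proof
      assume "m \<in> keys (?s m')"
      then have "(m, m') \<in> r" using some_normal_form[of S m'] r unfolding normal_form_of_def by blast
      then show False using max[OF that] o(3) False by blast
    qed
    then show ?thesis using False by (simp add: in_keys_iff)
  qed
  then have "lookup (normal_form S Q) m = (\<Sum>m'\<in>keys Q. if m' = m then lookup Q m' else 0)"
    unfolding normal_form_def lookup_sum scale by (intro sum.cong) auto
  also have "\<dots> = lookup Q m" using m(1) by (simp add: sum.delta)
  finally show ?thesis .
qed


section \<open>Standard monomials are independent\<close>

context
  fixes \<iota> :: "'p::ab_group_add group_ring \<Rightarrow> 'f::field" and S :: "('n::finite, 'p, 'f) seed"
  assumes \<iota>: "ring_embedding \<iota>" and seed: "is_seed \<iota> S"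
begin

abbreviation (input) "geval \<equiv> mp_eval \<iota> (generator \<iota> S)"

interpretation mp: character_ext \<iota> "pp_eval (generator \<iota> S)"
  by (rule mp_eval_character_ext[OF \<iota>])

lemma relation_ideal_closed:
  "0 \<in> relation_ideal \<iota> S"
  "P \<in> relation_ideal \<iota> S \<Longrightarrow> Q \<in> relation_ideal \<iota> S \<Longrightarrow> P + Q \<in> relation_ideal \<iota> S"
  "P \<in> relation_ideal \<iota> S \<Longrightarrow> Q \<in> relation_ideal \<iota> S \<Longrightarrow> P - Q \<in> relation_ideal \<iota> S"
  "P \<in> relation_ideal \<iota> S \<Longrightarrow> Q * P \<in> relation_ideal \<iota> S"
  by (simp_all add: relation_ideal_def mp_eval_eq_lin_ext mp.add mp.diff mp.mult)

lemma mp_eval_const: "geval (mp_const c) = \<iota> c"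
  by (simp add: mp_eval_eq_lin_ext mp_const_def pp_eval_zero)

lemma mp_eval_var: "geval (mp_var v) = generator \<iota> S v"
  using ring_embeddingD(2)[OF \<iota>] by (simp add: mp_eval_eq_lin_ext mp_var_def pp_eval_def)

lemma exchange_relation_in_relation_ideal: "exchange_relation S j \<in> relation_ideal \<iota> S"
proof -
  have "geval (formal_exchange_poly S j) = exchange_poly \<iota> (cluster S) S j"
    using mp_eval_const mp_eval_var[of "Vx _"]
    by (simp add: formal_exchange_poly_def exchange_poly_def mp_eval_eq_lin_ext mp.add mp.mult mp.prod mp.power)
  then have "geval (exchange_relation S j) =
      cluster S j * new_var \<iota> S j - exchange_poly \<iota> (cluster S) S j"
    using mp_eval_var[of "Vx j"] mp_eval_var[of "Vx' j"]
    by (simp add: exchange_relation_def mp_eval_eq_lin_ext mp.diff mp.mult)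
  then show ?thesis using is_seed_nonzero[OF \<iota> seed, of j] by (simp add: relation_ideal_def new_var_def)
qed

lemma ideal_gen_subset_relation_ideal:
  "exchange_ideal S \<subseteq> relation_ideal \<iota> S"
  using exchange_relation_in_relation_ideal
  by (intro ideal_gen_minimal) (auto intro: relation_ideal_closed)

lemma mp_eval_normal_form:
  "geval (normal_form S Q) = geval Q"
proof -
  have "Q - normal_form S Q \<in> relation_ideal \<iota> S"
    using minus_normal_form ideal_gen_subset_relation_ideal by blast
  then show ?thesis by (simp add: relation_ideal_def mp_eval_eq_lin_ext mp.diff)
qed

definition signed_exponent :: "'n var power_product \<Rightarrow> 'n \<Rightarrow> int" where
  "signed_exponent m j = int (lookup m (Vx j)) - int (lookup m (Vx' j))"

lemma signed_exponent_standard: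
  assumes "m \<in> standard_pps"
  shows "nat (signed_exponent m j) = lookup m (Vx j)" "nat (- signed_exponent m j) = lookup m (Vx' j)"
proof -
  have "lookup m (Vx j) = 0 \<or> lookup m (Vx' j) = 0" using assms by (simp add: standard_pps_def)
  then show "nat (signed_exponent m j) = lookup m (Vx j)" "nat (- signed_exponent m j) = lookup m (Vx' j)"
    by (auto simp: signed_exponent_def)
qed

lemma inj_signed_exponent: "inj_on signed_exponent standard_pps"
proof (rule inj_onI)
  fix m m' assume m: "m \<in> standard_pps" "m' \<in> standard_pps" "signed_exponent m = signed_exponent m'"
  have "lookup m v = lookup m' v" for v
    using signed_exponent_standard[OF m(1)] signed_exponent_standard[OF m(2)] m(3)
    by (cases v) metis+
  then show "m = m'" by (rule poly_mapping_eqI)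
qed

lemma pp_eval_generator:
  "pp_eval (generator \<iota> S) m =
    (\<Prod>j\<in>UNIV. cluster S j ^ lookup m (Vx j) * new_var \<iota> S j ^ lookup m (Vx' j))"
proof -
  have "keys m \<subseteq> range Vx \<union> range Vx'"
  proof
    fix v show "v \<in> range Vx \<union> range Vx'" by (cases v) auto
  qed
  then have "pp_eval (generator \<iota> S) m =
      (\<Prod>v\<in>range Vx \<union> range Vx'. generator \<iota> S v ^ lookup m v)"
    by (intro pp_eval_superset) auto
  also have "\<dots> = (\<Prod>v\<in>range Vx. generator \<iota> S v ^ lookup m v) * (\<Prod>v\<in>range Vx'. generator \<iota> S v ^ lookup m v)"
    by (rule prod.union_disjoint) auto
  also have "\<dots> = (\<Prod>j\<in>UNIV. cluster S j ^ lookup m (Vx j)) * (\<Prod>j\<in>UNIV. new_var \<iota> S j ^ lookup m (Vx' j))"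
    by (simp add: prod.reindex inj_def)
  finally show ?thesis by (simp add: prod.distrib)
qed

text \<open>Signed exponents embed the standard monomials into the Laurent exponents and turn
  \<open>Q\<close> into an element \<open>C\<close> whose standard expression has the value of
  \<open>Q\<close>. Injectivity of \<open>std_map\<close> rests on regularity alone, so the given
  coefficients serve without a lift.\<close>

theorem standard_monomials_independent:
  assumes "acyclic_seed S" and Q: "keys Q \<subseteq> standard_pps" "geval Q = 0"
  shows "Q = 0"
proof -
  have ind: "alg_independent (coeff_field \<iota>) (cluster S)" and skew: "sign_skew_symmetric (exch S)"
    using seed by (simp_all add: is_seed_def transcendence_basis_def)
  note nz = is_seed_nonzero[OF \<iota> seed]
  have ev: "laurent_eval (group_char \<iota>) (cluster S)" by (rule laurent_eval_group_char(2)[OF \<iota> nz])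
  interpret laurent_eval "group_char \<iota>" "cluster S" by (rule ev)
  let ?P = "lpoly (exch S) (pplus S) (pminus S)"
  obtain r where sys: "exchange_system ldeg r (pos_term (exch S) (pplus S)) (neg_term (exch S) (pminus S)) (\<lambda>_. True) UNIV"
    using acyclic_exchange_system[OF assms(1) skew] .
  have "c = 0" if "?P j * c = 0" for j c by (rule lpoly_regular[OF \<iota> ind that])
  then have reg: "regular_system (pos_term (exch S) (pplus S)) (neg_term (exch S) (pminus S)) (\<lambda>_. True) UNIV"
    unfolding regular_system_def lpoly_def by blast
  define I where "I = (SIGMA m:keys Q. keys (lookup Q m))"
  define e :: "'n var power_product \<times> 'p \<Rightarrow> ('p, 'n) exponent" where
    "e = (\<lambda>(m, p). (p, signed_exponent m))"
  define c where "c = (\<lambda>(m, p). lookup (lookup Q m) p)"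
  define C where "C = (\<Sum>s\<in>I. single (e s) (c s))"
  have I: "finite I" by (simp add: I_def)
  have e: "inj_on e I"
    using inj_signed_exponent Q(1) by (auto simp: inj_on_def e_def I_def subset_eq)
  have term_eval: "leval (group_char \<iota>) (cluster S) (std_map ldeg ?P UNIV (single (p, signed_exponent m) z)) =
      \<iota> (single p z) * pp_eval (generator \<iota> S) m" if "m \<in> standard_pps" for m p z
    unfolding leval_std_term[OF \<iota> ev refl refl]
    by (simp add: pp_eval_generator signed_exponent_standard[OF that] embedding_single[OF \<iota>] ldeg_def)
  have "leval (group_char \<iota>) (cluster S) (std_map ldeg ?P UNIV C) =
      (\<Sum>(m, p)\<in>I. \<iota> (single p (lookup (lookup Q m) p)) * pp_eval (generator \<iota> S) m)"
    unfolding C_def std_map_sum leval_sum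
    using Q(1) by (intro sum.cong) (auto simp: e_def c_def I_def term_eval subset_eq)
  also have "\<dots> = 0" using Q(2) unfolding mp_eval_double_sum[OF \<iota>] I_def .
  finally have "std_map ldeg ?P UNIV C = 0" by (rule leval_eq_0D[OF \<iota> ind])
  then have "C = 0" unfolding lpoly_def by (rule std_map_eq_0D[OF sys reg])
  have zero: "lookup (lookup Q m) p = 0" for m p
  proof (rule ccontr)
    assume "lookup (lookup Q m) p \<noteq> 0"
    then have mem: "(m, p) \<in> I" by (auto simp: I_def in_keys_iff)
    have "lookup C (e (m, p)) = c (m, p)"
      unfolding C_def by (rule lookup_sum_single_inj[OF I e mem])
    then show False using \<open>C = 0\<close> \<open>lookup (lookup Q m) p \<noteq> 0\<close> by (simp add: c_def)
  qed
  have "lookup Q m = 0" for m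
    by (rule poly_mapping_eqI) (simp only: zero lookup_zero)
  then show "Q = 0" by (intro poly_mapping_eqI) (simp only: lookup_zero)
qed

text \<open>The normal form of a relation is a combination of standard monomials with value 0, hence
  0.\<close>

lemma relation_ideal_eq:
  assumes "acyclic_seed S"
  shows "exchange_ideal S = relation_ideal \<iota> S"
proof
  show "relation_ideal \<iota> S \<subseteq> exchange_ideal S"
  proof
    fix Q assume "Q \<in> relation_ideal \<iota> S"
    then have "normal_form S Q = 0"
      using mp_eval_normal_form[of Q]
      by (intro standard_monomials_independent[OF assms keys_normal_form]) (simp add: relation_ideal_def)
    then show "Q \<in> exchange_ideal S" using minus_normal_form[of Q S] by simp
  qed
qed (rule ideal_gen_subset_relation_ideal)

section \<open>Leading terms and Groebner bases\<close>

lemma leading_ppI: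
  assumes "term_order r" "m \<in> keys p" "\<And>m'. m' \<in> keys p \<Longrightarrow> (m', m) \<in> r"
  shows "leading_pp r p = m"
  unfolding leading_pp_def
proof (rule the_equality)
  show "m \<in> keys p \<and> (\<forall>m'\<in>keys p. (m', m) \<in> r)" using assms(2,3) by blast
  fix n assume "n \<in> keys p \<and> (\<forall>m'\<in>keys p. (m', n) \<in> r)"
  then have "(m, n) \<in> r" "(n, m) \<in> r" using assms(2,3) by blast+
  then show "n = m" using term_orderD(3)[OF assms(1)] by blast
qed

lemma ex_leading_pp:
  assumes r: "term_order r" and "p \<noteq> 0"
  shows "\<exists>m\<in>keys p. \<forall>m'\<in>keys p. (m', m) \<in> r"
proof -
  note o = term_orderD[OF r]
  have main: "\<exists>m\<in>A. \<forall>m'\<in>A. (m', m) \<in> r" if "finite A" "A \<noteq> {}" for A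
    using that
  proof (induction A rule: finite_ne_induct)
    case (singleton m) then show ?case by (simp add: o(1))
  next
    case (insert n A)
    from insert.IH obtain m where m: "m \<in> A" "\<forall>m'\<in>A. (m', m) \<in> r" by blast
    show ?case
    proof (cases "(n, m) \<in> r")
      case True then show ?thesis using m by (intro bexI[of _ m]) simp_all
    next
      case False
      then have "(m, n) \<in> r" using o(4)[of m n] by simp
      have "(m', n) \<in> r" if "m' \<in> insert n A" for m'
      proof (cases "m' = n")
        case True then show ?thesis by (simp add: o(1))
      next
        case False
        then have "(m', m) \<in> r" using that m(2) by simp
        then show ?thesis using \<open>(m, n) \<in> r\<close> by (rule o(2))
      qed
      then show ?thesis by (intro bexI[of _ n]) simp_all
    qed
  qed
  have "keys p \<noteq> {}"
  proof
    assume "keys p = {}"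
    then have "lookup p m = 0" for m by (simp flip: not_in_keys_iff_lookup_eq_zero)
    then have "p = 0" by (intro poly_mapping_eqI) (simp only: lookup_zero)
    then show False using assms(2) by simp
  qed
  with finite_keys show ?thesis by (rule main)
qed

lemma leading_term_exchange_relation:
  assumes r: "term_order r" "much_more_expensive r S"
  shows "leading_term r (exchange_relation S j) = single (pair_pp j) 1"
proof -
  let ?f = "formal_exchange_poly S j"
  have f: "n \<noteq> pair_pp j" "(n, pair_pp j) \<in> r" if "n \<in> keys ?f" for n
    using r(2) that by (auto simp: much_more_expensive_def pair_pp_def Let_def)
  have lk: "lookup (exchange_relation S j) m = (1 when pair_pp j = m) - lookup ?f m" for m
    by (simp add: exchange_relation_eq lookup_minus lookup_single)
  have "pair_pp j \<notin> keys ?f" using f by blast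
  then have 1: "lookup (exchange_relation S j) (pair_pp j) = 1" by (simp add: lk in_keys_iff)
  have "leading_pp r (exchange_relation S j) = pair_pp j"
  proof (rule leading_ppI[OF r(1)])
    show "pair_pp j \<in> keys (exchange_relation S j)" using 1 by (simp add: in_keys_iff)
    fix m' assume "m' \<in> keys (exchange_relation S j)"
    then have "m' = pair_pp j \<or> m' \<in> keys ?f" by (auto simp: in_keys_iff lk when_def)
    then show "(m', pair_pp j) \<in> r" using f term_orderD(1)[OF r(1)] by blast
  qed
  moreover have "exchange_relation S j \<noteq> 0" using 1 by (metis lookup_zero zero_neq_one)
  ultimately show ?thesis by (simp add: leading_term_def 1)
qed

text \<open>A nonzero relation has normal form 0, so its leading power product is a multiple of some
  \<open>pair_pp j\<close>. The exchange relations have leading coefficient 1, so leading terms are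
  divisible even over the group ring.\<close>

lemma exchange_relations_groebner:
  assumes "acyclic_seed S" and r: "term_order r" "much_more_expensive r S"
  shows "groebner_basis r (range (exchange_relation S)) (relation_ideal \<iota> S)"
proof -
  let ?G = "range (exchange_relation S)" and ?I = "relation_ideal \<iota> S"
  have sub: "?G \<subseteq> ?I" using exchange_relation_in_relation_ideal by blast
  have "leading_term r Q \<in> ideal_gen (leading_term r ` ?G)" if Q: "Q \<in> ?I" for Q
  proof (cases "Q = 0")
    case True
    then show ?thesis by (simp add: leading_term_def ideal_gen_closed(2))
  next
    case False
    then obtain m where m: "m \<in> keys Q" "\<And>m'. m' \<in> keys Q \<Longrightarrow> (m', m) \<in> r"
      using ex_leading_pp[OF r(1) False] by blast
    have lead: "leading_term r Q = single m (lookup Q m)"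
      using leading_ppI[OF r(1) m] False by (simp add: leading_term_def)
    have "normal_form S Q = 0"
      using mp_eval_normal_form[of Q] Q
      by (intro standard_monomials_independent[OF assms(1) keys_normal_form]) (simp add: relation_ideal_def)
    then have "m \<notin> standard_pps"
      using lookup_normal_form_leading[OF r m(1) _ m(2)] m(1) by (auto simp: in_keys_iff)
    then obtain j m0 where m0: "m = m0 + pair_pp j" by (rule not_standardE)
    have "leading_term r Q = single m0 (lookup Q m) * leading_term r (exchange_relation S j)"
      by (simp add: lead leading_term_exchange_relation[OF r] mult_single m0)
    also have "\<dots> \<in> ideal_gen (leading_term r ` ?G)"
      by (intro ideal_gen_closed(5) ideal_gen_closed(1)) simp
    finally show ?thesis .
  qed
  then have "ideal_gen (leading_term r ` ?I) \<subseteq> ideal_gen (leading_term r ` ?G)"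
    by (intro ideal_gen_minimal) (auto intro: ideal_gen_closed)
  moreover have "ideal_gen (leading_term r ` ?G) \<subseteq> ideal_gen (leading_term r ` ?I)"
    unfolding ideal_gen_def by (intro module.span_mono[OF ring_module] image_mono sub)
  ultimately show ?thesis using sub by (simp add: groebner_basis_def)
qed

section \<open>The algebra generated by the variables of a seed and its neighbors\<close>

lemma lower_bound_eq_range:
  "lower_bound \<iota> S = range geval"
proof
  have "is_subalgebra \<iota> (range geval)"
    unfolding is_subalgebra_def
  proof (intro conjI ballI)
    show "range \<iota> \<subseteq> range geval"
    proof (rule image_subsetI)
      fix c
      show "\<iota> c \<in> range geval"
        using rangeI[of "geval" "mp_const c"] by (simp only: mp_eval_const)
    qed
    fix u v assume "u \<in> range geval" "v \<in> range geval"
    then obtain p q where pq: "u = geval p" "v = geval q" by blast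
    show "u + v \<in> range geval"
      by (rule image_eqI[of _ _ "p + q"]) (simp_all add: pq mp_eval_eq_lin_ext mp.add)
    show "u * v \<in> range geval"
      by (rule image_eqI[of _ _ "p * q"]) (simp_all add: pq mp_eval_eq_lin_ext mp.mult)
  qed
  moreover have "range (generator \<iota> S) \<subseteq> range geval"
  proof (rule image_subsetI)
    fix v
    show "generator \<iota> S v \<in> range geval"
      using rangeI[of "geval" "mp_var v"] by (simp only: mp_eval_var)
  qed
  ultimately show "lower_bound \<iota> S \<subseteq> range geval"
    by (intro hull_minimal)
  note L = subalgebra_closed[OF hull_is_subalgebra \<iota>]
  have gen: "generator \<iota> S v \<in> lower_bound \<iota> S" for v
    by (rule hull_inc) simp
  show "range geval \<subseteq> lower_bound \<iota> S"
  proof (rule image_subsetI)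
    fix Q
    have "pp_eval (generator \<iota> S) m \<in> lower_bound \<iota> S" for m
      unfolding pp_eval_def by (rule L(7)) (rule L(6)[OF gen])
    then show "geval Q \<in> lower_bound \<iota> S"
      unfolding mp_eval_def by (intro L(8)) (rule L(3)[OF L(1)])
  qed
qed

text \<open>Independence is first shown for the indexed family. A two-term relation with
  coefficients 1 and - 1 then gives injectivity, which transfers independence to the image
  set.\<close>

lemma standard_monomials_basis:
  assumes "acyclic_seed S"
  shows "is_basis_of \<iota> (pp_eval (generator \<iota> S)) standard_pps (lower_bound \<iota> S)"
proof -
  interpret m: module "\<lambda>c a. \<iota> c * a"
    by unfold_locales (simp_all add: ring_embeddingD[OF \<iota>] algebra_simps)
  let ?b = "pp_eval (generator \<iota> S)"
  have eval_sum: "geval (\<Sum>m\<in>M. single m (c m)) = (\<Sum>m\<in>M. \<iota> (c m) * ?b m)" for M c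
    by (simp add: mp_eval_eq_lin_ext mp.sum)
  have indep: "c m = 0" if M: "finite M" "M \<subseteq> standard_pps" "(\<Sum>m\<in>M. \<iota> (c m) * ?b m) = 0" "m \<in> M" for M c m
  proof -
    have "keys (\<Sum>m\<in>M. single m (c m)) \<subseteq> standard_pps"
      using keys_sum_subset[of "\<lambda>m. single m (c m)" M] M(2) by (auto split: if_splits)
    then have "(\<Sum>m\<in>M. single m (c m)) = 0"
      using M(3) by (intro standard_monomials_independent[OF assms]) (simp_all add: eval_sum)
    then show ?thesis using lookup_sum_single_inj[of M id m c] M(1,4) by simp
  qed
  have inj: "inj_on ?b standard_pps"
  proof (rule inj_onI, rule ccontr)
    fix m m' assume m: "m \<in> standard_pps" "m' \<in> standard_pps" "?b m = ?b m'" "m \<noteq> m'"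
    have "\<iota> (- 1) = - 1" using ring_embedding_of_int[OF \<iota>, of "- 1"] by simp
    then have "(\<Sum>n\<in>{m, m'}. \<iota> (if n = m then 1 else - 1) * ?b n) = 0"
      using m(3,4) ring_embeddingD(2)[OF \<iota>] by simp
    from indep[OF _ _ this, of m] m(1,2) show False by simp
  qed
  have "\<not> m.dependent (?b ` standard_pps)"
    unfolding m.dependent_explicit
  proof (intro notI, elim exE conjE bexE)
    fix t u v assume t: "finite t" "t \<subseteq> ?b ` standard_pps" "(\<Sum>v\<in>t. \<iota> (u v) * v) = 0" "v \<in> t" "u v \<noteq> 0"
    then obtain M where M: "M \<subseteq> standard_pps" "t = ?b ` M" by (meson subset_image_iff)
    have injM: "inj_on ?b M" using inj M(1) by (rule inj_on_subset)
    then have fin: "finite M" using t(1) M(2) finite_image_iff by blast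
    have sum0: "(\<Sum>m\<in>M. \<iota> (u (?b m)) * ?b m) = 0"
      using t(3) unfolding M(2) by (simp add: sum.reindex[OF injM])
    have "u (?b m) = 0" if "m \<in> M" for m by (rule indep[OF fin M(1) sum0 that])
    then show False using t(4,5) M(2) by blast
  qed
  moreover have "m.span (?b ` standard_pps) = lower_bound \<iota> S"
  proof
    show "lower_bound \<iota> S \<subseteq> m.span (?b ` standard_pps)"
      unfolding lower_bound_eq_range
    proof (rule image_subsetI)
      fix Q
      have "geval (normal_form S Q) \<in> m.span (?b ` standard_pps)"
        unfolding mp_eval_def using keys_normal_form[of S Q]
        by (intro m.span_sum m.span_scale m.span_base) blast
      then show "geval Q \<in> m.span (?b ` standard_pps)"
        by (simp add: mp_eval_normal_form)
    qed
    note L = subalgebra_closed[OF hull_is_subalgebra[of \<iota> "range (generator \<iota> S)"] \<iota>]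
    have "?b m = geval (single m 1)" for m
      using ring_embeddingD(2)[OF \<iota>] by (simp add: mp_eval_eq_lin_ext)
    then have "?b m \<in> lower_bound \<iota> S" for m
      unfolding lower_bound_eq_range by simp
    then show "m.span (?b ` standard_pps) \<subseteq> lower_bound \<iota> S"
      by (intro m.span_minimal) (auto simp: m.subspace_def L)
  qed
  ultimately show ?thesis using inj by (simp add: is_basis_of_def)
qed

end


section \<open>The cluster algebra of an acyclic seed\<close>

lemma cluster_algebra_eq:
  assumes \<iota>: "ring_embedding \<iota>" and S: "is_seed \<iota> S" "totally_mutable S" "acyclic_seed S"
  shows "cluster_algebra \<iota> S = lower_bound \<iota> S"
proof
  show "cluster_algebra \<iota> S \<subseteq> lower_bound \<iota> S"
    unfolding cluster_algebra_def
  proof (rule hull_minimal)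
    have "cluster S' i \<in> lower_bound \<iota> S"
      if "seed_mutation_equiv \<iota> S S'" for S' i
      by (rule cluster_variable_in_lower_bound[OF \<iota> S(1,3) that])
    then show "(\<Union>S'\<in>{S'. seed_mutation_equiv \<iota> S S'}. range (cluster S')) \<subseteq>
        lower_bound \<iota> S" by blast
  qed (rule hull_is_subalgebra)
  have var: "cluster S' i \<in> cluster_algebra \<iota> S" if "seed_mutation_equiv \<iota> S S'" for S' i
    unfolding cluster_algebra_def by (rule hull_inc) (use that in blast)
  have "seed_mutation_equiv \<iota> S S" by (simp add: seed_mutation_equiv_def equivclp_def)
  then have x: "cluster S j \<in> cluster_algebra \<iota> S" for j by (rule var)
  \<comment> \<open>Total mutability makes the mutated matrix sign-skew-symmetric, so an adjacent
    seed exists whose \<open>k\<close>-th variable is this element.\<close>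
  have x': "new_var \<iota> S k \<in> cluster_algebra \<iota> S" for k
  proof -
    have "matrix_mutation_equiv (exch S) (matrix_mutation k (exch S))"
      unfolding matrix_mutation_equiv_def by (rule r_into_equivclp) blast
    then have "sign_skew_symmetric (matrix_mutation k (exch S))"
      using S(2) unfolding totally_mutable_def by blast
    then obtain S' where S': "seed_mutation \<iota> k S S'" using ex_seed_mutation[OF \<iota> S(1)] by blast
    then have "seed_mutation_equiv \<iota> S S'"
      unfolding seed_mutation_equiv_def by (intro r_into_equivclp) blast
    from var[OF this, of k] show ?thesis using S' by (simp add: seed_mutation_def)
  qed
  have "generator \<iota> S v \<in> cluster_algebra \<iota> S" for v using x x' by (cases v) simp_all
  then show "lower_bound \<iota> S \<subseteq> cluster_algebra \<iota> S"
    unfolding cluster_algebra_def by (intro hull_minimal hull_is_subalgebra) blast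
qed

theorem corollary1p21:
  fixes \<iota> :: "'p::ab_group_add group_ring \<Rightarrow> 'f::field"
    and S :: "('n::finite, 'p, 'f) seed"
  assumes "torsion_free TYPE('p)"
    and "ambient_field TYPE('n) \<iota>"
    and "is_seed \<iota> S"
    and "totally_mutable S"
    and "acyclic_seed S"
  shows "cluster_algebra \<iota> S = is_subalgebra \<iota> hull (range (generator \<iota> S)) \<and>
    is_basis_of \<iota> (pp_eval (generator \<iota> S)) standard_pps (cluster_algebra \<iota> S) \<and>
    ideal_gen (range (exchange_relation S)) = relation_ideal \<iota> S \<and>
    (\<forall>r. term_order r \<longrightarrow> much_more_expensive r S \<longrightarrow>
       groebner_basis r (range (exchange_relation S)) (relation_ideal \<iota> S))"
proof -
  have \<iota>: "ring_embedding \<iota>" using assms(2) by (simp add: ambient_field_def)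
  have "cluster_algebra \<iota> S = is_subalgebra \<iota> hull (range (generator \<iota> S))"
    by (rule cluster_algebra_eq[OF \<iota> assms(3-5)])
  then show ?thesis
    using standard_monomials_basis[OF \<iota> assms(3,5)] relation_ideal_eq[OF \<iota> assms(3,5)]
      exchange_relations_groebner[OF \<iota> assms(3,5)] by simp
qed

end
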